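(* Let $n\ge1$, let $\mathcal{H}$ be a Hilbert space and let $T\in\mathbb{S}_n^B(\mathcal{H})$ be a Beurling tuple. Then the operator-valued analytic function $\Theta_T:\mathbb{D}^n\to\mathcal{B}(\boldsymbol{\mathcal{D}}_T,\mathcal{D}_{T^*})$ determined by $$\Theta_T(w)\boldsymbol{D}_T\tilde h=\sum_{i=1}^n\Big(\Big[\prod_{j\neq i}\Delta_{M_{z_j},T_j}(M_{z_i}\Pi_T-\Pi_TT_i)\Big]h_i\Big)(w)\qquad(w\in\mathbb{D}^n,\ \tilde h=(h_1,\dots,h_n)^t\in\mathcal{H}^n)$$ is given by $$\Theta_T(w)\boldsymbol{D}_T\tilde h=D_{T^*}\prod_{k=1}^n(I_{\mathcal{H}}-w_kT_k^* )^{-1}\sum_{j=1}^n(w_jI_{\mathcal{H}}-T_j)\prod_{i\in I_n\setminus\{j\}}(I_{\mathcal{H}}-w_iT_i^* )h_j$$ for all $w\in\mathbb{D}^n$ and $\tilde h\in\mathcal{H}^n$. Moreover, $T\cong C_{\mathcal{Q}_{\Theta_T}}$, where $C_{\mathcal{Q}_{\Theta_T}}=(P_{\mathcal{Q}_{\Theta_T}}M_{z_1}|_{\mathcal{Q}_{\Theta_T}},\dots,P_{\mathcal{Q}_{\Theta_T}}M_{z_n}|_{\mathcal{Q}_{\Theta_T}})$ is the tuple of model operators on $$\mathcal{Q}_{\Theta_T}=H^2_{\mathcal{D}_{T^*}}(\mathbb{D}^n)\ominus\Theta_TH^2_{\boldsymbol{\mathcal{D}}_T}(\mathbb{D}^n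).$$
   Context: Hilbert spaces are complex and separable (zero allowed); $I_n=\{1,\dots,n\}$. For a contraction $X$, $D_X=(I-X^*X)^{1/2}$; $X\in C_{\cdot0}$ means $X^{*m}\to0$ strongly. For a commuting $n$-tuple of contractions $T$ on $\mathcal{H}$ let $\mathbb{S}_n^{-1}(T,T^* )=\sum_{k\in\{0,1\}^n}(-1)^{|k|}T^kT^{*k}$, $T^k=T_1^{k_1}\cdots T_n^{k_n}$, $T^{*k}=T_1^{*k_1}\cdots T_n^{*k_n}$, $|k|=\sum_ik_i$. $T$ is a Szegő tuple if $\mathbb{S}_n^{-1}(T,T^* )\ge0$ and all $T_i\in C_{\cdot0}$; it is a Beurling tuple, $T\in\mathbb{S}_n^B(\mathcal{H})$, if moreover $D_{T_i}D_{T_j}=0$ for all $i\ne j$. First defect operator: $D_{T^*}=(\mathbb{S}_n^{-1}(T,T^* ))^{1/2}$, $\mathcal{D}_{T^*}=\overline{\mathrm{ran}}\,D_{T^*}$. $H^2_{\mathcal{E}}(\mathbb{D}^n)$ is the $\mathcal{E}$-valued Hardy space, with coordinate multiplications $M_{z_i}$. The canonical dilation $\Pi_T:\mathcal{H}\to H^2_{\mathcal{D}_{T^*}}(\mathbb{D}^n)$ is $(\Pi_Th)(w)=D_{T^*}\prod_{i=1}^n(I_{\mathcal{H}}-w_iT_i^* )^{-1}h$ (known to be a well-defined isometry with $\Pi_TT_i^*=M_{z_i}^*\Pi_T$). For bounded $X:\mathcal{H}\to H^2_{\mathcal{D}_{T^*}}(\mathbb{D}^n)$ put $\Delta_{M_{z_j},T_j}(X)=X-M_{z_j}XT_j^*$.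 Joint defect operator: with $\Delta_X(A)=XAX^*$ and $[A,B]=AB-BA$, set $D_{j,T}^2=\prod_{k\in I_n\setminus\{j\}}(I-\Delta_{T_k})(D_{T_j}^2)$ and, for $i\ne j$, $\delta_{ij}(T)=\prod_{k\in I_n\setminus\{i,j\}}(I-\Delta_{T_k})([T_j,T_i^*])$. Products of maps on operators are compositions (empty product = identity). $\boldsymbol{D}_T^2$ is the operator on $\mathcal{H}^n$ with $(j,j)$ entry $D_{j,T}^2$ and $(i,j)$ entry $\delta_{ij}(T)$, $i\neq j$; it is non-negative for Beurling tuples, $\boldsymbol{D}_T$ is its non-negative square root and $\boldsymbol{\mathcal{D}}_T=\overline{\mathrm{ran}}\,\boldsymbol{D}_T\subseteq\mathcal{H}^n$. The first displayed formula is known to give a well-defined inner function, i.e. a bounded analytic $\Theta_T$ with $\Theta_T(z)^*\Theta_T(z)=I$ for a.e. $z\in\mathbb{T}^n$. $X\cong Y$ for tuples means there is a unitary $U$ with $UX_iU^*=Y_i$ for all $i$. $P_{\mathcal{Q}}$ is the orthogonal projection onto $\mathcal{Q}$. *)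

theory Defs
  imports "HOL-Analysis.Analysis"
begin

section \<open>Complex Hilbert spaces\<close>

text \<open>
  The complex inner product is linear in its first argument. Positivity and the relation to the
  norm are inherited from the underlying real inner product, which is the real part of the
  complex one.
\<close>

class complex_inner = real_inner +
  fixes scaleC :: "complex \<Rightarrow> 'a \<Rightarrow> 'a"  (infixr "*\<^sub>C" 75)
    and cinner :: "'a \<Rightarrow> 'a \<Rightarrow> complex"
  assumes scaleC_add_right: "c *\<^sub>C (x + y) = c *\<^sub>C x + c *\<^sub>C y"
    and scaleC_add_left: "(c + d) *\<^sub>C x = c *\<^sub>C x + d *\<^sub>C x"
    and scaleC_scaleC: "c *\<^sub>C d *\<^sub>C x = (c * d) *\<^sub>C x"
    and scaleR_scaleC: "r *\<^sub>R x = complex_of_real r *\<^sub>C x"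
    and cinner_commute: "cinner x y = cnj (cinner y x)"
    and cinner_add_left: "cinner (x + y) z = cinner x z + cinner y z"
    and cinner_scaleC_left: "cinner (c *\<^sub>C x) y = c * cinner x y"
    and inner_eq_Re_cinner: "inner x y = Re (cinner x y)"

text \<open>Complex Hilbert spaces with a countable dense subset; the zero space is not excluded.\<close>

class chilbert_space = complex_inner + complete_space +
  assumes separable: "\<exists>S. countable S \<and> (\<forall>x. \<forall>e>0. \<exists>s\<in>S. dist s x < e)"

instantiation vec :: (complex_inner, finite) complex_inner
begin

definition scaleC_vec :: "complex \<Rightarrow> 'a ^ 'b \<Rightarrow> 'a ^ 'b" where
  "scaleC_vec c x = (\<chi> i. c *\<^sub>C (x $ i))"

definition cinner_vec :: "'a ^ 'b \<Rightarrow> 'a ^ 'b \<Rightarrow> complex" where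
  "cinner_vec x y = (\<Sum>i\<in>UNIV. cinner (x $ i) (y $ i))"

instance
proof
  fix c d :: complex and r :: real and x y z :: "'a ^ 'b"
  show "c *\<^sub>C (x + y) = c *\<^sub>C x + c *\<^sub>C y"
    by (simp add: scaleC_vec_def vec_eq_iff scaleC_add_right)
  show "(c + d) *\<^sub>C x = c *\<^sub>C x + d *\<^sub>C x"
    by (simp add: scaleC_vec_def vec_eq_iff scaleC_add_left)
  show "c *\<^sub>C d *\<^sub>C x = (c * d) *\<^sub>C x"
    by (simp add: scaleC_vec_def vec_eq_iff scaleC_scaleC)
  show "r *\<^sub>R x = complex_of_real r *\<^sub>C x"
    by (simp add: scaleC_vec_def vec_eq_iff scaleR_scaleC)
  show "cinner x y = cnj (cinner y x)"
    unfolding cinner_vec_def cnj_sum by (rule sum.cong) (auto intro: cinner_commute)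
  show "cinner (x + y) z = cinner x z + cinner y z"
    by (simp add: cinner_vec_def cinner_add_left sum.distrib)
  show "cinner (c *\<^sub>C x) y = c * cinner x y"
    by (simp add: cinner_vec_def scaleC_vec_def cinner_scaleC_left sum_distrib_left)
  show "inner x y = Re (cinner x y)"
    by (simp add: cinner_vec_def inner_vec_def inner_eq_Re_cinner)
qed

end

section \<open>Operators\<close>

definition bounded_clinear :: "('a::complex_inner \<Rightarrow> 'b::complex_inner) \<Rightarrow> bool" where
  "bounded_clinear A \<longleftrightarrow> bounded_linear A \<and> (\<forall>c x. A (c *\<^sub>C x) = c *\<^sub>C A x)"

definition cadjoint :: "('a::complex_inner \<Rightarrow> 'b::complex_inner) \<Rightarrow> 'b \<Rightarrow> 'a" where
  "cadjoint A = (THE B. \<forall>x y. cinner (A x) y = cinner x (B y))"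

definition nonneg_op :: "('a::complex_inner \<Rightarrow> 'a) \<Rightarrow> bool" where
  "nonneg_op A \<longleftrightarrow> bounded_clinear A \<and> (\<forall>x. cinner (A x) x \<in> \<real>\<^sub>\<ge>\<^sub>0)"

definition op_sqrt :: "('a::complex_inner \<Rightarrow> 'a) \<Rightarrow> 'a \<Rightarrow> 'a" where
  "op_sqrt A = (THE S. nonneg_op S \<and> S \<circ> S = A)"

text \<open>
  Composition of a finite family of pairwise commuting maps (for which the result of the fold does
  not depend on the order). It is used both for operators and for maps acting on operators.
\<close>

definition op_prod :: "('i \<Rightarrow> 'b \<Rightarrow> 'b) \<Rightarrow> 'i set \<Rightarrow> 'b \<Rightarrow> 'b" where
  "op_prod F I = Finite_Set.fold (\<lambda>i G. F i \<circ> G) id I"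

definition contractive_op :: "('a::complex_inner \<Rightarrow> 'a) \<Rightarrow> bool" where
  "contractive_op X \<longleftrightarrow> bounded_clinear X \<and> (\<forall>x. norm (X x) \<le> norm x)"

definition defect :: "('a::complex_inner \<Rightarrow> 'a) \<Rightarrow> 'a \<Rightarrow> 'a" where
  "defect X = op_sqrt (\<lambda>x. x - cadjoint X (X x))"

text \<open>The class $C_{\cdot 0}$.\<close>

definition C_dot_0 :: "('a::complex_inner \<Rightarrow> 'a) \<Rightarrow> bool" where
  "C_dot_0 X \<longleftrightarrow> (\<forall>x. (\<lambda>m. (cadjoint X ^^ m) x) \<longlonglongrightarrow> 0)"

section \<open>Szego and Beurling tuples\<close>

text \<open>An \<open>n\<close>-tuple is indexed by a finite type \<open>'n\<close> with \<open>n = CARD('n) \<ge> 1\<close> elements.\<close>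

definition commuting_contractions :: "('n::finite \<Rightarrow> 'h::complex_inner \<Rightarrow> 'h) \<Rightarrow> bool" where
  "commuting_contractions T \<longleftrightarrow>
     (\<forall>i. contractive_op (T i)) \<and> (\<forall>i j. T i \<circ> T j = T j \<circ> T i)"

definition tuple_pow :: "('n::finite \<Rightarrow> 'h \<Rightarrow> 'h) \<Rightarrow> ('n \<Rightarrow> nat) \<Rightarrow> 'h \<Rightarrow> 'h" where
  "tuple_pow T k = op_prod (\<lambda>i. T i ^^ k i) UNIV"

definition szego_inv :: "('n::finite \<Rightarrow> 'h::complex_inner \<Rightarrow> 'h) \<Rightarrow> 'h \<Rightarrow> 'h" where
  "szego_inv T x =
     (\<Sum>k \<in> (UNIV :: 'n set) \<rightarrow> {0, 1}.
        (- 1) ^ (\<Sum>i\<in>UNIV. k i) *\<^sub>R tuple_pow T k (tuple_pow (\<lambda>i. cadjoint (T i)) k x))"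

definition szego_tuple :: "('n::finite \<Rightarrow> 'h::complex_inner \<Rightarrow> 'h) \<Rightarrow> bool" where
  "szego_tuple T \<longleftrightarrow>
     commuting_contractions T \<and> nonneg_op (szego_inv T) \<and> (\<forall>i. C_dot_0 (T i))"

definition beurling_tuple :: "('n::finite \<Rightarrow> 'h::complex_inner \<Rightarrow> 'h) \<Rightarrow> bool" where
  "beurling_tuple T \<longleftrightarrow>
     szego_tuple T \<and> (\<forall>i j. i \<noteq> j \<longrightarrow> defect (T i) \<circ> defect (T j) = (\<lambda>x. 0))"

section \<open>First and joint defect operators\<close>

text \<open>$D_{T^*}$ and $\mathcal{D}_{T^*}$.\<close>

definition first_defect :: "('n::finite \<Rightarrow> 'h::complex_inner \<Rightarrow> 'h) \<Rightarrow> 'h \<Rightarrow> 'h" where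
  "first_defect T = op_sqrt (szego_inv T)"

definition first_defect_space :: "('n::finite \<Rightarrow> 'h::complex_inner \<Rightarrow> 'h) \<Rightarrow> 'h set" where
  "first_defect_space T = closure (range (first_defect T))"

text \<open>$I - \Delta_X$, where $\Delta_X(A) = XAX^*$.\<close>

definition id_minus_conj ::
    "('h::complex_inner \<Rightarrow> 'h) \<Rightarrow> ('h \<Rightarrow> 'h) \<Rightarrow> 'h \<Rightarrow> 'h" where
  "id_minus_conj X A = (\<lambda>x. A x - X (A (cadjoint X x)))"

text \<open>$D_{j,T}^2$ and $\delta_{ij}(T)$.\<close>

definition defect_diag :: "('n::finite \<Rightarrow> 'h::complex_inner \<Rightarrow> 'h) \<Rightarrow> 'n \<Rightarrow> 'h \<Rightarrow> 'h" where
  "defect_diag T j =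
     op_prod (\<lambda>k. id_minus_conj (T k)) (UNIV - {j}) (defect (T j) \<circ> defect (T j))"

definition defect_offdiag ::
    "('n::finite \<Rightarrow> 'h::complex_inner \<Rightarrow> 'h) \<Rightarrow> 'n \<Rightarrow> 'n \<Rightarrow> 'h \<Rightarrow> 'h" where
  "defect_offdiag T i j =
     op_prod (\<lambda>k. id_minus_conj (T k)) (UNIV - {i, j})
       (\<lambda>x. T j (cadjoint (T i) x) - cadjoint (T i) (T j x))"

text \<open>$\boldsymbol{D}_T^2$, $\boldsymbol{D}_T$ and $\boldsymbol{\mathcal{D}}_T$.\<close>

definition joint_defect_sq ::
    "('n::finite \<Rightarrow> 'h::complex_inner \<Rightarrow> 'h) \<Rightarrow> 'h ^ 'n \<Rightarrow> 'h ^ 'n" where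
  "joint_defect_sq T h =
     (\<chi> i. \<Sum>j\<in>UNIV. (if i = j then defect_diag T j else defect_offdiag T i j) (h $ j))"

definition joint_defect ::
    "('n::finite \<Rightarrow> 'h::complex_inner \<Rightarrow> 'h) \<Rightarrow> 'h ^ 'n \<Rightarrow> 'h ^ 'n" where
  "joint_defect T = op_sqrt (joint_defect_sq T)"

definition joint_defect_space ::
    "('n::finite \<Rightarrow> 'h::complex_inner \<Rightarrow> 'h) \<Rightarrow> ('h ^ 'n) set" where
  "joint_defect_space T = closure (range (joint_defect T))"

section \<open>Vector-valued Hardy spaces on the polydisc\<close>

definition polydisc :: "(complex ^ 'n) set" where
  "polydisc = {w. \<forall>i. norm (w $ i) < 1}"

definition mpow :: "complex ^ 'n::finite \<Rightarrow> ('n \<Rightarrow> nat) \<Rightarrow> complex" where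
  "mpow w k = (\<Prod>i\<in>UNIV. (w $ i) ^ k i)"

definition taylor_coeffs ::
    "(complex ^ 'n::finite \<Rightarrow> 'a::complex_inner) \<Rightarrow> (('n \<Rightarrow> nat) \<Rightarrow> 'a) \<Rightarrow> bool" where
  "taylor_coeffs f a \<longleftrightarrow> (\<forall>w\<in>polydisc. ((\<lambda>k. mpow w k *\<^sub>C a k) has_sum f w) UNIV)"

text \<open>
  For a closed subspace \<open>E\<close> of the ambient space, \<open>hardy E\<close> is the set of \<open>E\<close>-valued analytic
  functions on the polydisc with square-summable Taylor coefficients. To have unique
  representatives, functions are set to zero outside the polydisc.
\<close>

definition hardy :: "'a::complex_inner set \<Rightarrow> (complex ^ 'n::finite \<Rightarrow> 'a) set" where
  "hardy E = {f. (\<forall>w. w \<notin> polydisc \<longrightarrow> f w = 0) \<and>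
     (\<exists>a. (\<forall>k. a k \<in> E) \<and> (\<lambda>k. (norm (a k))\<^sup>2) summable_on UNIV \<and> taylor_coeffs f a)}"

definition hardy_inner ::
    "(complex ^ 'n::finite \<Rightarrow> 'a::complex_inner) \<Rightarrow> (complex ^ 'n \<Rightarrow> 'a) \<Rightarrow> complex" where
  "hardy_inner f g =
     (\<Sum>\<^sub>\<infinity>k. cinner ((THE a. taylor_coeffs f a) k) ((THE b. taylor_coeffs g b) k))"

definition hardy_ominus ::
    "(complex ^ 'n::finite \<Rightarrow> 'a::complex_inner) set \<Rightarrow> (complex ^ 'n \<Rightarrow> 'a) set \<Rightarrow>
     (complex ^ 'n \<Rightarrow> 'a) set" where
  "hardy_ominus H S = {f \<in> H. \<forall>g\<in>S. hardy_inner f g = 0}"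

definition hardy_proj ::
    "(complex ^ 'n::finite \<Rightarrow> 'a::complex_inner) set \<Rightarrow> (complex ^ 'n \<Rightarrow> 'a) \<Rightarrow>
     complex ^ 'n \<Rightarrow> 'a" where
  "hardy_proj Q f = (THE g. g \<in> Q \<and> (\<forall>q\<in>Q. hardy_inner (\<lambda>w. f w - g w) q = 0))"

definition Mz ::
    "'n::finite \<Rightarrow> (complex ^ 'n \<Rightarrow> 'a::complex_inner) \<Rightarrow> complex ^ 'n \<Rightarrow> 'a" where
  "Mz i f = (\<lambda>w. (w $ i) *\<^sub>C f w)"

section \<open>Operator-valued analytic functions\<close>

text \<open>
  \<open>ops D E\<close> represents $\mathcal{B}(D,E)$ for closed subspaces \<open>D\<close>, \<open>E\<close> of the ambient spaces; an
  operator on \<open>D\<close> is set to zero outside \<open>D\<close>.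
\<close>

definition ops ::
    "'a::complex_inner set \<Rightarrow> 'b::complex_inner set \<Rightarrow> ('a \<Rightarrow> 'b) set" where
  "ops D E = {A. A ` D \<subseteq> E \<and>
     (\<forall>x\<in>D. \<forall>y\<in>D. A (x + y) = A x + A y) \<and> (\<forall>c. \<forall>x\<in>D. A (c *\<^sub>C x) = c *\<^sub>C A x) \<and>
     (\<exists>K. \<forall>x\<in>D. norm (A x) \<le> K * norm x) \<and> (\<forall>x. x \<notin> D \<longrightarrow> A x = 0)}"

text \<open>
  Analyticity on the polydisc means expansion into a power series with coefficients in
  $\mathcal{B}(D,E)$. Pointwise convergence of the series on all of the polydisc already forces
  absolute convergence in the operator norm, since \<open>D\<close> is complete.
\<close>

definition op_analytic ::
    "'a::complex_inner set \<Rightarrow> 'b::complex_inner set \<Rightarrow> (complex ^ 'n::finite \<Rightarrow> 'a \<Rightarrow> 'b) \<Rightarrow> bool"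
  where
  "op_analytic D E \<Theta> \<longleftrightarrow>
     (\<forall>w\<in>polydisc. \<Theta> w \<in> ops D E) \<and> (\<forall>w. w \<notin> polydisc \<longrightarrow> \<Theta> w = (\<lambda>x. 0)) \<and>
     (\<exists>C. (\<forall>k. C k \<in> ops D E) \<and>
        (\<forall>w\<in>polydisc. \<forall>x\<in>D. ((\<lambda>k. mpow w k *\<^sub>C C k x) has_sum \<Theta> w x) UNIV))"

definition op_mult ::
    "(complex ^ 'n::finite \<Rightarrow> 'a \<Rightarrow> 'b) \<Rightarrow> (complex ^ 'n \<Rightarrow> 'a) \<Rightarrow> complex ^ 'n \<Rightarrow> 'b" where
  "op_mult \<Theta> g = (\<lambda>w. \<Theta> w (g w))"

section \<open>Canonical dilation and the analytic function of a tuple\<close>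

text \<open>$I - w_i T_i^*$.\<close>

definition pencil ::
    "('n::finite \<Rightarrow> 'h::complex_inner \<Rightarrow> 'h) \<Rightarrow> complex ^ 'n \<Rightarrow> 'n \<Rightarrow> 'h \<Rightarrow> 'h" where
  "pencil T w i = (\<lambda>x. x - (w $ i) *\<^sub>C cadjoint (T i) x)"

definition canonical_dilation ::
    "('n::finite \<Rightarrow> 'h::complex_inner \<Rightarrow> 'h) \<Rightarrow> 'h \<Rightarrow> complex ^ 'n \<Rightarrow> 'h" where
  "canonical_dilation T h w =
     (if w \<in> polydisc then first_defect T (op_prod (\<lambda>i. inv (pencil T w i)) UNIV h) else 0)"

text \<open>$\Delta_{M_{z_j},T_j}(X) = X - M_{z_j} X T_j^*$.\<close>

definition Delta_MT ::
    "('n::finite \<Rightarrow> 'h::complex_inner \<Rightarrow> 'h) \<Rightarrow> 'n \<Rightarrow>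
     ('h \<Rightarrow> complex ^ 'n \<Rightarrow> 'h) \<Rightarrow> 'h \<Rightarrow> complex ^ 'n \<Rightarrow> 'h" where
  "Delta_MT T j X = (\<lambda>h w. X h w - Mz j (X (cadjoint (T j) h)) w)"

definition is_char_fun ::
    "('n::finite \<Rightarrow> 'h::complex_inner \<Rightarrow> 'h) \<Rightarrow> (complex ^ 'n \<Rightarrow> 'h ^ 'n \<Rightarrow> 'h) \<Rightarrow> bool" where
  "is_char_fun T \<Theta> \<longleftrightarrow>
     op_analytic (joint_defect_space T) (first_defect_space T) \<Theta> \<and>
     (\<forall>w\<in>polydisc. \<forall>h. \<Theta> w (joint_defect T h) =
        (\<Sum>i\<in>UNIV. op_prod (Delta_MT T) (UNIV - {i})
           (\<lambda>x z. Mz i (canonical_dilation T x) z - canonical_dilation T (T i x) z) (h $ i) w))"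

definition char_fun ::
    "('n::finite \<Rightarrow> 'h::complex_inner \<Rightarrow> 'h) \<Rightarrow> complex ^ 'n \<Rightarrow> 'h ^ 'n \<Rightarrow> 'h" where
  "char_fun T = (THE \<Theta>. is_char_fun T \<Theta>)"

section \<open>Model space, model operators and unitary equivalence\<close>

definition model_space ::
    "('n::finite \<Rightarrow> 'h::complex_inner \<Rightarrow> 'h) \<Rightarrow> (complex ^ 'n \<Rightarrow> 'h) set" where
  "model_space T =
     hardy_ominus (hardy (first_defect_space T))
       (op_mult (char_fun T) ` hardy (joint_defect_space T))"

text \<open>The compression of $M_{z_i}$ to \<open>Q\<close>; only its values on \<open>Q\<close> matter.\<close>

definition model_op ::
    "(complex ^ 'n::finite \<Rightarrow> 'a::complex_inner) set \<Rightarrow> 'n \<Rightarrow>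
     (complex ^ 'n \<Rightarrow> 'a) \<Rightarrow> complex ^ 'n \<Rightarrow> 'a" where
  "model_op Q i f = hardy_proj Q (Mz i f)"

text \<open>
  Unitary equivalence of a tuple \<open>X\<close> on a Hilbert space with a tuple \<open>Y\<close> on a closed subspace \<open>Q\<close>
  of a Hardy space: $U X_i U^* = Y_i$ for a unitary \<open>U\<close> onto \<open>Q\<close>, so that $U^* = U^{-1}$.
\<close>

definition unitary_onto ::
    "(complex ^ 'n::finite \<Rightarrow> 'a::complex_inner) set \<Rightarrow>
     ('h::complex_inner \<Rightarrow> complex ^ 'n \<Rightarrow> 'a) \<Rightarrow> bool" where
  "unitary_onto Q U \<longleftrightarrow>
     bij_betw U UNIV Q \<and>
     (\<forall>x y. U (x + y) = (\<lambda>w. U x w + U y w)) \<and> (\<forall>c x. U (c *\<^sub>C x) = (\<lambda>w. c *\<^sub>C U x w)) \<and>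
     (\<forall>x y. hardy_inner (U x) (U y) = cinner x y)"

definition unitarily_equivalent ::
    "('n::finite \<Rightarrow> 'h::complex_inner \<Rightarrow> 'h) \<Rightarrow> (complex ^ 'n \<Rightarrow> 'a::complex_inner) set \<Rightarrow>
     ('n \<Rightarrow> (complex ^ 'n \<Rightarrow> 'a) \<Rightarrow> complex ^ 'n \<Rightarrow> 'a) \<Rightarrow> bool" where
  "unitarily_equivalent X Q Y \<longleftrightarrow>
     (\<exists>U. unitary_onto Q U \<and> (\<forall>i. \<forall>f\<in>Q. U (X i (inv U f)) = Y i f))"

end

theory Submission
  imports Defs
begin

text \<open>
  Write \<open>dil\<close> for the canonical dilation, an isometry that intertwines \<open>T i\<^sup>*\<close> with the adjoint of
  multiplication by \<open>z i\<close>, and \<open>P\<close> for the projection onto the orthogonal complement of its range in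
  the Hardy space of functions with values in the whole Hilbert space. This complement is invariant
  under the multiplications \<open>M i\<close>. The restrictions \<open>R i\<close> of \<open>M i\<close> to that complement commute, and
  the hypothesis \<open>defect (T i) \<circ> defect (T j) = 0\<close> makes them doubly commute: \<open>I - T i\<^sup>* T i\<close> is
  \<open>A i\<^sup>* A i\<close> for \<open>A i = P M i dil\<close>, so that \<open>A i A j\<^sup>* = 0\<close> for \<open>i \<noteq> j\<close>, and this is the only
  obstruction (lemma \<open>doubly_commute\<close>).

  For a doubly commuting tuple of shifts, \<open>F = \<Prod>\<^sub>i (I - \<Delta>)(P)\<close>, with \<open>\<Delta>\<close> conjugation by \<open>M i\<close>, is
  the projection onto the wandering subspace, whose translates by monomials are mutually orthogonal
  (\<open>wandering_orthogonal\<close>) and span the whole complement (\<open>wandering_complete\<close>). The key observation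
  is that the \<open>i\<close>-th summand in the formula that determines the characteristic function equals
  \<open>F M i dil\<close> (\<open>F_M_dil\<close>, \<open>hardy_fun_F_M_dil\<close>). Hence the operator \<open>Phi\<close> given by that formula maps into
  the wandering subspace. Compressing \<open>M i\<^sup>* F M j\<close> to the dilation space gives exactly the entries
  of the squared joint defect operator (\<open>compress_wandering\<close>), so \<open>Phi\<^sup>* Phi\<close> is this square; in
  particular it is non-negative, and \<open>joint_defect T h \<mapsto> Phi h\<close> extends to an isometry \<open>V\<close> of the
  joint defect space. Its range is the whole wandering subspace of the functions with values in the
  first defect space: a wandering vector orthogonal to the range of \<open>Phi\<close> is constant, and a
  constant orthogonal to the range of \<open>dil\<close> is orthogonal to the first defect space (\<open>Phi_total\<close>).

  The characteristic function is \<open>\<Theta> w x = (V x)(w)\<close>. Multiplication by it is \<open>g \<mapsto> \<Sum>k. z\<^sup>k V (g k)\<close>,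
  an isometry onto the orthogonal complement of the range of \<open>dil\<close> within the functions with values
  in the first defect space (\<open>N_image\<close>). The model space is therefore the range of \<open>dil\<close>, and \<open>dil\<close>
  is the unitary equivalence. The closed formula holds because \<open>X - M j X T j\<^sup>*\<close> applied to a vector
  and evaluated at \<open>w\<close> amounts to precomposing \<open>X\<close> with \<open>I - w j T j\<^sup>*\<close>.

  Hardy spaces are handled through Taylor coefficients, that is, as spaces of square-summable
  families. The preliminary parts provide the representation theorem, adjoints, positive square
  roots and projections for Hilbert spaces of class \<open>complex_inner\<close>.
\<close>

section \<open>Complex inner product spaces and bounded operators\<close>

instance chilbert_space \<subseteq> banach ..

lemma scaleC_zero_left [simp]: "0 *\<^sub>C (x::'a::complex_inner) = 0"
  using scaleR_scaleC[of 0 x] by simp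

lemma scaleC_one [simp]: "1 *\<^sub>C (x::'a::complex_inner) = x"
  using scaleR_scaleC[of 1 x] by simp

lemma scaleC_zero_right [simp]: "c *\<^sub>C (0::'a::complex_inner) = 0"
  using scaleC_add_right[of c 0 "0::'a"] by simp

lemma scaleC_minus_right [simp]: "c *\<^sub>C (- x::'a::complex_inner) = - (c *\<^sub>C x)"
  using scaleC_add_right[of c x "-x"] by (simp add: add_eq_0_iff)

lemma scaleC_minus_left [simp]: "(- c) *\<^sub>C (x::'a::complex_inner) = - (c *\<^sub>C x)"
  using scaleC_add_left[of c "-c" x] by (simp add: add_eq_0_iff)

lemma scaleC_diff_right: "c *\<^sub>C (x - y::'a::complex_inner) = c *\<^sub>C x - c *\<^sub>C y"
  using scaleC_add_right[of c x "-y"] by simp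

lemma cinner_zero_left [simp]: "cinner 0 (x::'a::complex_inner) = 0"
  using cinner_add_left[of 0 0 x] by simp

lemma cinner_zero_right [simp]: "cinner (x::'a::complex_inner) 0 = 0"
  by (subst cinner_commute) simp

lemma cinner_diff_left: "cinner (x - z) (y::'a::complex_inner) = cinner x y - cinner z y"
  using cinner_add_left[of "x - z" z y] by simp

lemma cinner_add_right: "cinner (x::'a::complex_inner) (y + z) = cinner x y + cinner x z"
  by (subst (1 2 3) cinner_commute) (simp add: cinner_add_left)

lemma cinner_diff_right: "cinner (x::'a::complex_inner) (y - z) = cinner x y - cinner x z"
  by (subst (1 2 3) cinner_commute) (simp add: cinner_diff_left)

lemma cinner_scaleC_right: "cinner (x::'a::complex_inner) (c *\<^sub>C y) = cnj c * cinner x y"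
  by (subst (1 2) cinner_commute) (simp add: cinner_scaleC_left)

lemma cinner_sum_right: "cinner (y::'a::complex_inner) (\<Sum>i\<in>A. f i) = (\<Sum>i\<in>A. cinner y (f i))"
  by (induction A rule: infinite_finite_induct) (auto simp: cinner_add_right)

lemma cinner_eq_inner: "cinner x y = Complex (inner x y) (inner x (\<i> *\<^sub>C (y::'a::complex_inner)))"
  by (simp add: complex_eq_iff inner_eq_Re_cinner cinner_scaleC_right)

lemma cinner_self: "cinner (x::'a::complex_inner) x = complex_of_real ((norm x)\<^sup>2)"
proof -
  have "Im (cinner x x) = - Im (cinner x x)"
    by (subst cinner_commute) simp
  thus ?thesis by (simp add: complex_eq_iff dot_square_norm[symmetric] inner_eq_Re_cinner)
qed

lemma cinner_self_eq_zero [simp]: "cinner (x::'a::complex_inner) x = 0 \<longleftrightarrow> x = 0"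
  by (simp add: cinner_self)

lemma cinner_ext:
  assumes "\<And>z. cinner x z = cinner (y::'a::complex_inner) z"
  shows "x = y"
proof -
  have "cinner (x - y) (x - y) = 0" by (simp add: cinner_diff_left assms)
  thus ?thesis by simp
qed

lemma norm_scaleC [simp]: "norm (c *\<^sub>C (x::'a::complex_inner)) = cmod c * norm x"
proof -
  have "cinner (c *\<^sub>C x) (c *\<^sub>C x) = (c * cnj c) * cinner x x"
    by (simp add: cinner_scaleC_left cinner_scaleC_right)
  also have "\<dots> = complex_of_real ((cmod c * norm x)\<^sup>2)"
    by (simp only: cinner_self power_mult_distrib complex_norm_square[symmetric] of_real_mult)
  finally have "(norm (c *\<^sub>C x))\<^sup>2 = (cmod c * norm x)\<^sup>2" by (simp only: cinner_self of_real_eq_iff)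
  thus ?thesis by simp
qed

lemma cinner_Cauchy_Schwarz: "cmod (cinner x y) \<le> norm x * norm (y::'a::complex_inner)"
proof (cases "cinner x y = 0")
  case False
  define u where "u = cnj (cinner x y) / cmod (cinner x y)"
  have u: "cmod u = 1" using False by (simp add: u_def norm_divide)
  have "cinner (u *\<^sub>C x) y = cmod (cinner x y)"
    using False by (simp add: cinner_scaleC_left u_def complex_norm_square[symmetric]
        power2_eq_square
        mult.commute[of "cnj _"])
  hence "cmod (cinner x y) = inner (u *\<^sub>C x) y" by (simp add: inner_eq_Re_cinner)
  also have "\<dots> \<le> norm (u *\<^sub>C x) * norm y" by (rule norm_cauchy_schwarz)
  finally show ?thesis using u by simp
qed simp

lemma bounded_linear_cinner_left: "bounded_linear (\<lambda>x. cinner x (y::'a::complex_inner))"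
  by (rule bounded_linear_intro[where K="norm y"])
     (auto simp: cinner_add_left scaleR_scaleC cinner_scaleC_left cinner_Cauchy_Schwarz
        scaleR_conv_of_real)

lemma bounded_linear_cinner_right: "bounded_linear (\<lambda>y. cinner (x::'a::complex_inner) y)"
  by (rule bounded_linear_intro[where K="norm x"])
     (auto simp: cinner_add_right scaleR_scaleC cinner_scaleC_right cinner_Cauchy_Schwarz
        scaleR_conv_of_real mult.commute[of _ "norm x"])

lemma bounded_linear_scaleC_right: "bounded_linear (\<lambda>x. c *\<^sub>C (x::'a::complex_inner))"
  by (rule bounded_linear_intro[where K="cmod c"])
     (auto simp: scaleC_add_right scaleR_scaleC scaleC_scaleC mult.commute)

lemmas tendsto_cinner_left = bounded_linear.tendsto[OF bounded_linear_cinner_left]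
lemmas tendsto_scaleC = bounded_linear.tendsto[OF bounded_linear_scaleC_right]

lemma bounded_clinearI:
  assumes "\<And>x y. A (x + y) = A x + A y" "\<And>c x. A (c *\<^sub>C x) = c *\<^sub>C A x"
      "\<And>x. norm (A x) \<le> K * norm x"
  shows "bounded_clinear A"
  unfolding bounded_clinear_def
proof (intro conjI allI assms bounded_linear_intro[where K=K])
  show "A (r *\<^sub>R x) = r *\<^sub>R A x" for r x by (simp add: scaleR_scaleC assms(2))
  show "norm (A x) \<le> norm x * K" for x using assms(3)[of x] by (simp add: mult.commute)
qed

lemma bounded_clinear_bounded_linear: "bounded_clinear A \<Longrightarrow> bounded_linear A"
  by (simp add: bounded_clinear_def)

context
  fixes A :: "'a::complex_inner \<Rightarrow> 'b::complex_inner"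
  assumes A: "bounded_clinear A"
begin

interpretation bounded_linear A using A by (rule bounded_clinear_bounded_linear)

lemma bounded_clinear_add: "A (x + y) = A x + A y" by (rule add)
lemma bounded_clinear_diff: "A (x - y) = A x - A y" by (rule diff)
lemma bounded_clinear_zero: "A 0 = 0" by (rule zero)
lemma bounded_clinear_minus: "A (- x) = - A x" by (rule neg)
lemma bounded_clinear_sum: "A (\<Sum>i\<in>I. f i) = (\<Sum>i\<in>I. A (f i))" by (rule sum)
lemma bounded_clinear_scaleC: "A (c *\<^sub>C x) = c *\<^sub>C A x" using A by (simp add: bounded_clinear_def)
lemma bounded_clinear_bound: "\<exists>K\<ge>0. \<forall>x. norm (A x) \<le> K * norm x"
proof -
  obtain K where "K \<ge> 0" "\<forall>x. norm (A x) \<le> norm x * K" using nonneg_bounded by blast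
  thus ?thesis by (intro exI[of _ K]) (simp add: mult.commute)
qed
lemma bounded_clinear_tendsto: "(f \<longlongrightarrow> a) F \<Longrightarrow> ((\<lambda>x. A (f x)) \<longlongrightarrow> A a) F" by (rule tendsto)
lemma bounded_clinear_has_sum: "(f has_sum a) S \<Longrightarrow> ((\<lambda>x. A (f x)) has_sum A a) S"
  by (rule has_sum_bounded_linear[OF bounded_clinear_bounded_linear[OF A]])

end

lemmas bounded_clinear_simps = bounded_clinear_add bounded_clinear_diff bounded_clinear_zero
  bounded_clinear_minus bounded_clinear_sum bounded_clinear_scaleC

lemma bounded_clinear_id: "bounded_clinear (\<lambda>x. x)"
  by (rule bounded_clinearI[where K=1]) auto

lemma bounded_clinear_zero_op: "bounded_clinear (\<lambda>x. 0)"
  by (rule bounded_clinearI[where K=1]) auto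

lemma bounded_clinear_compose:
  assumes "bounded_clinear A" "bounded_clinear B" shows "bounded_clinear (\<lambda>x. A (B x))"
  using assms bounded_linear_compose unfolding bounded_clinear_def by auto

lemma bounded_clinear_plus:
  assumes "bounded_clinear A" "bounded_clinear B" shows "bounded_clinear (\<lambda>x. A x + B x)"
  using assms bounded_linear_add unfolding bounded_clinear_def by (auto simp: scaleC_add_right)

lemma bounded_clinear_minus_op:
  assumes "bounded_clinear A" "bounded_clinear B" shows "bounded_clinear (\<lambda>x. A x - B x)"
  using assms bounded_linear_sub unfolding bounded_clinear_def by (auto simp: scaleC_diff_right)

lemma bounded_clinear_scaleC_op:
  assumes "bounded_clinear A" shows "bounded_clinear (\<lambda>x. c *\<^sub>C A x)"
proof -
  have "bounded_clinear (\<lambda>x. c *\<^sub>C (x::'b))"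
    using bounded_linear_scaleC_right by (auto simp: bounded_clinear_def scaleC_scaleC mult.commute)
  from bounded_clinear_compose[OF this assms] show ?thesis .
qed

lemma bounded_clinear_sum_op:
  assumes "\<And>i. i \<in> I \<Longrightarrow> bounded_clinear (A i)" shows "bounded_clinear (\<lambda>x. \<Sum>i\<in>I. A i x)"
  using assms
  by (induction I rule: infinite_finite_induct) (simp_all add: bounded_clinear_zero_op
      bounded_clinear_plus)

lemma bounded_clinear_ext_cinner:
  assumes "\<And>x y. cinner (A x) y = cinner (B x) (y::'a::complex_inner)"
  shows "A = B"
  by (rule ext, rule cinner_ext, rule assms)

section \<open>Closed subspaces, the representation theorem and adjoints\<close>

text \<open>Closed complex subspaces, given as subsets of the ambient space.\<close>

definition closed_csubspace :: "'a::complex_inner set \<Rightarrow> bool" where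
  "closed_csubspace S \<longleftrightarrow> closed S \<and> 0 \<in> S \<and> (\<forall>x\<in>S. \<forall>y\<in>S. x + y \<in> S) \<and> (\<forall>c. \<forall>x\<in>S. c *\<^sub>C x \<in> S)"

lemma closed_csubspace_UNIV [simp]: "closed_csubspace UNIV"
  by (simp add: closed_csubspace_def)

context
  fixes S :: "'a::complex_inner set"
  assumes S: "closed_csubspace S"
begin

lemma csubspace_zero: "0 \<in> S" using S by (simp add: closed_csubspace_def)
lemma csubspace_add: "x \<in> S \<Longrightarrow> y \<in> S \<Longrightarrow> x + y \<in> S" using S by (simp add: closed_csubspace_def)
lemma csubspace_scaleC: "x \<in> S \<Longrightarrow> c *\<^sub>C x \<in> S" using S by (simp add: closed_csubspace_def)
lemma csubspace_scaleR: "x \<in> S \<Longrightarrow> r *\<^sub>R x \<in> S" by (simp add: scaleR_scaleC csubspace_scaleC)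
lemma csubspace_minus: "x \<in> S \<Longrightarrow> - x \<in> S" using csubspace_scaleR[of x "-1"] by simp
lemma csubspace_diff: "x \<in> S \<Longrightarrow> y \<in> S \<Longrightarrow> x - y \<in> S"
  using csubspace_add[of x "-y"] csubspace_minus[of y] by simp
lemma csubspace_sum: "(\<And>i. i \<in> I \<Longrightarrow> f i \<in> S) \<Longrightarrow> (\<Sum>i\<in>I. f i) \<in> S"
  by (induction I rule: infinite_finite_induct) (auto intro: csubspace_zero csubspace_add)
lemma csubspace_limit: "(\<And>n::nat. f n \<in> S) \<Longrightarrow> f \<longlonglongrightarrow> a \<Longrightarrow> a \<in> S"
  using S unfolding closed_csubspace_def by (auto simp: closed_sequential_limits)
lemma csubspace_has_sum:
  assumes "\<And>i. i \<in> I \<Longrightarrow> f i \<in> S" "(f has_sum a) I" shows "a \<in> S"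
proof (rule Lim_in_closed_set[of S _ "finite_subsets_at_top I"])
  show "closed S" using S by (simp add: closed_csubspace_def)
  show "\<forall>\<^sub>F F in finite_subsets_at_top I. sum f F \<in> S"
    by (rule eventually_finite_subsets_at_top_weakI) (use assms(1) in \<open>auto intro: csubspace_sum\<close>)
  show "(sum f \<longlongrightarrow> a) (finite_subsets_at_top I)" using assms(2) by (simp add: has_sum_def)
qed simp

end

lemma closed_csubspace_closure_range:
  assumes "bounded_clinear A"
  shows "closed_csubspace (closure (range A))"
  unfolding closed_csubspace_def
proof (intro conjI ballI allI)
  show "0 \<in> closure (range A)"
    using closure_subset[of "range A"] rangeI[of A 0] bounded_clinear_zero[OF assms] by auto
next
  fix x y assume "x \<in> closure (range A)" "y \<in> closure (range A)"
  then obtain f g where f: "\<And>n. f n \<in> range A" "f \<longlonglongrightarrow> x" and g: "\<And>n. g n \<in> range A" "g \<longlonglongrightarrow> y"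
    by (auto simp: closure_sequential)
  have "f n + g n \<in> range A" for n
    using f(1)[of n] g(1)[of n] by (auto simp: bounded_clinear_add[OF assms, symmetric])
  thus "x + y \<in> closure (range A)"
    unfolding closure_sequential
    using tendsto_add[OF f(2) g(2)] by (intro exI[of _ "\<lambda>n. f n + g n"]) auto
next
  fix c x assume "x \<in> closure (range A)"
  then obtain f where f: "\<And>n. f n \<in> range A" "f \<longlonglongrightarrow> x" by (auto simp: closure_sequential)
  have "c *\<^sub>C f n \<in> range A" for n
    using f(1)[of n] by (auto simp: bounded_clinear_scaleC[OF assms, symmetric])
  thus "c *\<^sub>C x \<in> closure (range A)"
    unfolding closure_sequential
    using tendsto_scaleC[OF f(2)] by (intro exI[of _ "\<lambda>n. c *\<^sub>C f n"]) auto
qed simp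

text \<open>
  The representing vector minimises \<open>(norm x)\<^sup>2 - 2 * f x\<close> over the subspace; a minimising sequence
  is Cauchy by the parallelogram law.
\<close>

lemma riesz_representation_real:
  fixes S :: "'a::{complex_inner,banach} set" and f :: "'a \<Rightarrow> real"
  assumes S: "closed_csubspace S"
    and add: "\<And>x y. x \<in> S \<Longrightarrow> y \<in> S \<Longrightarrow> f (x + y) = f x + f y"
    and scale: "\<And>r x. x \<in> S \<Longrightarrow> f (r *\<^sub>R x) = r * f x"
    and bound: "\<And>x. x \<in> S \<Longrightarrow> \<bar>f x\<bar> \<le> K * norm x"
  shows "\<exists>y\<in>S. \<forall>v\<in>S. f v = inner v y"
proof -
  define \<phi> where "\<phi> x = inner x x - 2 * f x" for x
  define m where "m = Inf (\<phi> ` S)"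
  have lower: "- K\<^sup>2 \<le> \<phi> x" if "x \<in> S" for x
  proof -
    have "f x \<le> K * norm x" using bound[OF that] by simp
    moreover have "0 \<le> (norm x - K)\<^sup>2" by simp
    ultimately show ?thesis
      by (simp add: \<phi>_def dot_square_norm power2_eq_square algebra_simps)
  qed
  have bdd: "bdd_below (\<phi> ` S)" using lower by (rule bdd_belowI2)
  have ne: "\<phi> ` S \<noteq> {}" using csubspace_zero[OF S] by auto
  have m_le: "m \<le> \<phi> x" if "x \<in> S" for x
    unfolding m_def using that bdd by (auto intro: cInf_lower)
  have "\<exists>x\<in>S. \<phi> x < m + 1 / real (Suc n)" for n
    using cInf_lessD[OF ne, of "m + 1 / real (Suc n)"] by (auto simp: m_def)
  then obtain x where x: "\<And>n. x n \<in> S" "\<And>n. \<phi> (x n) < m + 1 / real (Suc n)" by metis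
  have parallelogram: "(norm (u - v))\<^sup>2 \<le> 2 * \<phi> u + 2 * \<phi> v - 4 * m" if "u \<in> S" "v \<in> S" for u v
  proof -
    have mem: "(1/2) *\<^sub>R (u + v) \<in> S" using that S by (intro csubspace_scaleR csubspace_add)
    have f: "f ((1/2) *\<^sub>R (u + v)) = (f u + f v) / 2"
      using scale[OF csubspace_add[OF S that], of "1/2"] add[OF that] by simp
    have "(norm ((1/2) *\<^sub>R (u + v)))\<^sup>2 = (norm (u + v))\<^sup>2 / 4"
      unfolding norm_scaleR by (simp add: power_divide)
    hence "4 * \<phi> ((1/2) *\<^sub>R (u + v)) = (norm (u + v))\<^sup>2 - 4 * f u - 4 * f v"
      by (simp only: \<phi>_def dot_square_norm f) argo
    with m_le[OF mem] have "4 * m \<le> (norm (u + v))\<^sup>2 - 4 * f u - 4 * f v" by simp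
    moreover have "(norm (u + v))\<^sup>2 + (norm (u - v))\<^sup>2 = 2 * (norm u)\<^sup>2 + 2 * (norm v)\<^sup>2"
      by (simp add: dot_square_norm[symmetric] inner_add_left inner_add_right inner_diff_left
          inner_diff_right inner_commute algebra_simps)
    ultimately show ?thesis by (simp add: \<phi>_def dot_square_norm)
  qed
  have "Cauchy x"
  proof (rule metric_CauchyI)
    fix e :: real assume "e > 0"
    then obtain N where N: "4 / real (Suc N) < e\<^sup>2"
      using reals_Archimedean[of "e\<^sup>2 / 4"] by (auto simp: field_simps)
    have "dist (x i) (x j) < e" if "i \<ge> N" "j \<ge> N" for i j
    proof -
      have "1 / real (Suc i) \<le> 1 / real (Suc N)" "1 / real (Suc j) \<le> 1 / real (Suc N)"
        using that by (auto simp: field_simps)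
      hence "(norm (x i - x j))\<^sup>2 < e\<^sup>2"
        using parallelogram[OF x(1) x(1), of i j] x(2)[of i] x(2)[of j] N by simp
      thus ?thesis using \<open>e > 0\<close> by (simp add: dist_norm power_less_imp_less_base)
    qed
    thus "\<exists>N. \<forall>i\<ge>N. \<forall>j\<ge>N. dist (x i) (x j) < e" by blast
  qed
  then obtain y where y: "x \<longlonglongrightarrow> y" using Cauchy_convergent convergent_def by blast
  have yS: "y \<in> S" using csubspace_limit[OF S x(1) y] .
  have "f v = inner v y" if v: "v \<in> S" for v
  proof -
    \<comment> \<open>first variation of the minimised functional in the direction \<open>v\<close>\<close>
    have var: "0 \<le> 2 * t * (inner v y - f v) + t\<^sup>2 * inner v v" for t
    proof (rule LIMSEQ_le)
      show "(\<lambda>n. - (1 / real (Suc n))) \<longlonglongrightarrow> 0"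
        using LIMSEQ_inverse_real_of_nat[THEN tendsto_minus] by (simp add: inverse_eq_divide)
      show "(\<lambda>n. 2 * t * (inner v (x n) - f v) + t\<^sup>2 * inner v v) \<longlonglongrightarrow>
          2 * t * (inner v y - f v) + t\<^sup>2 * inner v v"
        by (intro tendsto_intros y)
      have "- (1 / real (Suc n)) \<le> 2 * t * (inner v (x n) - f v) + t\<^sup>2 * inner v v" for n
      proof -
        have "m \<le> \<phi> (x n + t *\<^sub>R v)"
          using m_le S x(1) v by (intro m_le csubspace_add csubspace_scaleR)
        also have "\<dots> = \<phi> (x n) + (2 * t * (inner v (x n) - f v) + t\<^sup>2 * inner v v)"
          using add[OF x(1), of "t *\<^sub>R v" n] scale[OF v, of t] csubspace_scaleR[OF S v]
          by (simp add: \<phi>_def inner_add_left inner_add_right inner_commute power2_eq_square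
              algebra_simps)
        finally show ?thesis using x(2)[of n] by simp
      qed
      thus "\<exists>N. \<forall>n\<ge>N. - (1 / real (Suc n)) \<le> 2 * t * (inner v (x n) - f v) + t\<^sup>2 * inner v v"
        by blast
    qed
    show ?thesis
    proof (cases "v = 0")
      case True
      thus ?thesis using scale[OF v, of 0] by simp
    next
      case False
      define d where "d = inner v y - f v"
      have "0 \<le> 2 * (- d / inner v v) * d + (- d / inner v v)\<^sup>2 * inner v v"
        using var[of "- d / inner v v"] by (simp add: d_def)
      also have "\<dots> = - (d\<^sup>2 / inner v v)" using False by (simp add: power2_eq_square field_simps)
      finally have "d\<^sup>2 / inner v v \<le> 0" by simp
      moreover have "inner v v > 0" using False by simp
      ultimately have "d\<^sup>2 \<le> 0" by (simp add: divide_le_0_iff)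
      thus ?thesis by (simp add: d_def)
    qed
  qed
  thus ?thesis using yS by (intro bexI[of _ y] ballI)
qed

lemma riesz_representation:
  fixes S :: "'a::{complex_inner,banach} set" and f :: "'a \<Rightarrow> complex"
  assumes S: "closed_csubspace S"
    and add: "\<And>x y. x \<in> S \<Longrightarrow> y \<in> S \<Longrightarrow> f (x + y) = f x + f y"
    and scale: "\<And>c x. x \<in> S \<Longrightarrow> f (c *\<^sub>C x) = c * f x"
    and bound: "\<And>x. x \<in> S \<Longrightarrow> cmod (f x) \<le> K * norm x"
  shows "\<exists>y\<in>S. \<forall>v\<in>S. f v = cinner v y"
proof -
  have "\<bar>Re (f x)\<bar> \<le> K * norm x" if "x \<in> S" for x
    using abs_Re_le_cmod[of "f x"] bound[OF that] by simp
  hence "\<exists>y\<in>S. \<forall>v\<in>S. Re (f v) = inner v y"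
    by (intro riesz_representation_real[OF S, where K=K]) (auto simp: add scale scaleR_scaleC)
  then obtain y where y: "y \<in> S" "\<And>v. v \<in> S \<Longrightarrow> Re (f v) = Re (cinner v y)"
    by (auto simp: inner_eq_Re_cinner)
  have "f v = cinner v y" if "v \<in> S" for v
    using y(2)[OF that] y(2)[OF csubspace_scaleC[OF S that], of \<i>] scale[OF that, of \<i>]
    by (simp add: complex_eq_iff cinner_scaleC_left)
  thus ?thesis using y(1) by (intro bexI[of _ y] ballI)
qed

lemma cadjointI:
  assumes "\<And>x y. cinner (A x) y = cinner x (B y)"
  shows "cadjoint A = B"
  unfolding cadjoint_def
proof (rule the_equality)
  fix C assume "\<forall>x y. cinner (A x) y = cinner x (C y)"
  hence "cinner x (C y) = cinner x (B y)" for x y using assms by metis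
  hence "cinner (C y) x = cinner (B y) x" for x y by (metis cinner_commute)
  thus "C = B" by (intro bounded_clinear_ext_cinner)
qed (use assms in simp)

context
  fixes A :: "'a::{complex_inner,banach} \<Rightarrow> 'b::complex_inner"
  assumes A: "bounded_clinear A"
begin

lemma cinner_cadjoint: "cinner (A x) y = cinner x (cadjoint A y)"
proof -
  obtain K where K: "K \<ge> 0" "\<And>x. norm (A x) \<le> K * norm x" using bounded_clinear_bound[OF A] by auto
  have "\<exists>z. \<forall>x. cinner (A x) y = cinner x z" for y
  proof -
    have "cmod (cinner (A x) y) \<le> (K * norm y) * norm x" for x
      using cinner_Cauchy_Schwarz[of "A x" y] mult_right_mono[OF K(2)[of x] norm_ge_zero[of y]]
      by (simp add: mult_ac)
    hence "\<exists>z\<in>UNIV. \<forall>x\<in>UNIV. cinner (A x) y = cinner x z"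
      by (intro riesz_representation[where K="K * norm y"])
         (auto simp: bounded_clinear_simps[OF A] cinner_add_left cinner_scaleC_left)
    thus ?thesis by auto
  qed
  then obtain B where B: "\<And>x y. cinner (A x) y = cinner x (B y)" by metis
  with cadjointI[OF B] show ?thesis by simp
qed

lemma cinner_cadjoint': "cinner y (A x) = cinner (cadjoint A y) x"
  using cinner_cadjoint[of x y] by (metis cinner_commute)

lemma norm_cadjoint_le:
  assumes "K \<ge> 0" and bound: "\<And>x. norm (A x) \<le> K * norm x"
  shows "norm (cadjoint A y) \<le> K * norm y"
proof -
  let ?z = "cadjoint A y"
  have "(norm ?z)\<^sup>2 = cmod (cinner (A ?z) y)" by (simp add: cinner_cadjoint cinner_self norm_power)
  also have "\<dots> \<le> norm (A ?z) * norm y" by (rule cinner_Cauchy_Schwarz)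
  also have "\<dots> \<le> K * norm ?z * norm y" by (intro mult_right_mono bound) simp
  finally have "norm ?z * norm ?z \<le> norm ?z * (K * norm y)" by (simp add: power2_eq_square mult_ac)
  thus ?thesis
    using \<open>K \<ge> 0\<close> by (cases "?z = 0") (auto simp: mult_le_cancel_left_pos)
qed

lemma bounded_clinear_cadjoint: "bounded_clinear (cadjoint A)"
proof -
  obtain K where K: "K \<ge> 0" "\<And>x. norm (A x) \<le> K * norm x" using bounded_clinear_bound[OF A] by auto
  show ?thesis
  proof (rule bounded_clinearI[where K=K])
    show "cadjoint A (x + y) = cadjoint A x + cadjoint A y" for x y
      by (rule cinner_ext) (simp add: cinner_cadjoint'[symmetric] cinner_add_left)
    show "cadjoint A (c *\<^sub>C x) = c *\<^sub>C cadjoint A x" for c x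
      by (rule cinner_ext) (simp add: cinner_cadjoint'[symmetric] cinner_scaleC_left)
    show "norm (cadjoint A y) \<le> K * norm y" for y by (rule norm_cadjoint_le[OF K])
  qed
qed

end

section \<open>Positive operators and their square roots\<close>

lemma nonneg_op_bounded_clinear: "nonneg_op A \<Longrightarrow> bounded_clinear A"
  by (simp add: nonneg_op_def)

lemma nonneg_op_inner: "nonneg_op A \<Longrightarrow> inner (A x) x \<ge> 0"
  by (simp add: nonneg_op_def complex_nonneg_Reals_iff inner_eq_Re_cinner)

text \<open>Over the complex numbers, real-valuedness of the quadratic form implies symmetry.\<close>

lemma nonneg_op_symmetric:
  assumes "nonneg_op A"
  shows "cinner (A x) y = cinner x (A y)"
proof -
  note A = nonneg_op_bounded_clinear[OF assms]
  define d where "d x y = cinner (A x) y - cinner x (A y)" for x y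
  have real: "d x x = 0" for x
  proof -
    have "Im (cinner (A x) x) = 0"
      using assms by (simp add: nonneg_op_def complex_nonneg_Reals_iff)
    moreover have "cinner x (A x) = cnj (cinner (A x) x)" by (rule cinner_commute)
    ultimately show ?thesis by (simp add: d_def complex_eq_iff)
  qed
  have "d x y + d y x = d (x + y) (x + y) - d x x - d y y" for x y
    by (simp add: d_def bounded_clinear_simps[OF A] cinner_add_left cinner_add_right)
  hence anti: "d x y + d y x = 0" for x y by (simp add: real)
  have "d x (\<i> *\<^sub>C y) + d (\<i> *\<^sub>C y) x = - \<i> * d x y + \<i> * d y x"
    by (simp add: d_def bounded_clinear_simps[OF A] cinner_scaleC_left cinner_scaleC_right
        algebra_simps)
  hence "\<i> * (d y x - d x y) = 0" by (simp add: anti algebra_simps)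
  hence "d x y = 0" using anti[of x y] by simp
  thus ?thesis by (simp add: d_def)
qed

lemma nonneg_opI:
  assumes "bounded_clinear A" "\<And>x y. cinner (A x) y = cinner x (A y)" "\<And>x. inner (A x) x \<ge> 0"
  shows "nonneg_op A"
proof -
  have "Im (cinner (A x) x) = 0" for x
  proof -
    have "cinner (A x) x = cnj (cinner (A x) x)" using assms(2) cinner_commute by metis
    hence "Im (cinner (A x) x) = - Im (cinner (A x) x)" by (metis cnj.sel(2))
    thus ?thesis by simp
  qed
  with assms show ?thesis
    by (simp add: nonneg_op_def complex_nonneg_Reals_iff inner_eq_Re_cinner)
qed

text \<open>The discriminant of a non-negative quadratic polynomial is non-positive.\<close>

lemma nonneg_quadratic:
  fixes a b c :: real
  assumes "\<And>t. 0 \<le> a + 2 * b * t + c * t\<^sup>2"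
  shows "b\<^sup>2 \<le> a * c"
proof (cases "c = 0")
  case True
  have "b = 0"
  proof (rule ccontr)
    assume "b \<noteq> 0"
    thus False using assms[of "- (a + 1) / (2 * b)"] True by simp
  qed
  thus ?thesis using True by simp
next
  case False
  have "c > 0"
  proof (rule ccontr)
    assume "\<not> c > 0"
    hence c: "c < 0" using False by simp
    \<comment> \<open>large enough for the leading term to dominate\<close>
    define t where "t = 1 + (\<bar>a\<bar> + 2 * \<bar>b\<bar>) / \<bar>c\<bar>"
    have t: "t \<ge> 1" "\<bar>c\<bar> * t = \<bar>c\<bar> + \<bar>a\<bar> + 2 * \<bar>b\<bar>" using c by (auto simp: t_def field_simps)
    have "\<bar>c\<bar> * t\<^sup>2 = (\<bar>c\<bar> + \<bar>a\<bar> + 2 * \<bar>b\<bar>) * t" using t(2) by (simp add: power2_eq_square)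
    hence "\<bar>c\<bar> * t\<^sup>2 = \<bar>c\<bar> * t + \<bar>a\<bar> * t + 2 * (\<bar>b\<bar> * t)" by (simp add: algebra_simps)
    moreover have "\<bar>c\<bar> * t > 0" using t(1) c by (intro mult_pos_pos) auto
    moreover have "\<bar>a\<bar> \<le> \<bar>a\<bar> * t" "b * t \<le> \<bar>b\<bar> * t"
      using t(1) by (auto intro!: mult_right_mono simp: mult_le_cancel_left1)
    ultimately have "a + 2 * b * t + c * t\<^sup>2 < 0" using c by simp
    thus False using assms[of t] by simp
  qed
  have "0 \<le> a + 2 * b * (- b / c) + c * (- b / c)\<^sup>2" by (rule assms)
  also have "\<dots> = a - b\<^sup>2 / c" using \<open>c > 0\<close> by (simp add: power2_eq_square field_simps)
  finally show ?thesis using \<open>c > 0\<close> by (simp add: field_simps)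
qed

lemma nonneg_op_Cauchy_Schwarz:
  assumes "nonneg_op A"
  shows "(inner (A x) y)\<^sup>2 \<le> inner (A x) x * inner (A y) y"
proof (rule nonneg_quadratic)
  fix t :: real
  note A = nonneg_op_bounded_clinear[OF assms]
  have sym: "inner (A y) x = inner (A x) y"
    using nonneg_op_symmetric[OF assms, of y x] inner_commute[of y "A x"]
    by (simp only: inner_eq_Re_cinner)
  have "0 \<le> inner (A (x + t *\<^sub>R y)) (x + t *\<^sub>R y)" by (rule nonneg_op_inner[OF assms])
  also have "A (x + t *\<^sub>R y) = A x + t *\<^sub>R A y"
    by (simp add: bounded_clinear_simps[OF A] scaleR_scaleC)
  finally show "0 \<le> inner (A x) x + 2 * inner (A x) y * t + inner (A y) y * t\<^sup>2"
    by (simp add: inner_add_left inner_add_right sym power2_eq_square algebra_simps)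
qed

lemma nonneg_op_inner_zeroD:
  assumes "nonneg_op A" "inner (A x) x = 0"
  shows "A x = 0"
  using nonneg_op_Cauchy_Schwarz[OF assms(1), of x "A x"] assms(2) by simp

text \<open>The Taylor coefficients of \<open>sqrt (1 - t)\<close> at 0.\<close>

primrec sqrt_coeff :: "nat \<Rightarrow> real" where
  "sqrt_coeff 0 = 1"
| "sqrt_coeff (Suc n) = sqrt_coeff n * (real n - 1/2) / real (Suc n)"

lemma sqrt_coeff_gbinomial: "sqrt_coeff n = (- 1) ^ n * ((1/2) gchoose n)"
proof (induction n)
  case (Suc n)
  have g: "(1/2 gchoose Suc n) = (1/2 gchoose n) * ((1/2 - real n) / real (Suc n))"
    by (simp add: gbinomial_prod_rev)
  show ?case unfolding sqrt_coeff.simps Suc g by (simp add: field_simps)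
qed simp

lemma sqrt_coeff_convolution:
  "(\<Sum>i\<le>n. sqrt_coeff i * sqrt_coeff (n - i)) = (if n = 0 then 1 else if n = 1 then -1 else 0)"
proof -
  have "(\<Sum>i\<le>n. sqrt_coeff i * sqrt_coeff (n - i)) =
      (- 1) ^ n * (\<Sum>i\<le>n. ((1/2) gchoose i) * ((1/2) gchoose (n - i)))"
    unfolding sum_distrib_left
  proof (rule sum.cong)
    fix i assume "i \<in> {..n}"
    hence "(- 1) ^ n = (- 1) ^ i * (- 1 :: real) ^ (n - i)" by (simp add: power_add[symmetric])
    thus "sqrt_coeff i * sqrt_coeff (n - i) =
        (- 1) ^ n * (((1/2) gchoose i) * ((1/2) gchoose (n - i)))"
      by (simp add: sqrt_coeff_gbinomial)
  qed simp
  also have "(\<Sum>i\<le>n. ((1/2) gchoose i) * ((1/2) gchoose (n - i))) = ((1::real) gchoose n)"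
    using gbinomial_Vandermonde[of "1/2::real" "1/2" n] by (simp add: atLeast0AtMost)
  also have "((1::real) gchoose n) = real (1 choose n)"
    using binomial_gbinomial[of 1 n, where 'a=real] by simp
  also have "(- 1) ^ n * real (1 choose n) = (if n = 0 then 1 else if n = 1 then -1 else 0)"
    by (cases n) (auto simp: binomial_eq_0)
  finally show ?thesis .
qed

lemma sqrt_coeff_nonpos: "sqrt_coeff (Suc n) \<le> 0"
proof (induction n)
  case (Suc n)
  have "sqrt_coeff (Suc (Suc n)) = sqrt_coeff (Suc n) * ((real (Suc n) - 1/2) / real (Suc (Suc n)))"
    by simp
  also have "\<dots> \<le> 0" using Suc by (intro mult_nonpos_nonneg) (auto simp del: sqrt_coeff.simps)
  finally show ?case .
qed simp

lemma sqrt_coeff_partial_sum: "(\<Sum>k\<le>n. sqrt_coeff k) = - 2 * real (Suc n) * sqrt_coeff (Suc n)"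
proof (induction n)
  case (Suc n)
  have "- 2 * real (Suc (Suc n)) * sqrt_coeff (Suc (Suc n)) = - (2 * real n + 1) * sqrt_coeff (Suc
      n)"
    by (subst sqrt_coeff.simps) (simp add: field_simps del: sqrt_coeff.simps)
  with Suc show ?case by (simp add: algebra_simps del: sqrt_coeff.simps)
qed simp

lemma sqrt_coeff_partial_sum_nonneg: "(\<Sum>k\<le>n. sqrt_coeff k) \<ge> 0"
  unfolding sqrt_coeff_partial_sum
  by (rule mult_nonpos_nonpos[OF _ sqrt_coeff_nonpos]) simp

lemma sqrt_coeff_abs_summable: "(\<lambda>n. \<bar>sqrt_coeff n\<bar>) summable_on UNIV"
proof (subst summable_on_UNIV_nonneg_real_iff)
  show "summable (\<lambda>n. \<bar>sqrt_coeff n\<bar>)"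
  proof (rule bounded_imp_summable[where B=2])
    fix n
    have "(\<Sum>k\<le>n. \<bar>sqrt_coeff k\<bar>) = 2 - (\<Sum>k\<le>n. sqrt_coeff k)"
    proof (induction n)
      case (Suc n)
      thus ?case using sqrt_coeff_nonpos[of n] by (simp del: sqrt_coeff.simps)
    qed simp
    thus "(\<Sum>k\<le>n. \<bar>sqrt_coeff k\<bar>) \<le> 2" using sqrt_coeff_partial_sum_nonneg[of n] by simp
  qed simp
qed simp

text \<open>
  If \<open>0 \<le> B \<le> I\<close>, the binomial series of \<open>sqrt (1 - t)\<close> converges absolutely at \<open>B\<close> and gives a
  positive square root of \<open>I - B\<close> which commutes with every bounded operator that commutes with \<open>B\<close>.
\<close>

lemma sqrt_of_id_minus:
  fixes B :: "'a::{complex_inner,banach} \<Rightarrow> 'a"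
  assumes B: "nonneg_op B" and le: "\<And>x. inner (B x) x \<le> (norm x)\<^sup>2"
  shows "\<exists>S. nonneg_op S \<and> (\<forall>x. S (S x) = x - B x) \<and>
    (\<forall>C. bounded_clinear C \<longrightarrow> (\<forall>x. C (B x) = B (C x)) \<longrightarrow> (\<forall>x. C (S x) = S (C x)))"
proof -
  note Bl = nonneg_op_bounded_clinear[OF B]
  \<comment> \<open>the Cauchy-Schwarz inequality for the form of \<open>B\<close>, applied to \<open>x\<close> and \<open>B x\<close>\<close>
  have contr: "norm (B x) \<le> norm x" for x
  proof -
    have "(inner (B x) (B x))\<^sup>2 \<le> inner (B x) x * inner (B (B x)) (B x)"
      by (rule nonneg_op_Cauchy_Schwarz[OF B])
    also have "\<dots> \<le> (norm x)\<^sup>2 * (norm (B x))\<^sup>2"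
      by (intro mult_mono le nonneg_op_inner[OF B]) auto
    finally have "(norm (B x))\<^sup>2 * (norm (B x))\<^sup>2 \<le> (norm x)\<^sup>2 * (norm (B x))\<^sup>2"
      by (simp add: dot_square_norm power2_eq_square)
    hence "norm (B x) = 0 \<or> (norm (B x))\<^sup>2 \<le> (norm x)\<^sup>2"
      by (simp only: mult_le_cancel_right) auto
    thus ?thesis by (auto intro: power2_le_imp_le)
  qed
  have pow_lin: "bounded_clinear (B ^^ n)" for n
  proof (induction n)
    case (Suc n)
    thus ?case using bounded_clinear_compose[OF Bl Suc] by (simp add: o_def)
  qed (simp add: bounded_clinear_id id_def)
  have pow_norm: "norm ((B ^^ n) x) \<le> norm x" for n x
    by (induction n) (auto intro: order_trans[OF contr])
  have pow_sym: "cinner ((B ^^ n) x) y = cinner x ((B ^^ n) y)" for n x y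
    by (induction n arbitrary: x y)
       (simp_all add: nonneg_op_symmetric[OF B] funpow_swap1)
  define t where "t x n = sqrt_coeff n *\<^sub>R (B ^^ n) x" for x n
  define S where "S x = infsum (t x) UNIV" for x
  define D where "D = infsum (\<lambda>n. \<bar>sqrt_coeff n\<bar>) UNIV"
  have t_norm: "norm (t x n) \<le> \<bar>sqrt_coeff n\<bar> * norm x" for x n
    unfolding t_def by (simp add: mult_left_mono pow_norm)
  have D_sum: "((\<lambda>n. \<bar>sqrt_coeff n\<bar> * c) has_sum (D * c)) UNIV" for c
    unfolding D_def by (intro has_sum_cmult_left has_sum_infsum sqrt_coeff_abs_summable)
  have t_abs: "t x abs_summable_on UNIV" for x
    by (rule summable_on_comparison_test[OF has_sum_imp_summable[OF D_sum[of "norm x"]]])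
       (use t_norm in auto)
  have S_sum: "(t x has_sum S x) UNIV" for x
    unfolding S_def using abs_summable_summable[OF t_abs] by simp
  have S_unique: "(t x has_sum y) UNIV \<Longrightarrow> y = S x" for x y
    using S_sum has_sum_unique by blast
  have Sl: "bounded_clinear S"
  proof (rule bounded_clinearI[where K=D])
    show "S (x + y) = S x + S y" for x y
      using has_sum_add[OF S_sum S_sum, of x y]
      by (intro S_unique[symmetric])
         (simp add: t_def[abs_def] bounded_clinear_simps[OF pow_lin] scaleR_add_right)
    show "S (c *\<^sub>C x) = c *\<^sub>C S x" for c x
    proof -
      have "(\<lambda>n. c *\<^sub>C t x n) = t (c *\<^sub>C x)"
        by (auto simp: t_def bounded_clinear_simps[OF pow_lin] scaleR_scaleC scaleC_scaleC
            mult.commute)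
      with has_sum_bounded_linear[OF bounded_linear_scaleC_right S_sum, of c x]
      show ?thesis by (intro S_unique[symmetric]) simp
    qed
    show "norm (S x) \<le> D * norm x" for x
    proof -
      have "norm (S x) \<le> infsum (\<lambda>n. norm (t x n)) UNIV"
        by (rule norm_has_sum_bound[OF has_sum_infsum[OF t_abs] S_sum])
      also have "\<dots> \<le> D * norm x"
        by (rule has_sum_mono[OF has_sum_infsum[OF t_abs] D_sum t_norm])
      finally show ?thesis .
    qed
  qed
  have comm: "C (S x) = S (C x)" if C: "bounded_clinear C" "\<And>x. C (B x) = B (C x)" for C x
  proof (rule S_unique)
    have "C ((B ^^ n) x) = (B ^^ n) (C x)" for n by (induction n) (auto simp: C(2))
    hence "(\<lambda>n. C (t x n)) = t (C x)"
      by (auto simp: t_def scaleR_scaleC bounded_clinear_scaleC[OF C(1)])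
    thus "(t (C x) has_sum C (S x)) UNIV"
      using bounded_clinear_has_sum[OF C(1) S_sum[of x]] by simp
  qed
  have sym: "cinner (S x) y = cinner x (S y)" for x y
  proof (rule has_sum_unique)
    show "((\<lambda>n. cinner (t x n) y) has_sum cinner (S x) y) UNIV"
      by (rule has_sum_bounded_linear[OF bounded_linear_cinner_left S_sum])
    have "(\<lambda>n. cinner (t x n) y) = (\<lambda>n. cinner x (t y n))"
      by (auto simp: t_def scaleR_scaleC cinner_scaleC_left cinner_scaleC_right pow_sym)
    thus "((\<lambda>n. cinner (t x n) y) has_sum cinner x (S y)) UNIV"
      using has_sum_bounded_linear[OF bounded_linear_cinner_right S_sum, of x y] by simp
  qed
  have pos: "inner (S x) x \<ge> 0" for x
  proof -
    have "((\<lambda>n. inner (t x n) x) has_sum inner (S x) x) UNIV"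
      by (rule has_sum_bounded_linear[OF bounded_linear_inner_left S_sum])
    hence "(\<lambda>n. inner (t x n) x) sums inner (S x) x" by (rule has_sum_imp_sums)
    hence "(\<lambda>N. \<Sum>n\<le>N. inner (t x n) x) \<longlonglongrightarrow> inner (S x) x" by (simp add: sums_def_le)
    moreover have "0 \<le> (\<Sum>n\<le>N. inner (t x n) x)" for N
    proof -
      \<comment> \<open>all coefficients but the first are non-positive, and \<open>B ^^ n\<close> is a contraction\<close>
      have "sqrt_coeff n * (norm x)\<^sup>2 \<le> inner (t x n) x" for n
      proof (cases n)
        case (Suc m)
        have "inner ((B ^^ n) x) x \<le> norm ((B ^^ n) x) * norm x" by (rule norm_cauchy_schwarz)
        also have "\<dots> \<le> (norm x)\<^sup>2" by (simp add: power2_eq_square mult_right_mono pow_norm)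
        finally show ?thesis
          using sqrt_coeff_nonpos[of m] unfolding t_def Suc inner_scaleR_left
          by (rule mult_left_mono_neg)
      qed (simp add: t_def dot_square_norm)
      hence "(\<Sum>n\<le>N. sqrt_coeff n * (norm x)\<^sup>2) \<le> (\<Sum>n\<le>N. inner (t x n) x)" by (rule sum_mono)
      moreover have "0 \<le> (\<Sum>n\<le>N. sqrt_coeff n * (norm x)\<^sup>2)"
        using sqrt_coeff_partial_sum_nonneg[of N] by (simp add: sum_distrib_right[symmetric])
      ultimately show ?thesis by linarith
    qed
    ultimately show ?thesis by (intro LIMSEQ_le_const) auto
  qed
  have sq: "S (S x) = x - B x" for x
  proof -
    \<comment> \<open>the double series of \<open>S (S x)\<close>, summed by rows and along the diagonals \<open>n + m = k\<close>\<close>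
    define f where "f n m = (sqrt_coeff n * sqrt_coeff m) *\<^sub>R (B ^^ (n + m)) x" for n m
    have rows: "((\<lambda>m. f n m) has_sum t (S x) n) UNIV" for n
    proof -
      have "bounded_clinear (\<lambda>y. t y n)"
        unfolding t_def scaleR_scaleC by (intro bounded_clinear_scaleC_op pow_lin)
      from bounded_clinear_has_sum[OF this S_sum[of x]] show ?thesis
        by (simp add: t_def f_def scaleR_scaleC bounded_clinear_scaleC[OF pow_lin] scaleC_scaleC
            funpow_add)
    qed
    have abs: "(\<lambda>(n, m). f n m) abs_summable_on UNIV \<times> UNIV"
    proof (rule summable_on_comparison_test)
      show "(\<lambda>(n, m). \<bar>sqrt_coeff n\<bar> * (\<bar>sqrt_coeff m\<bar> * norm x)) summable_on UNIV \<times> UNIV"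
      proof (rule summable_on_SigmaI)
        show "((\<lambda>m. case (n, m) of (n, m) \<Rightarrow> \<bar>sqrt_coeff n\<bar> * (\<bar>sqrt_coeff m\<bar> * norm x)) has_sum
            \<bar>sqrt_coeff n\<bar> * (D * norm x)) UNIV" for n
          using has_sum_cmult_right[OF D_sum] by simp
        show "(\<lambda>n. \<bar>sqrt_coeff n\<bar> * (D * norm x)) summable_on UNIV"
          by (rule has_sum_imp_summable[OF D_sum])
      qed auto
      fix p :: "nat \<times> nat"
      show "norm (case p of (n, m) \<Rightarrow> f n m) \<le>
          (case p of (n, m) \<Rightarrow> \<bar>sqrt_coeff n\<bar> * (\<bar>sqrt_coeff m\<bar> * norm x))"
        by (auto simp: f_def abs_mult mult.assoc intro!: mult_left_mono pow_norm split: prod.splits)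
    qed auto
    have sum: "(\<lambda>(n, m). f n m) summable_on UNIV \<times> UNIV" by (rule abs_summable_summable[OF abs])
    then obtain s where s: "((\<lambda>(n, m). f n m) has_sum s) (UNIV \<times> UNIV)"
      by (auto simp: summable_on_def)
    have "(t (S x) has_sum s) UNIV" by (rule has_sum_SigmaD[OF s]) (use rows in simp)
    hence 1: "s = S (S x)" by (rule S_unique)
    have bij: "bij_betw (\<lambda>(k, i). (i, k - i)) (SIGMA k:UNIV. {..k}) (UNIV \<times> (UNIV :: nat set))"
      by (rule bij_betw_byWitness[where f'="\<lambda>(n, m). (n + m, n)"]) auto
    have "((\<lambda>p. (case p of (k, i) \<Rightarrow> f i (k - i))) has_sum s) (SIGMA k:UNIV. {..k})"
      using s has_sum_reindex_bij_betw[OF bij, of "\<lambda>(n, m). f n m" s]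
        by (simp add: case_prod_unfold)
    hence "((\<lambda>k. \<Sum>i\<le>k. f i (k - i)) has_sum s) UNIV"
      by (rule has_sum_SigmaD) auto
    also have "(\<lambda>k. \<Sum>i\<le>k. f i (k - i)) =
        (\<lambda>k. (if k = 0 then 1 else if k = 1 then -1 else 0) *\<^sub>R (B ^^ k) x)"
    proof
      fix k
      have "(\<Sum>i\<le>k. f i (k - i)) = (\<Sum>i\<le>k. (sqrt_coeff i * sqrt_coeff (k - i)) *\<^sub>R (B ^^ k) x)"
        by (rule sum.cong) (auto simp: f_def)
      thus "(\<Sum>i\<le>k. f i (k - i)) = (if k = 0 then 1 else if k = 1 then -1 else 0) *\<^sub>R (B ^^ k) x"
        by (simp only: scaleR_sum_left[symmetric] sqrt_coeff_convolution)
    qed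
    finally have "((\<lambda>k. (if k = 0 then 1 else
        if k = 1 then -1 else 0) *\<^sub>R (B ^^ k) x) has_sum s) UNIV" .
    moreover have "((\<lambda>k. (if k = 0 then 1 else if k = 1 then -1 else 0) *\<^sub>R (B ^^ k) x)
        has_sum (x - B x)) UNIV"
    proof (rule has_sum_finite_neutralI[where B="{0, 1}"])
    qed auto
    ultimately have "s = x - B x" by (rule has_sum_unique)
    with 1 show ?thesis by simp
  qed
  show ?thesis
    using nonneg_opI[OF Sl sym pos] sq comm by (intro exI[of _ S]) simp
qed

lemma nonneg_op_sqrt_exists:
  fixes A :: "'a::{complex_inner,banach} \<Rightarrow> 'a"
  assumes A: "nonneg_op A"
  shows "\<exists>S. nonneg_op S \<and> (\<forall>x. S (S x) = A x) \<and>
    (\<forall>C. bounded_clinear C \<longrightarrow> (\<forall>x. C (A x) = A (C x)) \<longrightarrow> (\<forall>x. C (S x) = S (C x)))"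
proof -
  note Al = nonneg_op_bounded_clinear[OF A]
  obtain K0 where K0: "K0 \<ge> 0" "\<And>x. norm (A x) \<le> K0 * norm x" using bounded_clinear_bound[OF Al]
    by auto
  \<comment> \<open>the summand 1 makes the scaling factor nonzero\<close>
  define K where "K = K0 + 1"
  have K: "K > 0" "norm (A x) \<le> K * norm x" for x
    using K0(1) K0(2)[of x] by (auto simp: K_def distrib_right intro: add_increasing2)
  define B where "B x = x - complex_of_real (1 / K) *\<^sub>C A x" for x
  have in_B: "inner (B x) x = (norm x)\<^sup>2 - inner (A x) x / K" for x
    by (simp add: B_def inner_diff_left dot_square_norm scaleR_scaleC[symmetric] del:
        of_real_divide)
  have Bl: "bounded_clinear B"
    unfolding B_def by (intro bounded_clinear_minus_op bounded_clinear_id bounded_clinear_scaleC_op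
        Al)
  have B: "nonneg_op B"
  proof (rule nonneg_opI[OF Bl])
    show "cinner (B x) y = cinner x (B y)" for x y
      by (simp add: B_def cinner_diff_left cinner_diff_right cinner_scaleC_left cinner_scaleC_right
          nonneg_op_symmetric[OF A])
    show "inner (B x) x \<ge> 0" for x
    proof -
      have "inner (A x) x \<le> norm (A x) * norm x" by (rule norm_cauchy_schwarz)
      also have "\<dots> \<le> K * norm x * norm x" by (intro mult_right_mono K) simp
      finally show ?thesis using K(1) by (simp add: in_B field_simps power2_eq_square)
    qed
  qed
  have "inner (B x) x \<le> (norm x)\<^sup>2" for x
    using nonneg_op_inner[OF A, of x] K(1) by (simp add: in_B)
  from sqrt_of_id_minus[OF B this] obtain S where S: "nonneg_op S" "\<And>x. S (S x) = x - B x"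
    "\<And>C x. bounded_clinear C \<Longrightarrow> (\<And>x. C (B x) = B (C x)) \<Longrightarrow> C (S x) = S (C x)" by metis
  note Sl = nonneg_op_bounded_clinear[OF S(1)]
  define R where "R x = complex_of_real (sqrt K) *\<^sub>C S x" for x
  have "nonneg_op R"
  proof (rule nonneg_opI)
    show "bounded_clinear R" unfolding R_def by (intro bounded_clinear_scaleC_op Sl)
    show "cinner (R x) y = cinner x (R y)" for x y
      by (simp add: R_def cinner_scaleC_left cinner_scaleC_right nonneg_op_symmetric[OF S(1)])
    show "inner (R x) x \<ge> 0" for x
      using nonneg_op_inner[OF S(1), of x] K(1) by (simp add: R_def scaleR_scaleC[symmetric])
  qed
  moreover have "R (R x) = A x" for x
  proof -
    have "R (R x) = complex_of_real (sqrt K) *\<^sub>C complex_of_real (sqrt K) *\<^sub>C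
        complex_of_real (1 / K) *\<^sub>C A x"
      by (simp add: R_def bounded_clinear_simps[OF Sl] S(2) B_def)
    also have "\<dots> = complex_of_real (sqrt K * sqrt K * (1 / K)) *\<^sub>C A x"
      by (simp only: scaleC_scaleC of_real_mult mult.assoc)
    also have "sqrt K * sqrt K * (1 / K) = 1" using K(1) by simp
    finally have "R (R x) = complex_of_real 1 *\<^sub>C A x" .
    hence "R (R x) = A x" by simp
    thus ?thesis .
  qed
  moreover have "C (R x) = R (C x)" if C: "bounded_clinear C" "\<And>x. C (A x) = A (C x)" for C x
  proof -
    have "C (S x) = S (C x)"
      by (rule S(3)[OF C(1)]) (simp add: B_def bounded_clinear_simps[OF C(1)] C(2))
    thus ?thesis by (simp add: R_def bounded_clinear_simps[OF C(1)])
  qed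
  ultimately show ?thesis by (intro exI[of _ R]) simp
qed

text \<open>
  For \<open>y = R x - S x\<close>, the sum of the non-negative numbers \<open>inner (R y) y\<close> and \<open>inner (S y) y\<close> is 0
  because \<open>(R + S)(R - S) = 0\<close>.
\<close>

lemma nonneg_op_sqrt_unique:
  fixes R S :: "'a::complex_inner \<Rightarrow> 'a"
  assumes R: "nonneg_op R" and S: "nonneg_op S"
    and eq: "\<And>x. R (R x) = S (S x)" and comm: "\<And>x. R (S x) = S (R x)"
  shows "R = S"
proof
  fix x
  note Rl = nonneg_op_bounded_clinear[OF R] and Sl = nonneg_op_bounded_clinear[OF S]
  define y where "y = R x - S x"
  have "R y + S y = 0"
    by (simp add: y_def bounded_clinear_simps[OF Rl] bounded_clinear_simps[OF Sl] eq comm)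
  hence "inner (R y) y + inner (S y) y = 0" by (simp add: inner_add_left[symmetric])
  hence "inner (R y) y = 0" "inner (S y) y = 0"
    using nonneg_op_inner[OF R, of y] nonneg_op_inner[OF S, of y] by linarith+
  hence "R y = 0" "S y = 0" by (auto intro: nonneg_op_inner_zeroD R S)
  hence "cinner y y = 0"
    by (simp add: y_def cinner_diff_left nonneg_op_symmetric[OF R] nonneg_op_symmetric[OF S])
  thus "R x = S x" by (simp add: y_def)
qed

lemma op_sqrt_properties:
  fixes A :: "'a::{complex_inner,banach} \<Rightarrow> 'a"
  assumes A: "nonneg_op A"
  shows "nonneg_op (op_sqrt A) \<and> op_sqrt A \<circ> op_sqrt A = A"
proof -
  obtain S where S: "nonneg_op S" "\<And>x. S (S x) = A x"
    "\<And>C x. bounded_clinear C \<Longrightarrow> (\<And>x. C (A x) = A (C x)) \<Longrightarrow> C (S x) = S (C x)"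
    using nonneg_op_sqrt_exists[OF A] by metis
  have SA: "nonneg_op S \<and> S \<circ> S = A" using S(1,2) by (auto simp: o_def)
  have "R = S" if R: "nonneg_op R \<and> R \<circ> R = A" for R
  proof -
    have RR: "R (R x) = A x" for x using R by (auto simp: o_def)
    have "R (S x) = S (R x)" for x
      by (rule S(3)) (use R RR in \<open>auto intro: nonneg_op_bounded_clinear simp flip: RR\<close>)
    thus "R = S" using R S RR by (intro nonneg_op_sqrt_unique) auto
  qed
  hence "op_sqrt A = S" unfolding op_sqrt_def using SA by (intro the_equality)
  thus ?thesis using SA by simp
qed

context
  fixes A :: "'a::{complex_inner,banach} \<Rightarrow> 'a"
  assumes A: "nonneg_op A"
begin

lemma op_sqrt_nonneg: "nonneg_op (op_sqrt A)"
  using op_sqrt_properties[OF A] by simp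

lemma op_sqrt_sq: "op_sqrt A (op_sqrt A x) = A x"
  using op_sqrt_properties[OF A] by (auto simp: o_def dest: fun_cong)

lemma bounded_clinear_op_sqrt: "bounded_clinear (op_sqrt A)"
  by (rule nonneg_op_bounded_clinear[OF op_sqrt_nonneg])

lemma op_sqrt_symmetric: "cinner (op_sqrt A x) y = cinner x (op_sqrt A y)"
  by (rule nonneg_op_symmetric[OF op_sqrt_nonneg])

lemma cinner_op_sqrt: "cinner (op_sqrt A x) (op_sqrt A y) = cinner (A x) y"
  by (simp add: op_sqrt_symmetric[symmetric] op_sqrt_sq)

lemma norm_op_sqrt: "(norm (op_sqrt A x))\<^sup>2 = inner (A x) x"
proof -
  have "Re (cinner (op_sqrt A x) (op_sqrt A x)) = Re (cinner (A x) x)"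
    by (simp only: cinner_op_sqrt)
  thus ?thesis by (simp only: cinner_self Re_complex_of_real inner_eq_Re_cinner)
qed

end

section \<open>Orthogonal projections and isometries\<close>

text \<open>The orthogonal projection onto a closed subspace of a Hilbert space.\<close>

definition orth_proj :: "'a::complex_inner set \<Rightarrow> 'a \<Rightarrow> 'a" where
  "orth_proj D x = (SOME p. p \<in> D \<and> (\<forall>v\<in>D. cinner v x = cinner v p))"

context
  fixes D :: "'a::{complex_inner,banach} set"
  assumes D: "closed_csubspace D"
begin

lemma orth_proj_exists: "\<exists>p. p \<in> D \<and> (\<forall>v\<in>D. cinner v x = cinner v p)"
proof -
  have "\<exists>p\<in>D. \<forall>v\<in>D. cinner v x = cinner v p"
    by (rule riesz_representation[OF D, where K="norm x"])
       (simp_all add: cinner_add_left cinner_scaleC_left cinner_Cauchy_Schwarz mult.commute[of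
           "norm x"])
  thus ?thesis by blast
qed

lemma orth_proj_in: "orth_proj D x \<in> D"
  and cinner_orth_proj: "v \<in> D \<Longrightarrow> cinner v (orth_proj D x) = cinner v x"
  using someI_ex[OF orth_proj_exists[of x]] unfolding orth_proj_def[symmetric] by auto

lemma orth_proj_eqI:
  assumes "p \<in> D" "\<And>v. v \<in> D \<Longrightarrow> cinner v x = cinner v p"
  shows "orth_proj D x = p"
proof -
  let ?d = "orth_proj D x - p"
  have "?d \<in> D" by (intro csubspace_diff D orth_proj_in assms)
  hence "cinner ?d ?d = 0" using assms(2)[of ?d] by (simp add: cinner_diff_right cinner_orth_proj)
  thus ?thesis by simp
qed

lemma orth_proj_id: "x \<in> D \<Longrightarrow> orth_proj D x = x"
  by (intro orth_proj_eqI) simp_all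

lemma norm_orth_proj_le: "norm (orth_proj D x) \<le> norm x"
proof -
  let ?p = "orth_proj D x"
  have "(norm ?p)\<^sup>2 = cmod (cinner ?p ?p)" by (simp add: cinner_self norm_power)
  also have "\<dots> = cmod (cinner ?p x)" by (simp add: cinner_orth_proj orth_proj_in)
  also have "\<dots> \<le> norm ?p * norm x" by (rule cinner_Cauchy_Schwarz)
  finally have "norm ?p * norm ?p \<le> norm ?p * norm x" by (simp add: power2_eq_square)
  thus ?thesis by (cases "?p = 0") (auto simp: mult_le_cancel_left_pos)
qed

lemma bounded_clinear_orth_proj: "bounded_clinear (orth_proj D)"
proof (rule bounded_clinearI[where K=1])
  show "orth_proj D (x + y) = orth_proj D x + orth_proj D y" for x y
    by (rule orth_proj_eqI) (simp_all add: csubspace_add[OF D] orth_proj_in cinner_add_right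
        cinner_orth_proj)
  show "orth_proj D (c *\<^sub>C x) = c *\<^sub>C orth_proj D x" for c x
    by (rule orth_proj_eqI) (simp_all add: csubspace_scaleC[OF D] orth_proj_in cinner_scaleC_right
        cinner_orth_proj)
qed (simp add: norm_orth_proj_le)

text \<open>A linear isometry preserves inner products, by polarization.\<close>

lemma isometry_cinner:
  fixes V :: "'a \<Rightarrow> 'b::complex_inner"
  assumes V: "bounded_clinear V" and iso: "\<And>x. x \<in> D \<Longrightarrow> norm (V x) = norm x"
    and "x \<in> D" "y \<in> D"
  shows "cinner (V x) (V y) = cinner x y"
proof -
  have real: "inner (V x) (V y) = inner x y" if "x \<in> D" "y \<in> D" for x y
  proof -
    have "(norm (V x + V y))\<^sup>2 = (norm (x + y))\<^sup>2"
      using iso[OF csubspace_add[OF D that]] by (simp add: bounded_clinear_simps[OF V])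
    hence "inner (V x + V y) (V x + V y) = inner (x + y) (x + y)" by (simp add: dot_square_norm)
    moreover have "inner (V x) (V x) = inner x x" "inner (V y) (V y) = inner y y"
      using iso that by (simp_all add: dot_square_norm)
    ultimately show ?thesis by (simp add: inner_add_left inner_add_right inner_commute)
  qed
  have "inner (V x) (\<i> *\<^sub>C V y) = inner x (\<i> *\<^sub>C y)"
    using real[OF assms(3) csubspace_scaleC[OF D assms(4), of \<i>]]
    by (simp add: bounded_clinear_simps[OF V])
  with real[OF assms(3,4)] show ?thesis by (simp add: cinner_eq_inner)
qed

text \<open>
  The image of an isometry on a closed subspace is closed, so it exhausts every closed subspace that
  contains it and in which its orthogonal complement vanishes.
\<close>

lemma isometry_onto:
  fixes V :: "'a \<Rightarrow> 'b::complex_inner"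
  assumes V: "bounded_clinear V" and iso: "\<And>x. x \<in> D \<Longrightarrow> norm (V x) = norm x"
    and S: "closed_csubspace S" and into: "\<And>x. x \<in> D \<Longrightarrow> V x \<in> S"
    and total: "\<And>y. y \<in> S \<Longrightarrow> (\<And>x. x \<in> D \<Longrightarrow> cinner (V x) y = 0) \<Longrightarrow> y = 0"
  shows "V ` D = S"
proof
  show "S \<subseteq> V ` D"
  proof
    fix y assume y: "y \<in> S"
    have "\<exists>p\<in>D. \<forall>v\<in>D. cinner (V v) y = cinner v p"
    proof (rule riesz_representation[OF D, where K="norm y"])
      show "cmod (cinner (V x) y) \<le> norm y * norm x" if "x \<in> D" for x
        using cinner_Cauchy_Schwarz[of "V x" y] iso[OF that] by (simp add: mult.commute)
    qed (simp_all add: bounded_clinear_simps[OF V] cinner_add_left cinner_scaleC_left)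
    then obtain p where p: "p \<in> D" "\<And>v. v \<in> D \<Longrightarrow> cinner (V v) y = cinner v p" by blast
    have "y - V p = 0"
    proof (rule total)
      show "y - V p \<in> S" by (intro csubspace_diff S y into p)
      show "cinner (V v) (y - V p) = 0" if "v \<in> D" for v
        using p that by (simp add: cinner_diff_right isometry_cinner[OF V iso])
    qed
    thus "y \<in> V ` D" using p(1) by auto
  qed
qed (use into in auto)

end

text \<open>
  If \<open>norm (A x) = norm (B x)\<close> for all \<open>x\<close>, then \<open>A x \<mapsto> B x\<close> extends to a partial isometry with
  initial space the closure of the range of \<open>A\<close>.
\<close>

lemma partial_isometry_extension:
  fixes A :: "'a::complex_inner \<Rightarrow> 'b::{complex_inner,banach}"
    and B :: "'a \<Rightarrow> 'c::{complex_inner,banach}"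
  assumes A: "bounded_clinear A" and B: "bounded_clinear B"
    and eq: "\<And>x. norm (A x) = norm (B x)"
  shows "\<exists>V. bounded_clinear V \<and> (\<forall>x. V (A x) = B x) \<and>
    (\<forall>x. V x \<in> closure (range B) \<and> norm (V x) \<le> norm x) \<and>
    (\<forall>d\<in>closure (range A). norm (V d) = norm d)"
proof -
  define D where "D = closure (range A)"
  have D: "closed_csubspace D" unfolding D_def by (rule closed_csubspace_closure_range[OF A])
  have diff: "dist (A x) (A y) = dist (B x) (B y)" for x y
    using eq[of "x - y"]
      by (simp add: dist_norm bounded_clinear_simps[OF A] bounded_clinear_simps[OF B])
  have "\<exists>h y. (\<lambda>n. A (h n)) \<longlonglongrightarrow> d \<and> (\<lambda>n. B (h n)) \<longlonglongrightarrow> y" if "d \<in> D" for d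
  proof -
    from that obtain f where f: "\<And>n. f n \<in> range A" "f \<longlonglongrightarrow> d" by (auto simp: D_def closure_sequential)
    from f(1) have "\<forall>n. \<exists>h. f n = A h" by auto
    then obtain h where h: "\<And>n. f n = A (h n)" by metis
    have lim: "(\<lambda>n. A (h n)) \<longlonglongrightarrow> d" using f(2) unfolding h[symmetric] by simp
    hence "Cauchy (\<lambda>n. A (h n))" by (rule LIMSEQ_imp_Cauchy)
    hence "Cauchy (\<lambda>n. B (h n))" by (simp add: Cauchy_def diff)
    thus ?thesis using lim by (auto simp: Cauchy_convergent_iff convergent_def)
  qed
  then obtain H V0 where HV: "\<And>d. d \<in> D \<Longrightarrow> (\<lambda>n. A (H d n)) \<longlonglongrightarrow> d"
    "\<And>d. d \<in> D \<Longrightarrow> (\<lambda>n. B (H d n)) \<longlonglongrightarrow> V0 d" by metis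
  \<comment> \<open>the limit does not depend on the approximating sequence\<close>
  have V0_lim: "(\<lambda>n. B (k n)) \<longlonglongrightarrow> V0 d" if k: "(\<lambda>n. A (k n)) \<longlonglongrightarrow> d" and d: "d \<in> D" for k d
  proof -
    have "(\<lambda>n. A (k n) - A (H d n)) \<longlonglongrightarrow> d - d" by (intro tendsto_diff k HV d)
    hence "(\<lambda>n. norm (A (k n) - A (H d n))) \<longlonglongrightarrow> 0" using tendsto_norm_zero by auto
    hence "(\<lambda>n. norm (B (k n) - B (H d n))) \<longlonglongrightarrow> 0" by (simp only: diff[unfolded dist_norm])
    hence "(\<lambda>n. B (k n) - B (H d n)) \<longlonglongrightarrow> 0" by (rule tendsto_norm_zero_cancel)
    from tendsto_add[OF this HV(2)[OF d]] show ?thesis by simp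
  qed
  have V0_A: "V0 (A x) = B x" for x
  proof -
    have "A x \<in> D" using closure_subset[of "range A"] by (auto simp: D_def)
    hence "(\<lambda>n. B x) \<longlonglongrightarrow> V0 (A x)" by (rule V0_lim[OF tendsto_const])
    thus ?thesis by (rule LIMSEQ_unique[OF _ tendsto_const])
  qed
  have V0_add: "V0 (x + y) = V0 x + V0 y" if "x \<in> D" "y \<in> D" for x y
  proof (rule LIMSEQ_unique)
    show "(\<lambda>n. B (H x n + H y n)) \<longlonglongrightarrow> V0 (x + y)"
      using that by (intro V0_lim csubspace_add D) (auto simp: bounded_clinear_simps[OF A] intro!:
          tendsto_add HV)
    show "(\<lambda>n. B (H x n + H y n)) \<longlonglongrightarrow> V0 x + V0 y"
      using that by (auto simp: bounded_clinear_simps[OF B] intro!: tendsto_add HV)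
  qed
  have V0_scale: "V0 (c *\<^sub>C x) = c *\<^sub>C V0 x" if "x \<in> D" for c x
  proof (rule LIMSEQ_unique)
    show "(\<lambda>n. B (c *\<^sub>C H x n)) \<longlonglongrightarrow> V0 (c *\<^sub>C x)"
      using that by (intro V0_lim csubspace_scaleC D) (auto simp: bounded_clinear_simps[OF A]
          intro!: tendsto_scaleC HV)
    show "(\<lambda>n. B (c *\<^sub>C H x n)) \<longlonglongrightarrow> c *\<^sub>C V0 x"
      using that by (auto simp: bounded_clinear_simps[OF B] intro!: tendsto_scaleC HV)
  qed
  have V0_norm: "norm (V0 x) = norm x" if "x \<in> D" for x
    using LIMSEQ_unique[OF tendsto_norm[OF HV(2)[OF that]]] tendsto_norm[OF HV(1)[OF that]]
    unfolding eq by blast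
  have V0_cl: "V0 x \<in> closure (range B)" if "x \<in> D" for x
    unfolding closure_sequential using HV(2)[OF that] by (intro exI[of _ "\<lambda>n. B (H x n)"]) simp
  note pr = orth_proj_in[OF D] bounded_clinear_simps[OF bounded_clinear_orth_proj[OF D]]
  define V where "V x = V0 (orth_proj D x)" for x
  have V_D: "V x = V0 x" if "x \<in> D" for x using that by (simp add: V_def orth_proj_id[OF D])
  have V_norm: "norm (V x) \<le> norm x" for x
    by (simp add: V_def V0_norm pr norm_orth_proj_le[OF D])
  have "bounded_clinear V"
    by (rule bounded_clinearI[where K=1]) (simp_all add: V_norm, simp_all add: V_def V0_add
        V0_scale pr)
  moreover have "V (A x) = B x" for x
    using V_D[of "A x"] closure_subset[of "range A"] by (auto simp: V0_A D_def)
  moreover have "V x \<in> closure (range B)" for x by (simp add: V_def V0_cl pr)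
  moreover have "norm (V d) = norm d" if "d \<in> closure (range A)" for d
    using that V_D V0_norm by (simp add: D_def)
  ultimately show ?thesis using V_norm by (intro exI[of _ V] conjI allI ballI) simp_all
qed

text \<open>Pythagoras, and convergence of orthogonal series with square-summable norms.\<close>

lemma orthogonal_sum_norm:
  fixes f :: "'i \<Rightarrow> 'a::complex_inner"
  assumes "finite F" and orth: "\<And>i j. i \<noteq> j \<Longrightarrow> cinner (f i) (f j) = 0"
  shows "(norm (sum f F))\<^sup>2 = (\<Sum>i\<in>F. (norm (f i))\<^sup>2)"
  using assms(1)
proof (induction F rule: finite_induct)
  case (insert i F)
  have "cinner (f i) (sum f F) = (\<Sum>j\<in>F. cinner (f i) (f j))" by (rule cinner_sum_right)
  also have "\<dots> = 0" using insert(2) by (intro sum.neutral ballI orth) auto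
  finally have "inner (f i) (sum f F) = 0" by (simp add: inner_eq_Re_cinner)
  hence "(norm (f i + sum f F))\<^sup>2 = (norm (f i))\<^sup>2 + (norm (sum f F))\<^sup>2"
    by (simp add: dot_square_norm[symmetric] inner_add_left inner_add_right inner_commute)
  with insert show ?case by simp
qed simp

lemma orthogonal_has_sum:
  fixes f :: "'i \<Rightarrow> 'a::{complex_inner,banach}"
  assumes orth: "\<And>i j. i \<noteq> j \<Longrightarrow> cinner (f i) (f j) = 0"
    and sq: "((\<lambda>i. (norm (f i))\<^sup>2) has_sum c) UNIV"
  shows "\<exists>s. (f has_sum s) UNIV \<and> (norm s)\<^sup>2 = c"
proof -
  let ?q = "\<lambda>i. (norm (f i))\<^sup>2"
  have lim: "(sum ?q \<longlongrightarrow> c) (finite_subsets_at_top UNIV)" using sq by (simp add: has_sum_def)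
  have "\<exists>P. eventually P (finite_subsets_at_top UNIV) \<and>
      (\<forall>F F'. P F \<and> P F' \<longrightarrow> dist (sum f F) (sum f F') < e)" if "e > 0" for e
  proof -
    from has_sum_finite_approximation[OF sq, of "e\<^sup>2 / 8"] that obtain F0
      where F0: "finite F0" "dist (sum ?q F0) c \<le> e\<^sup>2 / 8" by auto
    have le: "sum ?q F \<le> c" if "finite F" for F
      by (rule finite_sum_le_has_sum[OF sq that]) auto
    have close: "norm (sum f F - sum f F0) < e / 2" if "finite F" "F0 \<subseteq> F" for F
    proof -
      have "sum f F - sum f F0 = sum f (F - F0)" using that by (simp add: sum_diff)
      hence "(norm (sum f F - sum f F0))\<^sup>2 = sum ?q (F - F0)"
        using that orthogonal_sum_norm[OF _ orth, of "F - F0"] by simp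
      also have "\<dots> = sum ?q F - sum ?q F0" using that F0 by (simp add: sum_diff)
      also have "\<dots> \<le> e\<^sup>2 / 8" using le[OF that(1)] F0(2) unfolding dist_real_def by argo
      also have "\<dots> < (e / 2)\<^sup>2" using \<open>e > 0\<close> by (simp add: power2_eq_square)
      finally show ?thesis by (rule power_less_imp_less_base) (use \<open>e > 0\<close> in simp)
    qed
    show ?thesis
    proof (intro exI conjI allI impI)
      show "eventually (\<lambda>F. finite F \<and> F0 \<subseteq> F) (finite_subsets_at_top UNIV)"
        using F0(1) by (auto simp: eventually_finite_subsets_at_top)
      fix F F' assume "(finite F \<and> F0 \<subseteq> F) \<and> (finite F' \<and> F0 \<subseteq> F')"
      hence "norm (sum f F - sum f F0) < e / 2" "norm (sum f F' - sum f F0) < e / 2"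
        using close by blast+
      thus "dist (sum f F) (sum f F') < e"
        unfolding dist_norm[symmetric] by (rule dist_triangle_half_l)
    qed
  qed
  hence "cauchy_filter (filtermap (sum f) (finite_subsets_at_top UNIV))"
    by (simp add: cauchy_filter_metric_filtermap)
  moreover have "complete (UNIV :: 'a set)"
    by (meson Cauchy_convergent UNIV_I complete_def convergent_def)
  ultimately obtain s where s: "(sum f \<longlongrightarrow> s) (finite_subsets_at_top UNIV)"
    using complete_uniform[where S="UNIV :: 'a set"] by (force simp add: filterlim_def)
  have "(sum ?q \<longlongrightarrow> (norm s)\<^sup>2) (finite_subsets_at_top UNIV)"
  proof (rule Lim_transform_eventually)
    show "((\<lambda>F. (norm (sum f F))\<^sup>2) \<longlongrightarrow> (norm s)\<^sup>2) (finite_subsets_at_top UNIV)"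
      by (intro tendsto_intros s)
    show "\<forall>\<^sub>F F in finite_subsets_at_top UNIV. (norm (sum f F))\<^sup>2 = sum ?q F"
      by (rule eventually_finite_subsets_at_top_weakI) (rule orthogonal_sum_norm[OF _ orth])
  qed
  hence "(norm s)\<^sup>2 = c" using lim by (rule tendsto_unique[rotated]) simp
  with s show ?thesis by (auto simp: has_sum_def)
qed

section \<open>Square-summable families\<close>

text \<open>The Hilbert space of square-summable families indexed by an arbitrary type.\<close>

typedef (overloaded) ('i, 'a) ell2 =
    "{f :: 'i \<Rightarrow> 'a::complex_inner. (\<lambda>i. (norm (f i))\<^sup>2) summable_on UNIV}"
  morphisms ell2_nth Ell2
  by (intro exI[of _ "\<lambda>i. 0"]) simp

setup_lifting type_definition_ell2

lemma ell2_nth_Ell2: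
  "(\<lambda>i. (norm (f i))\<^sup>2) summable_on UNIV \<Longrightarrow> ell2_nth (Ell2 f) = f"
  by (simp add: Ell2_inverse)

lemma ell2_summable: "(\<lambda>i. (norm (ell2_nth x i))\<^sup>2) summable_on UNIV"
  using ell2_nth[of x] by simp

lemma ell2_eqI: "(\<And>i. ell2_nth x i = ell2_nth y i) \<Longrightarrow> x = y"
  by (simp add: ell2_nth_inject[symmetric] fun_eq_iff)

lemma sq_summable_plus:
  fixes f g :: "'i \<Rightarrow> 'a::complex_inner"
  assumes "(\<lambda>i. (norm (f i))\<^sup>2) summable_on UNIV" "(\<lambda>i. (norm (g i))\<^sup>2) summable_on UNIV"
  shows "(\<lambda>i. (norm (f i + g i))\<^sup>2) summable_on UNIV"
proof (rule summable_on_comparison_test)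
  show "(\<lambda>i. 2 * (norm (f i))\<^sup>2 + 2 * (norm (g i))\<^sup>2) summable_on UNIV"
    by (intro summable_on_add summable_on_cmult_right assms)
  show "(norm (f i + g i))\<^sup>2 \<le> 2 * (norm (f i))\<^sup>2 + 2 * (norm (g i))\<^sup>2" for i
  proof -
    have "(norm (f i + g i))\<^sup>2 \<le> (norm (f i) + norm (g i))\<^sup>2"
      by (intro power_mono norm_triangle_ineq) simp
    also have "\<dots> \<le> 2 * (norm (f i))\<^sup>2 + 2 * (norm (g i))\<^sup>2"
      using sum_squares_bound[of "norm (f i)" "norm (g i)"] by (simp add: power2_sum)
    finally show ?thesis .
  qed
qed simp

lemma sq_summable_scaleC:
  fixes f :: "'i \<Rightarrow> 'a::complex_inner"
  assumes "(\<lambda>i. (norm (f i))\<^sup>2) summable_on UNIV"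
  shows "(\<lambda>i. (norm (c *\<^sub>C f i))\<^sup>2) summable_on UNIV"
  using summable_on_cmult_right[OF assms, of "(cmod c)\<^sup>2"] by (simp add: power_mult_distrib)

lemma sq_summable_cinner:
  fixes f g :: "'i \<Rightarrow> 'a::complex_inner"
  assumes "(\<lambda>i. (norm (f i))\<^sup>2) summable_on UNIV" "(\<lambda>i. (norm (g i))\<^sup>2) summable_on UNIV"
  shows "(\<lambda>i. cinner (f i) (g i)) summable_on UNIV"
proof (rule abs_summable_summable, rule summable_on_comparison_test)
  show "(\<lambda>i. (norm (f i))\<^sup>2 + (norm (g i))\<^sup>2) summable_on UNIV" by (intro summable_on_add assms)
  show "norm (cinner (f i) (g i)) \<le> (norm (f i))\<^sup>2 + (norm (g i))\<^sup>2" for i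
    using cinner_Cauchy_Schwarz[of "f i" "g i"] sum_squares_bound[of "norm (f i)" "norm (g i)"]
      mult_nonneg_nonneg[OF norm_ge_zero norm_ge_zero, of "f i" "g i"]
    by argo
qed simp

instantiation ell2 :: (type, complex_inner) real_vector
begin

lift_definition zero_ell2 :: "('a, 'b) ell2" is "\<lambda>i. 0" by simp
lift_definition plus_ell2 :: "('a, 'b) ell2 \<Rightarrow> ('a, 'b) ell2 \<Rightarrow> ('a, 'b) ell2"
  is "\<lambda>x y i. x i + y i" by (rule sq_summable_plus)
lift_definition scaleR_ell2 :: "real \<Rightarrow> ('a, 'b) ell2 \<Rightarrow> ('a, 'b) ell2"
  is "\<lambda>r x i. complex_of_real r *\<^sub>C x i" by (rule sq_summable_scaleC)
lift_definition uminus_ell2 :: "('a, 'b) ell2 \<Rightarrow> ('a, 'b) ell2" is "\<lambda>x i. - x i" by simp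
definition "minus_ell2 (x :: ('a, 'b) ell2) y = x + - y"

instance
proof
  fix x y z :: "('a, 'b) ell2" and r s :: real
  show "x + y + z = x + (y + z)" by transfer (simp add: add.assoc)
  show "x + y = y + x" by transfer (simp add: add.commute)
  show "0 + x = x" by transfer simp
  show "- x + x = 0" by transfer simp
  show "x - y = x + - y" by (simp add: minus_ell2_def)
  show "r *\<^sub>R (x + y) = r *\<^sub>R x + r *\<^sub>R y" by transfer (simp add: scaleC_add_right)
  show "(r + s) *\<^sub>R x = r *\<^sub>R x + s *\<^sub>R x" by transfer (simp add: scaleC_add_left)
  show "r *\<^sub>R s *\<^sub>R x = (r * s) *\<^sub>R x" by transfer (simp add: scaleC_scaleC)
  show "1 *\<^sub>R x = x" by transfer simp
qed

end

instantiation ell2 :: (type, complex_inner) complex_inner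
begin

lift_definition scaleC_ell2 :: "complex \<Rightarrow> ('a, 'b) ell2 \<Rightarrow> ('a, 'b) ell2"
  is "\<lambda>c x i. c *\<^sub>C x i" by (rule sq_summable_scaleC)
definition "cinner_ell2 (x :: ('a, 'b) ell2) y = (\<Sum>\<^sub>\<infinity>i. cinner (ell2_nth x i) (ell2_nth y i))"
definition "inner_ell2 (x :: ('a, 'b) ell2) y = Re (\<Sum>\<^sub>\<infinity>i. cinner (ell2_nth x i) (ell2_nth y i))"
definition "norm_ell2 (x :: ('a, 'b) ell2) =
  sqrt (Re (\<Sum>\<^sub>\<infinity>i. cinner (ell2_nth x i) (ell2_nth x i)))"
definition "sgn_ell2 (x :: ('a, 'b) ell2) = x /\<^sub>R norm x"
definition "dist_ell2 (x :: ('a, 'b) ell2) y = norm (x - y)"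
definition [code del]: "uniformity_ell2 = (INF e\<in>{0 <..}. principal {(x::('a, 'b) ell2, y). dist x
    y < e})"
definition [code del]: "open_ell2 (U :: ('a, 'b) ell2 set) \<longleftrightarrow>
    (\<forall>x\<in>U. eventually (\<lambda>(x', y). x' = x \<longrightarrow> y \<in> U) uniformity)"

instance
proof
  fix x y z :: "('a, 'b) ell2" and r s :: real and c d :: complex and U :: "('a, 'b) ell2 set"
  note summ = sq_summable_cinner[OF ell2_summable ell2_summable]
  show "c *\<^sub>C (x + y) = c *\<^sub>C x + c *\<^sub>C y" by transfer (simp add: scaleC_add_right)
  show "(c + d) *\<^sub>C x = c *\<^sub>C x + d *\<^sub>C x" by transfer (simp add: scaleC_add_left)
  show "c *\<^sub>C d *\<^sub>C x = (c * d) *\<^sub>C x" by transfer (simp add: scaleC_scaleC)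
  show scaleR: "r *\<^sub>R x = complex_of_real r *\<^sub>C x" for r and x :: "('a, 'b) ell2" by transfer simp
  show "dist x y = norm (x - y)" by (simp add: dist_ell2_def)
  show "sgn x = x /\<^sub>R norm x" by (simp add: sgn_ell2_def)
  show "uniformity = (INF e\<in>{0 <..}. principal {(x::('a, 'b) ell2, y). dist x y < e})"
    by (simp add: uniformity_ell2_def)
  show "open U \<longleftrightarrow> (\<forall>x\<in>U. eventually (\<lambda>(x', y). x' = x \<longrightarrow> y \<in> U) uniformity)"
    by (simp add: open_ell2_def)
  have inner: "inner x y = Re (cinner x y)" for x y :: "('a, 'b) ell2"
    by (simp add: inner_ell2_def cinner_ell2_def)
  have conj: "cinner x y = cnj (cinner y x)" for x y :: "('a, 'b) ell2"
    unfolding cinner_ell2_def infsum_cnj[symmetric] by (intro infsum_cong cinner_commute)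
  have add: "cinner (x + y) z = cinner x z + cinner y z" for x y z :: "('a, 'b) ell2"
    unfolding cinner_ell2_def
    by (simp add: plus_ell2.rep_eq cinner_add_left infsum_add summ)
  have scale: "cinner (c *\<^sub>C x) y = c * cinner x y" for c and x y :: "('a, 'b) ell2"
    unfolding cinner_ell2_def
    by (simp add: scaleC_ell2.rep_eq cinner_scaleC_left infsum_cmult_right')
  show "cinner x y = cnj (cinner y x)" by (rule conj)
  show "cinner (x + y) z = cinner x z + cinner y z" by (rule add)
  show "cinner (c *\<^sub>C x) y = c * cinner x y" by (rule scale)
  show "inner x y = Re (cinner x y)" by (rule inner)
  show "inner x y = inner y x" unfolding inner by (subst conj) simp
  show "inner (x + y) z = inner x z + inner y z" by (simp add: inner add)
  show "inner (r *\<^sub>R x) y = r * inner x y" by (simp add: inner scaleR scale)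
  have self: "inner x x = (\<Sum>\<^sub>\<infinity>i. (norm (ell2_nth x i))\<^sup>2)"
  proof -
    have "cinner x x = (\<Sum>\<^sub>\<infinity>i. complex_of_real ((norm (ell2_nth x i))\<^sup>2))"
      unfolding cinner_ell2_def by (simp only: cinner_self)
    also have "\<dots> = complex_of_real (\<Sum>\<^sub>\<infinity>i. (norm (ell2_nth x i))\<^sup>2)"
      by (rule infsumI, rule has_sum_of_real, rule has_sum_infsum, rule ell2_summable)
    finally show ?thesis by (simp add: inner)
  qed
  show "0 \<le> inner x x" unfolding self by (rule infsum_nonneg) simp
  show "inner x x = 0 \<longleftrightarrow> x = 0"
  proof
    assume "inner x x = 0"
    hence "(norm (ell2_nth x i))\<^sup>2 = 0" for i
      unfolding self by (intro nonneg_infsum_le_0D[OF _ ell2_summable[of x]]) auto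
    thus "x = 0" by (intro ell2_eqI) (simp add: zero_ell2.rep_eq)
  qed (simp add: inner_ell2_def zero_ell2.rep_eq)
  show "norm x = sqrt (inner x x)" by (simp add: norm_ell2_def inner_ell2_def)
qed

end

lemma ell2_nth_zero [simp]: "ell2_nth 0 i = 0" by (simp add: zero_ell2.rep_eq)
lemma ell2_nth_plus [simp]: "ell2_nth (x + y) i = ell2_nth x i + ell2_nth y i"
  by (simp add: plus_ell2.rep_eq)
lemma ell2_nth_minus [simp]: "ell2_nth (x - y) i = ell2_nth x i - ell2_nth y i"
  unfolding minus_ell2_def plus_ell2.rep_eq uminus_ell2.rep_eq by simp
lemma ell2_nth_scaleC [simp]: "ell2_nth (c *\<^sub>C x) i = c *\<^sub>C ell2_nth x i"
  by (simp add: scaleC_ell2.rep_eq)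

lemma ell2_cinner: "((\<lambda>i. cinner (ell2_nth x i) (ell2_nth y i)) has_sum cinner x y) UNIV"
  unfolding cinner_ell2_def by (intro has_sum_infsum sq_summable_cinner ell2_summable)

lemma ell2_norm: "((\<lambda>i. (norm (ell2_nth x i))\<^sup>2) has_sum (norm x)\<^sup>2) UNIV"
proof -
  have "((\<lambda>i. Re (cinner (ell2_nth x i) (ell2_nth x i))) has_sum Re (cinner x x)) UNIV"
    by (rule has_sum_Re[OF ell2_cinner])
  thus ?thesis by (simp only: cinner_self Re_complex_of_real)
qed

lemma ell2_norm_finite_sum_le: "finite F \<Longrightarrow> (\<Sum>i\<in>F. (norm (ell2_nth x i))\<^sup>2) \<le> (norm x)\<^sup>2"
  by (rule finite_sum_le_has_sum[OF ell2_norm]) auto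

lemma ell2_norm_nth_le: "norm (ell2_nth x i) \<le> norm x"
  using ell2_norm_finite_sum_le[of "{i}" x] power2_le_imp_le[of "norm (ell2_nth x i)" "norm x"]
    by simp

lemma bounded_clinear_ell2_nth: "bounded_clinear (\<lambda>x. ell2_nth x i)"
  by (rule bounded_clinearI[where K=1]) (simp_all add: ell2_norm_nth_le)

instance ell2 :: (type, "{complex_inner,banach}") banach
proof
  fix X :: "nat \<Rightarrow> ('a, 'b) ell2"
  assume X: "Cauchy X"
  have "Cauchy (\<lambda>n. ell2_nth (X n) i)" for i
    by (rule bounded_linear.Cauchy[OF bounded_clinear_bounded_linear[OF bounded_clinear_ell2_nth]
        X])
  hence "\<forall>i. \<exists>l. (\<lambda>n. ell2_nth (X n) i) \<longlonglongrightarrow> l" by (simp add: Cauchy_convergent_iff convergent_def)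
  then obtain L where L: "\<And>i. (\<lambda>n. ell2_nth (X n) i) \<longlonglongrightarrow> L i" by metis
  have tail: "\<exists>N. \<forall>n\<ge>N. \<forall>F. finite F \<longrightarrow> (\<Sum>i\<in>F. (norm (ell2_nth (X n) i - L i))\<^sup>2) \<le> e\<^sup>2"
    if e: "e > 0" for e
  proof -
    obtain N where N: "\<And>m n. m \<ge> N \<Longrightarrow> n \<ge> N \<Longrightarrow> norm (X m - X n) < e"
      using CauchyD[OF X e] by blast
    have "(\<Sum>i\<in>F. (norm (ell2_nth (X n) i - L i))\<^sup>2) \<le> e\<^sup>2" if "n \<ge> N" "finite F" for n F
    proof (rule LIMSEQ_le_const2)
      show "(\<lambda>m. \<Sum>i\<in>F. (norm (ell2_nth (X n) i - ell2_nth (X m) i))\<^sup>2) \<longlonglongrightarrow>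
          (\<Sum>i\<in>F. (norm (ell2_nth (X n) i - L i))\<^sup>2)"
        by (intro tendsto_intros L)
      have "(\<Sum>i\<in>F. (norm (ell2_nth (X n) i - ell2_nth (X m) i))\<^sup>2) \<le> e\<^sup>2" if "m \<ge> N" for m
      proof -
        have "(\<Sum>i\<in>F. (norm (ell2_nth (X n - X m) i))\<^sup>2) \<le> (norm (X n - X m))\<^sup>2"
          by (rule ell2_norm_finite_sum_le) fact
        also have "\<dots> \<le> e\<^sup>2" using N[OF \<open>n \<ge> N\<close> that] by (intro power_mono) auto
        finally show ?thesis by simp
      qed
      thus "\<exists>N. \<forall>m\<ge>N. (\<Sum>i\<in>F. (norm (ell2_nth (X n) i - ell2_nth (X m) i))\<^sup>2) \<le> e\<^sup>2" by blast
    qed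
    thus ?thesis by blast
  qed
  have summ: "(\<lambda>i. (norm (ell2_nth (X n) i - L i))\<^sup>2) summable_on UNIV"
    if "\<And>F. finite F \<Longrightarrow> (\<Sum>i\<in>F. (norm (ell2_nth (X n) i - L i))\<^sup>2) \<le> e\<^sup>2" for n and e :: real
    by (rule nonneg_bdd_above_summable_on) (auto intro!: bdd_aboveI2[where M="e\<^sup>2"] that)
  obtain N where N: "\<And>F. finite F \<Longrightarrow> (\<Sum>i\<in>F. (norm (ell2_nth (X N) i - L i))\<^sup>2) \<le> 1\<^sup>2"
    using tail[of 1] by auto
  have "(\<lambda>i. (norm (ell2_nth (X N) i + (-1) *\<^sub>C (ell2_nth (X N) i - L i)))\<^sup>2) summable_on UNIV"
    by (rule sq_summable_plus[OF ell2_summable sq_summable_scaleC[OF summ[OF N]]])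
  hence L2: "(\<lambda>i. (norm (L i))\<^sup>2) summable_on UNIV" by simp
  have "X \<longlonglongrightarrow> Ell2 L"
  proof (rule LIMSEQ_I)
    fix e :: real assume "e > 0"
    then obtain N where N: "\<And>n F. n \<ge> N \<Longrightarrow> finite F \<Longrightarrow>
        (\<Sum>i\<in>F. (norm (ell2_nth (X n) i - L i))\<^sup>2) \<le> (e/2)\<^sup>2"
      using tail[of "e/2"] by auto
    have "norm (X n - Ell2 L) < e" if "n \<ge> N" for n
    proof -
      have "(norm (X n - Ell2 L))\<^sup>2 \<le> (e/2)\<^sup>2"
      proof (rule has_sum_le_finite_sums[OF ell2_norm])
        fix F :: "'a set" assume "finite F"
        from N[OF that this] show "(\<Sum>i\<in>F. (norm (ell2_nth (X n - Ell2 L) i))\<^sup>2) \<le> (e/2)\<^sup>2"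
          by (simp only: ell2_nth_minus ell2_nth_Ell2[OF L2])
      qed
      hence "norm (X n - Ell2 L) \<le> e/2" by (rule power2_le_imp_le) (use \<open>e > 0\<close> in simp)
      thus ?thesis using \<open>e > 0\<close> by simp
    qed
    thus "\<exists>N. \<forall>n\<ge>N. norm (X n - Ell2 L) < e" by blast
  qed
  thus "convergent X" by (auto simp: convergent_def)
qed

section \<open>Products of commuting maps\<close>

lemma op_prod_empty [simp]: "op_prod F {} x = x"
  by (simp add: op_prod_def)

context
  fixes F :: "'i \<Rightarrow> 'b \<Rightarrow> 'b"
  assumes comm: "\<And>i j x. F i (F j x) = F j (F i x)"
begin

lemma op_prod_insert:
  assumes "finite I" "i \<notin> I"
  shows "op_prod F (insert i I) x = F i (op_prod F I x)"
proof -
  interpret comp_fun_commute "\<lambda>i G. F i \<circ> G"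
    by standard (simp add: fun_eq_iff comm)
  show ?thesis unfolding op_prod_def using assms by simp
qed

lemma op_prod_intertwine:
  assumes "finite I" "\<And>i x. i \<in> I \<Longrightarrow> C (F i x) = F i (C x)"
  shows "C (op_prod F I x) = op_prod F I (C x)"
  using assms by (induction I rule: finite_induct) (simp_all add: op_prod_insert)

lemma op_prod_inverse:
  assumes "finite I" and commG: "\<And>i j x. G i (G j x) = G j (G i x)" and inv: "\<And>i x. G i (F i x) = x"
  shows "op_prod G I (op_prod F I x) = x"
  using assms(1)
proof (induction I arbitrary: x rule: finite_induct)
  case (insert i I)
  interpret G: comp_fun_commute "\<lambda>i H. G i \<circ> H"
    by standard (simp add: fun_eq_iff commG)
  have "op_prod G (insert i I) y = G i (op_prod G I y)" for y
    unfolding op_prod_def using insert by simp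
  moreover have "F i (op_prod F I x) = op_prod F I (F i x)"
    by (rule op_prod_intertwine[OF insert(1)]) (rule comm)
  ultimately show ?case using insert by (simp add: op_prod_insert inv)
qed simp

end

section \<open>Multi-indices and shifts\<close>

text \<open>A multi-index is a function \<open>'n \<Rightarrow> nat\<close>; \<open>unit_index i\<close> is the exponent of the monomial \<open>z i\<close>.\<close>

definition unit_index :: "'n \<Rightarrow> 'n \<Rightarrow> nat" where
  "unit_index i = (\<lambda>j. if j = i then 1 else 0)"

lemma multi_index_induct [case_names zero step]:
  fixes k :: "'n::finite \<Rightarrow> nat"
  assumes "P (\<lambda>_. 0)" "\<And>k i. P k \<Longrightarrow> P (\<lambda>j. unit_index i j + k j)"
  shows "P k"
proof (induction "sum k UNIV" arbitrary: k)
  case 0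
  hence "k = (\<lambda>_. 0)" by auto
  thus ?case using assms(1) by simp
next
  case (Suc m)
  then obtain i where i: "k i > 0" by (metis gr0I sum.neutral nat.distinct(1))
  define l where "l = k(i := k i - 1)"
  have k: "k = (\<lambda>j. unit_index i j + l j)" using i by (auto simp: l_def unit_index_def)
  have "sum k UNIV = sum (unit_index i) UNIV + sum l UNIV" by (subst k) (simp add: sum.distrib)
  also have "sum (unit_index i) UNIV = 1" by (simp add: unit_index_def)
  finally have "P l" using Suc by simp
  thus ?case unfolding k by (rule assms(2))
qed

lemma inj_index_shift: "inj (\<lambda>(m::'n \<Rightarrow> nat) i. k i + m i)"
  by (rule injI) (simp add: fun_eq_iff)

lemma range_index_shift: "range (\<lambda>(m::'n \<Rightarrow> nat) i. k i + m i) = {m. \<forall>i. k i \<le> m i}"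
proof safe
  fix m :: "'n \<Rightarrow> nat" assume "\<forall>i. k i \<le> m i"
  hence "m = (\<lambda>i. k i + (m i - k i))" by auto
  thus "m \<in> range (\<lambda>m i. k i + m i)" by (rule image_eqI[where x="\<lambda>i. m i - k i"]) simp
qed auto

text \<open>
  \<open>mshift k\<close> multiplies by the monomial with exponent \<open>k\<close>, in terms of coefficients; \<open>mbshift k\<close> is
  its adjoint.
\<close>

lift_definition mshift ::
  "('n \<Rightarrow> nat) \<Rightarrow> ('n \<Rightarrow> nat, 'a::complex_inner) ell2 \<Rightarrow> ('n \<Rightarrow> nat, 'a) ell2"
  is "\<lambda>k x m. if \<forall>i. k i \<le> m i then x (\<lambda>i. m i - k i) else 0"
proof -
  fix k :: "'n \<Rightarrow> nat" and x :: "('n \<Rightarrow> nat) \<Rightarrow> 'a"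
  let ?g = "\<lambda>m. (norm (if \<forall>i. k i \<le> m i then x (\<lambda>i. m i - k i) else 0))\<^sup>2"
  assume "(\<lambda>i. (norm (x i))\<^sup>2) summable_on UNIV"
  hence "?g summable_on range (\<lambda>m i. k i + m i)"
    by (subst summable_on_reindex[OF inj_index_shift]) (simp add: o_def)
  thus "?g summable_on UNIV"
    by (rule summable_on_cong_neutral[THEN iffD1, rotated -1]) (auto simp: range_index_shift)
qed

lift_definition mbshift ::
  "('n \<Rightarrow> nat) \<Rightarrow> ('n \<Rightarrow> nat, 'a::complex_inner) ell2 \<Rightarrow> ('n \<Rightarrow> nat, 'a) ell2"
  is "\<lambda>k x m. x (\<lambda>i. k i + m i)"
proof -
  fix k :: "'n \<Rightarrow> nat" and x :: "('n \<Rightarrow> nat) \<Rightarrow> 'a"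
  assume "(\<lambda>i. (norm (x i))\<^sup>2) summable_on UNIV"
  hence "(\<lambda>i. (norm (x i))\<^sup>2) summable_on range (\<lambda>m i. k i + m i)"
    by (rule summable_on_subset) simp
  thus "(\<lambda>m. (norm (x (\<lambda>i. k i + m i)))\<^sup>2) summable_on UNIV"
    by (subst (asm) summable_on_reindex[OF inj_index_shift]) (simp add: o_def)
qed

lemmas mshift_nth = mshift.rep_eq and mbshift_nth = mbshift.rep_eq

lemma cinner_mshift: "cinner (mshift k x) y = cinner x (mbshift k y)"
proof (rule has_sum_unique[OF _ ell2_cinner])
  let ?g = "\<lambda>m. cinner (ell2_nth (mshift k x) m) (ell2_nth y m)"
  have "(?g has_sum cinner (mshift k x) y) (range (\<lambda>m i. k i + m i))"
    by (rule has_sum_cong_neutral[THEN iffD1, OF _ _ _ ell2_cinner])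
       (auto simp: range_index_shift mshift_nth)
  thus "((\<lambda>m. cinner (ell2_nth x m) (ell2_nth (mbshift k y) m)) has_sum cinner (mshift k x) y) UNIV"
    by (subst (asm) has_sum_reindex[OF inj_index_shift]) (simp add: o_def mshift_nth mbshift_nth)
qed

lemma cinner_mbshift: "cinner (mbshift k x) y = cinner x (mshift k y)"
  using cinner_mshift[of k y x] by (metis cinner_commute)

lemma mbshift_mshift [simp]: "mbshift k (mshift k x) = x"
  by (rule ell2_eqI) (simp add: mshift_nth mbshift_nth)

lemma norm_mshift [simp]: "norm (mshift k x) = norm x"
proof -
  have "Re (cinner (mshift k x) (mshift k x)) = Re (cinner x x)"
    by (simp only: cinner_mshift mbshift_mshift)
  thus ?thesis by (simp only: cinner_self Re_complex_of_real) simp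
qed

lemma norm_mbshift_le: "norm (mbshift k x) \<le> norm x"
proof -
  let ?y = "mbshift k x"
  have "(norm ?y)\<^sup>2 = cmod (cinner x (mshift k ?y))"
    by (simp only: cinner_mbshift[symmetric]) (simp add: cinner_self norm_power)
  also have "\<dots> \<le> norm x * norm ?y" using cinner_Cauchy_Schwarz[of x "mshift k ?y"] by simp
  finally have "norm ?y * norm ?y \<le> norm ?y * norm x" by (simp add: power2_eq_square mult.commute)
  thus ?thesis by (cases "?y = 0") (auto simp: mult_le_cancel_left_pos)
qed

lemma bounded_clinear_mshift: "bounded_clinear (mshift k)"
  by (rule bounded_clinearI[where K=1]) (auto intro!: ell2_eqI simp: mshift_nth)

lemma bounded_clinear_mbshift: "bounded_clinear (mbshift k)"
  by (rule bounded_clinearI[where K=1]) (auto intro!: ell2_eqI simp: mbshift_nth norm_mbshift_le)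

lemma mshift_mshift: "mshift k (mshift l x) = mshift (\<lambda>i. k i + l i) x"
proof (rule ell2_eqI)
  fix m
  have "k i \<le> m i \<and> l i \<le> m i - k i \<longleftrightarrow> k i + l i \<le> m i" for i by arith
  hence "(\<forall>i. k i \<le> m i) \<and> (\<forall>i. l i \<le> m i - k i) \<longleftrightarrow> (\<forall>i. k i + l i \<le> m i)"
    by (simp only: all_conj_distrib[symmetric])
  thus "ell2_nth (mshift k (mshift l x)) m = ell2_nth (mshift (\<lambda>i. k i + l i) x) m"
    by (auto simp: mshift_nth diff_diff_left)
qed

lemma mbshift_mbshift: "mbshift k (mbshift l x) = mbshift (\<lambda>i. l i + k i) x"
  by (rule ell2_eqI) (simp add: mbshift_nth add.assoc)

lemma mshift_commute: "mshift k (mshift l x) = mshift l (mshift k x)"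
  by (simp add: mshift_mshift add.commute)

lemma mbshift_commute: "mbshift k (mbshift l x) = mbshift l (mbshift k x)"
  by (simp add: mbshift_mbshift add.commute)

lemma mshift_zero [simp]: "mshift (\<lambda>_. 0) x = x"
  by (rule ell2_eqI) (simp add: mshift_nth)

lemma mbshift_zero [simp]: "mbshift (\<lambda>_. 0) x = x"
  by (rule ell2_eqI) (simp add: mbshift_nth)

lemma mbshift_unit_mshift:
  assumes "k i = 0"
  shows "mbshift (unit_index i) (mshift k x) = mshift k (mbshift (unit_index i) x)"
proof (rule ell2_eqI)
  fix m
  have "k j \<le> unit_index i j + m j \<longleftrightarrow> k j \<le> m j" for j
    using assms by (cases "j = i") (simp_all add: unit_index_def)
  moreover have "(\<lambda>j. unit_index i j + m j - k j) = (\<lambda>j. unit_index i j + (m j - k j))"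
    if "\<forall>j. k j \<le> m j"
    using that by (auto simp: fun_eq_iff)
  ultimately show "ell2_nth (mbshift (unit_index i) (mshift k x)) m =
      ell2_nth (mshift k (mbshift (unit_index i) x)) m"
    by (auto simp: mshift_nth mbshift_nth)
qed

lemma mbshift_unit_mshift_unit:
  "i \<noteq> j \<Longrightarrow> mbshift (unit_index i) (mshift (unit_index j) x) = mshift (unit_index j) (mbshift
      (unit_index i) x)"
  by (rule mbshift_unit_mshift) (simp add: unit_index_def)

lemma cadjoint_mshift: "cadjoint (mshift k) = mbshift k"
  by (rule cadjointI) (rule cinner_mshift)

lemma mbshift_unit_funpow: "(mbshift (unit_index i) ^^ m) x = mbshift (\<lambda>j. m * unit_index i j) x"
  by (induction m) (simp_all add: mbshift_mbshift add.commute)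

lemma mbshift_unit_tendsto_0: "(\<lambda>m. (mbshift (unit_index i) ^^ m) x) \<longlonglongrightarrow> 0"
proof (rule LIMSEQ_I)
  fix e :: real assume e: "e > 0"
  let ?q = "\<lambda>k. (norm (ell2_nth x k))\<^sup>2"
  from has_sum_finite_approximation[OF ell2_norm, of "(e/2)\<^sup>2" x] e
  obtain F where F: "finite F" "dist (sum ?q F) ((norm x)\<^sup>2) \<le> (e/2)\<^sup>2" by auto
  define N where "N = Suc (Max (insert 0 ((\<lambda>k. k i) ` F)))"
  have N: "k i < N" if "k \<in> F" for k
    using that F(1) by (auto simp: N_def less_Suc_eq_le intro!: Max_ge)
  have "norm ((mbshift (unit_index i) ^^ m) x) < e" if "m \<ge> N" for m
  proof -
    define \<tau> where "\<tau> k = (\<lambda>j. m * unit_index i j + k j)" for k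
    have "(norm ((mbshift (unit_index i) ^^ m) x))\<^sup>2 \<le> (e/2)\<^sup>2"
    proof (rule has_sum_le_finite_sums[OF ell2_norm])
      fix G :: "('a \<Rightarrow> nat) set" assume G: "finite G"
      have disj: "\<tau> ` G \<inter> F = {}"
      proof -
        have "\<tau> k i \<ge> N" for k using that by (simp add: \<tau>_def unit_index_def)
        thus ?thesis using N by (metis disjoint_iff imageE not_le)
      qed
      have inj: "inj_on \<tau> G" unfolding \<tau>_def by (rule inj_on_subset[OF inj_index_shift]) simp
      have "(\<Sum>k\<in>G. (norm (ell2_nth ((mbshift (unit_index i) ^^ m) x) k))\<^sup>2) = sum ?q (\<tau> ` G)"
        unfolding sum.reindex[OF inj] o_def mbshift_unit_funpow mbshift_nth by (simp only: \<tau>_def)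
      also have "\<dots> = sum ?q (\<tau> ` G \<union> F) - sum ?q F"
        using G F(1) disj by (simp add: sum.union_disjoint)
      also have "\<dots> \<le> (norm x)\<^sup>2 - sum ?q F"
        using ell2_norm_finite_sum_le[of "\<tau> ` G \<union> F" x] G F(1) by simp
      also have "\<dots> \<le> (e/2)\<^sup>2" using F(2) unfolding dist_real_def by argo
      finally show "(\<Sum>k\<in>G. (norm (ell2_nth ((mbshift (unit_index i) ^^ m) x) k))\<^sup>2) \<le> (e/2)\<^sup>2" .
    qed
    hence "norm ((mbshift (unit_index i) ^^ m) x) \<le> e/2" by (rule power2_le_imp_le) (use e in simp)
    thus ?thesis using e by simp
  qed
  thus "\<exists>N. \<forall>m\<ge>N. norm ((mbshift (unit_index i) ^^ m) x - 0) < e" by auto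
qed

section \<open>Hardy space functions and their Taylor coefficients\<close>

lemma mpow_zero [simp]: "mpow w (\<lambda>_. 0) = 1"
  by (simp add: mpow_def)

lemma mpow_add: "mpow w (\<lambda>i. k i + l i) = mpow w k * mpow w l"
  by (simp add: mpow_def power_add prod.distrib)

lemma mpow_unit: "mpow w (unit_index i) = w $ i"
proof -
  have "mpow w (unit_index i) = (\<Prod>j\<in>UNIV. if j = i then w $ j else 1)"
    unfolding mpow_def unit_index_def by (intro prod.cong) auto
  thus ?thesis by simp
qed

lemma mpow_summable:
  fixes w :: "complex ^ 'n::finite"
  assumes "w \<in> polydisc"
  shows "(\<lambda>k. norm (mpow w k)) summable_on UNIV"
proof (rule nonneg_bdd_above_summable_on)
  have w: "norm (w $ i) < 1" for i using assms by (simp add: polydisc_def)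
  show "bdd_above (sum (\<lambda>k. norm (mpow w k)) ` {F. F \<subseteq> UNIV \<and> finite F})"
  proof (rule bdd_aboveI2)
    fix F :: "('n \<Rightarrow> nat) set" assume "F \<in> {F. F \<subseteq> UNIV \<and> finite F}"
    hence F: "finite F" by simp
    define N where "N = Max (insert 0 ((\<lambda>(k, i). k i) ` (F \<times> UNIV)))"
    have "k i \<le> N" if "k \<in> F" for k i
      unfolding N_def using that F by (intro Max_ge) (auto intro!: image_eqI[of _ _ "(k, i)"])
    hence sub: "F \<subseteq> (UNIV \<rightarrow>\<^sub>E {..N})" by auto
    have "(\<Sum>k\<in>F. norm (mpow w k)) \<le> (\<Sum>k\<in>UNIV \<rightarrow>\<^sub>E {..N}. norm (mpow w k))"
      by (intro sum_mono2 sub finite_PiE) auto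
    also have "\<dots> = (\<Sum>k\<in>UNIV \<rightarrow>\<^sub>E {..N}. \<Prod>i\<in>UNIV. norm (w $ i) ^ k i)"
      by (simp add: mpow_def prod_norm[symmetric] norm_power)
    also have "\<dots> = (\<Prod>i\<in>UNIV. \<Sum>m\<le>N. norm (w $ i) ^ m)"
      by (rule prod_sum_PiE[symmetric]) auto
    also have "\<dots> \<le> (\<Prod>i\<in>(UNIV::'n set). 1 / (1 - norm (w $ i)))"
    proof (intro prod_mono conjI sum_nonneg)
      fix i
      have "(\<Sum>m\<in>{..N}. norm (w $ i) ^ m) \<le> (\<Sum>m. norm (w $ i) ^ m)"
        by (rule sum_le_suminf) (use w[of i] in auto)
      also have "\<dots> = 1 / (1 - norm (w $ i))" by (rule suminf_geometric) (use w[of i] in auto)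
      finally show "(\<Sum>m\<le>N. norm (w $ i) ^ m) \<le> 1 / (1 - norm (w $ i))" .
    qed auto
    finally show "(\<Sum>k\<in>F. norm (mpow w k)) \<le> (\<Prod>i\<in>(UNIV::'n set). 1 / (1 - norm (w $ i)))" .
  qed
qed auto

lemma mpow_scaleC_abs_summable:
  fixes a :: "('n::finite \<Rightarrow> nat) \<Rightarrow> 'a::complex_inner"
  assumes "w \<in> polydisc" "\<And>k. norm (a k) \<le> C"
  shows "(\<lambda>k. mpow w k *\<^sub>C a k) abs_summable_on UNIV"
proof (rule summable_on_comparison_test)
  show "(\<lambda>k. norm (mpow w k) * C) summable_on UNIV"
    by (intro summable_on_cmult_left mpow_summable assms)
qed (auto intro!: mult_left_mono assms)

text \<open>The function on the polydisc with the given Taylor coefficients, set to 0 outside.\<close>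

definition hardy_fun ::
    "('n::finite \<Rightarrow> nat, 'a::complex_inner) ell2 \<Rightarrow> complex ^ 'n \<Rightarrow> 'a" where
  "hardy_fun x w = (if w \<in> polydisc then \<Sum>\<^sub>\<infinity>k. mpow w k *\<^sub>C ell2_nth x k else 0)"

lemma hardy_fun_outside [simp]: "w \<notin> polydisc \<Longrightarrow> hardy_fun x w = 0"
  by (simp add: hardy_fun_def)

lemma hardy_fun_has_sum:
  fixes x :: "('n::finite \<Rightarrow> nat, 'a::{complex_inner,banach}) ell2"
  assumes "w \<in> polydisc"
  shows "((\<lambda>k. mpow w k *\<^sub>C ell2_nth x k) has_sum hardy_fun x w) UNIV"
proof -
  have "(\<lambda>k. mpow w k *\<^sub>C ell2_nth x k) summable_on UNIV"
    by (rule abs_summable_summable, rule mpow_scaleC_abs_summable[OF assms], rule ell2_norm_nth_le)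
  thus ?thesis using assms by (simp add: hardy_fun_def)
qed

lemma hardy_fun_unique:
  fixes x :: "('n::finite \<Rightarrow> nat, 'a::{complex_inner,banach}) ell2"
  assumes "w \<in> polydisc" "((\<lambda>k. mpow w k *\<^sub>C ell2_nth x k) has_sum y) UNIV"
  shows "hardy_fun x w = y"
  using has_sum_unique[OF hardy_fun_has_sum[OF assms(1)] assms(2)] .

lemma taylor_coeffs_hardy_fun:
  "taylor_coeffs (hardy_fun x) (ell2_nth (x :: ('n::finite \<Rightarrow> nat, 'a::{complex_inner,banach})
      ell2))"
  by (simp add: taylor_coeffs_def hardy_fun_has_sum)

lemma bounded_clinear_hardy_fun:
  "bounded_clinear (\<lambda>x :: ('n::finite \<Rightarrow> nat, 'a::{complex_inner,banach}) ell2. hardy_fun x w)"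
proof (cases "w \<in> polydisc")
  case True
  let ?K = "\<Sum>\<^sub>\<infinity>k. norm (mpow w k)"
  show ?thesis
  proof (rule bounded_clinearI[where K="?K"])
    fix x y :: "('n \<Rightarrow> nat, 'a) ell2" and c
    show "hardy_fun (x + y) w = hardy_fun x w + hardy_fun y w"
      using has_sum_add[OF hardy_fun_has_sum[OF True] hardy_fun_has_sum[OF True], of x y]
      by (intro hardy_fun_unique[OF True]) (simp add: scaleC_add_right)
    show "hardy_fun (c *\<^sub>C x) w = c *\<^sub>C hardy_fun x w"
      using has_sum_bounded_linear[OF bounded_linear_scaleC_right hardy_fun_has_sum[OF True], of c
          x]
      by (intro hardy_fun_unique[OF True]) (simp add: scaleC_scaleC mult.commute)
    have "norm (hardy_fun x w) \<le> (\<Sum>\<^sub>\<infinity>k. norm (mpow w k *\<^sub>C ell2_nth x k))"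
      by (rule norm_has_sum_bound[OF has_sum_infsum hardy_fun_has_sum[OF True]])
         (rule mpow_scaleC_abs_summable[OF True ell2_norm_nth_le])
    also have "\<dots> \<le> (\<Sum>\<^sub>\<infinity>k. norm (mpow w k) * norm x)"
      by (intro infsum_mono mpow_scaleC_abs_summable[OF True ell2_norm_nth_le]
          summable_on_cmult_left mpow_summable[OF True])
         (auto intro!: mult_left_mono ell2_norm_nth_le)
    also have "\<dots> = ?K * norm x" by (rule infsum_cmult_left')
    finally show "norm (hardy_fun x w) \<le> ?K * norm x" .
  qed
qed (simp add: bounded_clinear_zero_op)

lemmas hardy_fun_simps = bounded_clinear_add[OF bounded_clinear_hardy_fun]
  bounded_clinear_diff[OF bounded_clinear_hardy_fun] bounded_clinear_scaleC[OF
      bounded_clinear_hardy_fun]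
  bounded_clinear_zero[OF bounded_clinear_hardy_fun]

lemma hardy_fun_mshift:
  fixes x :: "('n::finite \<Rightarrow> nat, 'a::{complex_inner,banach}) ell2"
  shows "hardy_fun (mshift k x) w = mpow w k *\<^sub>C hardy_fun x w"
proof (cases "w \<in> polydisc")
  case True
  show ?thesis
  proof (rule hardy_fun_unique[OF True])
    let ?g = "\<lambda>m. mpow w m *\<^sub>C ell2_nth (mshift k x) m"
    have "((\<lambda>m. mpow w k *\<^sub>C mpow w m *\<^sub>C ell2_nth x m) has_sum mpow w k *\<^sub>C hardy_fun x w) UNIV"
      by (rule has_sum_bounded_linear[OF bounded_linear_scaleC_right hardy_fun_has_sum[OF True]])
    hence "(?g has_sum mpow w k *\<^sub>C hardy_fun x w) (range (\<lambda>m i. k i + m i))"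
      by (subst has_sum_reindex[OF inj_index_shift]) (simp add: o_def mshift_nth mpow_add
          scaleC_scaleC)
    thus "(?g has_sum mpow w k *\<^sub>C hardy_fun x w) UNIV"
      by (rule has_sum_cong_neutral[THEN iffD1, rotated -1]) (auto simp: range_index_shift
          mshift_nth)
  qed
qed simp

lemma Mz_hardy_fun:
  "Mz i (hardy_fun x) = hardy_fun (mshift (unit_index i) (x :: ('n::finite \<Rightarrow> nat,
      'a::{complex_inner,banach}) ell2))"
  by (simp add: Mz_def fun_eq_iff hardy_fun_mshift mpow_unit)

subsection \<open>Uniqueness of Taylor coefficients\<close>

lemma power_series_eq_0:
  fixes a :: "nat \<Rightarrow> complex"
  assumes "\<And>t. t \<noteq> 0 \<Longrightarrow> norm t < 1 \<Longrightarrow> (\<lambda>n. a n * t ^ n) sums 0"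
  shows "a n = 0"
  using assms
proof (induction n arbitrary: a)
  case 0
  have "((\<lambda>t::complex. 0::complex) \<longlongrightarrow> a 0) (at 0)"
    by (rule powser_limit_0_strong[where s=1]) (use 0 in auto)
  from tendsto_unique[OF _ this tendsto_const] show ?case by simp
next
  case (Suc n)
  have a0: "a 0 = 0"
  proof -
    have "((\<lambda>t::complex. 0::complex) \<longlongrightarrow> a 0) (at 0)"
      by (rule powser_limit_0_strong[where s=1]) (use Suc.prems in auto)
    from tendsto_unique[OF _ this tendsto_const] show ?thesis by simp
  qed
  show ?case
  proof (rule Suc.IH[of "\<lambda>n. a (Suc n)"])
    fix t :: complex assume t: "t \<noteq> 0" "norm t < 1"
    have "(\<lambda>n. a (Suc n) * t ^ Suc n) sums 0"
      using Suc.prems[OF t] by (subst sums_Suc_iff) (simp add: a0)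
    from sums_mult[OF this, of "inverse t"] t(1) show "(\<lambda>n. a (Suc n) * t ^ n) sums 0"
      by (simp add: field_simps)
  qed
qed

text \<open>Multi-indices supported in a set of coordinates.\<close>

definition supported_in :: "'n set \<Rightarrow> ('n \<Rightarrow> nat) set" where
  "supported_in J = {k. \<forall>i. i \<notin> J \<longrightarrow> k i = 0}"

lemma supported_in_empty [simp]: "supported_in {} = {\<lambda>_. 0}"
  by (auto simp: supported_in_def)

lemma supported_in_UNIV [simp]: "supported_in UNIV = UNIV"
  by (simp add: supported_in_def)

lemma supported_in_insert_bij:
  assumes "j \<notin> J"
  shows "bij_betw (\<lambda>(l, k). k(j := l)) (UNIV \<times> supported_in J) (supported_in (insert j J))"
  by (rule bij_betw_byWitness[where f'="\<lambda>k. (k j, k(j := 0))"])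
     (use assms in \<open>auto simp: supported_in_def fun_eq_iff\<close>)

lemma mpow_upd:
  fixes w :: "complex ^ 'n::finite"
  assumes "k j = 0"
  shows "mpow w (k(j := l)) = (w $ j) ^ l * mpow w k"
proof -
  have "k(j := l) = (\<lambda>i. l * unit_index j i + k i)" using assms by (auto simp: unit_index_def)
  moreover have "mpow w (\<lambda>i. l * unit_index j i) = (w $ j) ^ l"
    by (induction l) (simp_all add: mpow_add mpow_unit)
  ultimately show ?thesis by (simp add: mpow_add)
qed

text \<open>
  One coordinate at a time: for fixed values of the other coordinates, the series is a power series
  in the remaining one, whose coefficients \<open>row w l\<close> must vanish.
\<close>

lemma multi_power_series_eq_0:
  fixes d :: "('n::finite \<Rightarrow> nat) \<Rightarrow> complex"
  assumes "finite J" "\<And>w. w \<in> polydisc \<Longrightarrow> ((\<lambda>k. mpow w k * d k) has_sum 0) (supported_in J)"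
    "k \<in> supported_in J"
  shows "d k = 0"
  using assms
proof (induction J arbitrary: d k rule: finite_induct)
  case empty
  have "(0 :: complex ^ 'n) \<in> polydisc" by (simp add: polydisc_def)
  hence "((\<lambda>k. mpow 0 k * d k) has_sum 0) {\<lambda>_. 0}" using empty(1) by simp
  moreover have "((\<lambda>k. mpow 0 k * d k) has_sum (\<Sum>k\<in>{\<lambda>_. 0}. mpow 0 k * d k)) {\<lambda>_. 0}"
    by (rule has_sum_finite) simp
  ultimately have "(\<Sum>k\<in>{\<lambda>_. 0}. mpow 0 k * d k) = 0" by (rule has_sum_unique[rotated])
  thus ?case using empty(2) by simp
next
  case (insert j J)
  define row where "row w l = (\<Sum>\<^sub>\<infinity>k\<in>supported_in J. mpow w k * d (k(j := l)))" for w :: "complex ^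
      'n" and l
  have zero_j: "k j = 0" if "k \<in> supported_in J" for k
    using that insert(2) by (simp add: supported_in_def)
  have whole:
      "((\<lambda>(l, k). (w $ j) ^ l * (mpow w k * d (k(j := l)))) has_sum 0) (UNIV \<times> supported_in J)"
    if "w \<in> polydisc" for w
  proof -
    have "((\<lambda>p. (\<lambda>k. mpow w k * d k) (case p of (l, k) \<Rightarrow> k(j := l))) has_sum 0) (UNIV \<times>
        supported_in J)"
      using insert.prems(1)[OF that]
      by (subst has_sum_reindex_bij_betw[OF supported_in_insert_bij[OF insert(2)]])
    thus ?thesis
      by (rule has_sum_cong[THEN iffD1, rotated]) (auto simp: mpow_upd zero_j mult.assoc)
  qed
  have rows: "((\<lambda>k. mpow w k * d (k(j := l))) has_sum row w l) (supported_in J)"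
    if w: "w \<in> polydisc" "w $ j \<noteq> 0" for w l
  proof -
    have "(\<lambda>k. (w $ j) ^ l * (mpow w k * d (k(j := l)))) summable_on supported_in J"
      using summable_on_SigmaD1[of "\<lambda>l k. (w $ j) ^ l * (mpow w k * d (k(j := l)))" UNIV "\<lambda>_.
          supported_in J" l]
        whole[OF w(1)] by (auto simp: summable_on_def)
    hence "(\<lambda>k. mpow w k * d (k(j := l))) summable_on supported_in J"
      using w(2) by (simp add: summable_on_cmult_right')
    thus ?thesis by (simp add: row_def)
  qed
  have indep: "mpow (\<chi> i. if i = j then t else w $ i) k = mpow w k" if "k \<in> supported_in J"
    for t k and w :: "complex ^ 'n"
    unfolding mpow_def using zero_j[OF that] by (intro prod.cong) auto
  have row_zero: "((\<lambda>k. mpow w k * d (k(j := l))) has_sum 0) (supported_in J)"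
      if w: "w \<in> polydisc" for w l
  proof -
    define u where "u t = (\<chi> i. if i = j then t else w $ i)" for t
    have u: "u t \<in> polydisc" "u t $ j = t" if "norm t < 1" for t
      using w that by (auto simp: u_def polydisc_def)
    have row_u: "row (u t) m = row w m" for t m
      unfolding row_def u_def by (intro infsum_cong) (simp add: indep)
    have "row w l = 0"
    proof (rule power_series_eq_0[of "row w"])
      fix t :: complex assume t: "t \<noteq> 0" "norm t < 1"
      have "((\<lambda>m. t ^ m * row w m) has_sum 0) UNIV"
      proof (rule has_sum_SigmaD[OF whole[OF u(1)[OF t(2)]]])
        fix m
        have "((\<lambda>k. t ^ m * (mpow (u t) k * d (k(j := m)))) has_sum t ^ m * row (u t) m)
            (supported_in J)"
          by (intro has_sum_cmult_right rows u t) (use u(2)[OF t(2)] t in simp)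
        thus "((\<lambda>k. case (m, k) of (l, k) \<Rightarrow> (u t $ j) ^ l * (mpow (u t) k * d (k(j := l))))
            has_sum t ^ m * row w m) (supported_in J)"
          by (simp add: u(2)[OF t(2)] row_u)
      qed
      from has_sum_imp_sums[OF this] show "(\<lambda>m. row w m * t ^ m) sums 0" by (simp add: mult.commute)
    qed
    moreover have "((\<lambda>k. mpow (u (1/2)) k * d (k(j := l))) has_sum row (u (1/2)) l) (supported_in
        J)"
      by (rule rows) (auto simp: u)
    ultimately have "((\<lambda>k. mpow (u (1/2)) k * d (k(j := l))) has_sum 0) (supported_in J)"
      by (simp add: row_u)
    thus ?thesis by (rule has_sum_cong[THEN iffD1, rotated]) (simp add: u_def indep)
  qed
  have "d ((k(j := 0))(j := k j)) = 0"
  proof (rule insert.IH[of "\<lambda>k'. d (k'(j := k j))"])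
    show "k(j := 0) \<in> supported_in J" using insert.prems(2) by (auto simp: supported_in_def)
  qed (rule row_zero)
  thus ?case by simp
qed

lemma taylor_coeffs_unique:
  fixes f :: "complex ^ 'n::finite \<Rightarrow> 'a::complex_inner"
  assumes "taylor_coeffs f a" "taylor_coeffs f b"
  shows "a = b"
proof
  fix k
  have "cinner (a k - b k) y = 0" for y
  proof (rule multi_power_series_eq_0[where J=UNIV and d="\<lambda>k. cinner (a k - b k) y"])
    fix w :: "complex ^ 'n" assume w: "w \<in> polydisc"
    have "((\<lambda>k. mpow w k *\<^sub>C a k) has_sum f w) UNIV" "((\<lambda>k. mpow w k *\<^sub>C b k) has_sum f w) UNIV"
      using assms w by (auto simp: taylor_coeffs_def)
    from has_sum_add[OF this(1) has_sum_bounded_linear[OF bounded_linear_minus[OF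
        bounded_linear_ident] this(2)]]
    have "((\<lambda>k. mpow w k *\<^sub>C (a k - b k)) has_sum 0) UNIV" by (simp add: scaleC_diff_right)
    from has_sum_bounded_linear[OF bounded_linear_cinner_left this, of y]
    show "((\<lambda>k. mpow w k * cinner (a k - b k) y) has_sum 0) (supported_in UNIV)"
      by (simp add: cinner_scaleC_left)
  qed auto
  from this[of "a k - b k"] show "a k = b k" by simp
qed

lemma taylor_coeffs_eq:
  "taylor_coeffs f a \<Longrightarrow> (THE a. taylor_coeffs f a) = a"
  by (rule the_equality) (auto intro: taylor_coeffs_unique)

lemma inj_hardy_fun: "inj (hardy_fun :: ('n::finite \<Rightarrow> nat, 'a::{complex_inner,banach}) ell2 \<Rightarrow> _)"
proof (rule injI)
  fix x y :: "('n \<Rightarrow> nat, 'a) ell2" assume eq: "hardy_fun x = hardy_fun y"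
  have "ell2_nth x = ell2_nth y"
    by (rule taylor_coeffs_unique[OF taylor_coeffs_hardy_fun]) (simp only: eq
        taylor_coeffs_hardy_fun)
  thus "x = y" by (simp add: ell2_nth_inject)
qed

lemma hardy_inner_hardy_fun:
  "hardy_inner (hardy_fun x) (hardy_fun y) = cinner x (y :: ('n::finite \<Rightarrow> nat,
      'a::{complex_inner,banach}) ell2)"
  unfolding hardy_inner_def taylor_coeffs_eq[OF taylor_coeffs_hardy_fun]
  by (rule infsumI[OF ell2_cinner])

text \<open>The Taylor coefficient sequences of the functions in \<open>hardy E\<close>.\<close>

definition coeffs_in :: "'a::complex_inner set \<Rightarrow> ('n::finite \<Rightarrow> nat, 'a) ell2 set" where
  "coeffs_in E = {x. \<forall>k. ell2_nth x k \<in> E}"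

lemma hardy_eq_image:
    "hardy E = hardy_fun ` (coeffs_in E :: ('n::finite \<Rightarrow> nat, 'a::{complex_inner,banach}) ell2 set)"
proof (intro equalityI subsetI)
  fix f :: "complex ^ 'n \<Rightarrow> 'a" assume "f \<in> hardy E"
  then obtain a where a: "\<And>w. w \<notin> polydisc \<Longrightarrow> f w = 0" "\<And>k. a k \<in> E"
      "(\<lambda>k. (norm (a k))\<^sup>2) summable_on UNIV" "taylor_coeffs f a"
    by (auto simp: hardy_def)
  have "hardy_fun (Ell2 a) w = f w" for w
  proof (cases "w \<in> polydisc")
    case True
    thus ?thesis using a(4)
      by (intro hardy_fun_unique) (simp_all add: ell2_nth_Ell2[OF a(3)] taylor_coeffs_def)
  qed (simp add: a(1))
  moreover have "Ell2 a \<in> coeffs_in E" using a(2)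
    by (simp add: coeffs_in_def ell2_nth_Ell2[OF a(3)])
  ultimately show "f \<in> hardy_fun ` coeffs_in E"
    by (intro image_eqI[of _ _ "Ell2 a"] ext) simp_all
next
  fix f assume "f \<in> hardy_fun ` (coeffs_in E :: ('n \<Rightarrow> nat, 'a) ell2 set)"
  then obtain x :: "('n \<Rightarrow> nat, 'a) ell2" where "f = hardy_fun x" "x \<in> coeffs_in E" by auto
  thus "f \<in> hardy E"
    using taylor_coeffs_hardy_fun[of x] ell2_summable[of x]
    by (auto simp: hardy_def coeffs_in_def intro!: exI[of _ "ell2_nth x"])
qed

lemma closed_csubspace_coeffs_in:
  fixes E :: "'a::complex_inner set"
  assumes "closed_csubspace E"
  shows "closed_csubspace (coeffs_in E :: ('n::finite \<Rightarrow> nat, 'a) ell2 set)"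
  unfolding closed_csubspace_def
proof (intro conjI ballI allI)
  have "closed ((\<lambda>x :: ('n \<Rightarrow> nat, 'a) ell2. ell2_nth x k) -` E)" for k
    using assms bounded_clinear_ell2_nth[of k]
    by (intro continuous_closed_vimage)
       (auto simp: closed_csubspace_def bounded_clinear_def intro: linear_continuous_at)
  moreover have "coeffs_in E = (\<Inter>k. (\<lambda>x :: ('n \<Rightarrow> nat, 'a) ell2. ell2_nth x k) -` E)"
    by (auto simp: coeffs_in_def)
  ultimately show "closed (coeffs_in E :: ('n \<Rightarrow> nat, 'a) ell2 set)" by (simp add: closed_INT)
qed (auto simp: coeffs_in_def csubspace_zero[OF assms] csubspace_add[OF assms] csubspace_scaleC[OF
    assms])

lemma hardy_fun_in:
  fixes x :: "('n::finite \<Rightarrow> nat, 'a::{complex_inner,banach}) ell2"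
  assumes "closed_csubspace E" "x \<in> coeffs_in E"
  shows "hardy_fun x w \<in> E"
proof (cases "w \<in> polydisc")
  case True
  thus ?thesis using assms
    by (intro csubspace_has_sum[OF assms(1) _ hardy_fun_has_sum])
       (auto simp: coeffs_in_def intro!: csubspace_scaleC[OF assms(1)])
qed (simp add: csubspace_zero[OF assms(1)])

lemma mshift_coeffs_in: "closed_csubspace E \<Longrightarrow> x \<in> coeffs_in E \<Longrightarrow> mshift k x \<in> coeffs_in E"
  by (simp add: coeffs_in_def mshift_nth csubspace_zero)

lemma mbshift_coeffs_in: "x \<in> coeffs_in E \<Longrightarrow> mbshift k x \<in> coeffs_in E"
  by (simp add: coeffs_in_def mbshift_nth)

lemma op_prod_cong:
  assumes "finite I" and commF: "\<And>i j x. F i (F j x) = F j (F i x)"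
    and commG: "\<And>i j x. G i (G j x) = G j (G i x)" and eq: "\<And>i. i \<in> I \<Longrightarrow> F i = G i"
  shows "op_prod F I x = op_prod G I x"
  using assms(1) eq
  by (induction I rule: finite_induct) (simp_all add: op_prod_insert[of F, OF commF]
      op_prod_insert[of G, OF commG])

lemma funpow_commute_family:
  assumes comm: "\<And>i j x. F i (F j x) = F j (F i x)"
  shows "(F i ^^ a) ((F j ^^ b) x) = (F j ^^ b) ((F i ^^ a) x)"
proof -
  have "F i ((F j ^^ b) x) = (F j ^^ b) (F i x)" for x
    by (induction b) (simp_all add: comm[of i j])
  thus ?thesis by (induction a) simp_all
qed

context
  fixes F :: "'n::finite \<Rightarrow> 'b \<Rightarrow> 'b"
  assumes comm: "\<And>i j x. F i (F j x) = F j (F i x)"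
begin

lemma tuple_pow_zero: "tuple_pow F (\<lambda>_. 0) x = x"
proof -
  have "op_prod (\<lambda>i. F i ^^ 0) I x = x" if "finite I" for I :: "'n set"
    using that by (induction I rule: finite_induct) (simp_all add: op_prod_insert)
  thus ?thesis by (simp add: tuple_pow_def)
qed

lemma tuple_pow_unit: "tuple_pow F (\<lambda>j. unit_index i j + k j) x = F i (tuple_pow F k x)"
proof -
  let ?l = "\<lambda>j. unit_index i j + k j"
  have split:
      "op_prod (\<lambda>j. F j ^^ m j) UNIV x = (F i ^^ m i) (op_prod (\<lambda>j. F j ^^ m j) (UNIV - {i}) x)"
      for m
    using op_prod_insert[of "\<lambda>j. F j ^^ m j" "UNIV - {i}" i x] funpow_commute_family[of F, OF comm]
    by (simp add: insert_absorb)
  have "op_prod (\<lambda>j. F j ^^ ?l j) (UNIV - {i}) x = op_prod (\<lambda>j. F j ^^ k j) (UNIV - {i}) x"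
  proof (rule op_prod_cong)
    show "(F i ^^ ?l i) ((F j ^^ ?l j) x) = (F j ^^ ?l j) ((F i ^^ ?l i) x)"
      "(F i ^^ k i) ((F j ^^ k j) x) = (F j ^^ k j) ((F i ^^ k i) x)" for i j x
      by (rule funpow_commute_family, rule comm)+
  qed (auto simp: unit_index_def)
  thus ?thesis unfolding tuple_pow_def split by (simp add: unit_index_def)
qed

lemma tuple_pow_commute: "F i (tuple_pow F k x) = tuple_pow F k (F i x)"
  by (induction k rule: multi_index_induct) (simp_all add: tuple_pow_zero tuple_pow_unit comm[of i])

lemma tuple_pow_upd:
  assumes "k j = 0"
  shows "tuple_pow F (k(j := l)) x = tuple_pow F k ((F j ^^ l) x)"
proof (induction l arbitrary: x)
  case 0
  have "k(j := 0) = k" using assms by auto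
  thus ?case by simp
next
  case (Suc l)
  have "k(j := Suc l) = (\<lambda>i. unit_index j i + (k(j := l)) i)" by (auto simp: unit_index_def)
  thus ?case using Suc by (simp only: tuple_pow_unit) (simp add: tuple_pow_commute)
qed

end

context
  fixes X :: "'i \<Rightarrow> 'a::complex_inner \<Rightarrow> 'a"
  assumes lin: "\<And>i. bounded_clinear (X i)"
    and comm: "\<And>i j x. X i (X j x) = X j (X i x)"
    and adj_comm: "\<And>i j x. cadjoint (X i) (cadjoint (X j) x) = cadjoint (X j) (cadjoint (X i) x)"
begin

lemma id_minus_conj_commute:
  "id_minus_conj (X i) (id_minus_conj (X j) A) = id_minus_conj (X j) (id_minus_conj (X i) A)"
  by (simp add: id_minus_conj_def fun_eq_iff bounded_clinear_simps[OF lin] comm[of i j] adj_comm[of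
      i j])

lemma op_prod_id_minus_conj_insert_apply:
  assumes "finite I" "i \<notin> I"
  shows "op_prod (\<lambda>k. id_minus_conj (X k)) (insert i I) A x =
    op_prod (\<lambda>k. id_minus_conj (X k)) I A x - X i (op_prod (\<lambda>k. id_minus_conj (X k)) I A (cadjoint
        (X i) x))"
proof -
  have "op_prod (\<lambda>k. id_minus_conj (X k)) (insert i I) A =
      id_minus_conj (X i) (op_prod (\<lambda>k. id_minus_conj (X k)) I A)"
    by (rule op_prod_insert[of "\<lambda>k. id_minus_conj (X k)", OF id_minus_conj_commute assms])
  thus ?thesis by (simp only: id_minus_conj_def[of "X i" "op_prod (\<lambda>k. id_minus_conj (X k)) I A"])
qed

lemma bounded_clinear_op_prod_id_minus_conj_family:
  assumes adj: "\<And>i. bounded_clinear (cadjoint (X i))" and A: "bounded_clinear A" and "finite I"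
  shows "bounded_clinear (op_prod (\<lambda>k. id_minus_conj (X k)) I A)"
  using assms(3)
proof (induction I rule: finite_induct)
  case (insert i I)
  have "op_prod (\<lambda>k. id_minus_conj (X k)) (insert i I) A =
      (\<lambda>x. op_prod (\<lambda>k. id_minus_conj (X k)) I A x -
        X i (op_prod (\<lambda>k. id_minus_conj (X k)) I A (cadjoint (X i) x)))"
    by (rule ext) (rule op_prod_id_minus_conj_insert_apply[OF insert(1,2)])
  thus ?case
    using bounded_clinear_minus_op[OF insert.IH bounded_clinear_compose[OF lin
        bounded_clinear_compose[OF insert.IH adj]]] by simp
qed (simp add: A op_prod_def id_def)

end

section \<open>The canonical dilation of a Szego tuple\<close>

text \<open>A fixed Szego tuple; \<open>Ts i\<close> is the adjoint of \<open>T i\<close>, and \<open>D\<close> its first defect operator.\<close>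

locale szego =
  fixes T :: "'n::finite \<Rightarrow> 'h::chilbert_space \<Rightarrow> 'h"
  assumes szego: "szego_tuple T"
begin

abbreviation Ts :: "'n \<Rightarrow> 'h \<Rightarrow> 'h" where "Ts i \<equiv> cadjoint (T i)"
abbreviation D :: "'h \<Rightarrow> 'h" where "D \<equiv> first_defect T"

lemma bounded_clinear_T: "bounded_clinear (T i)" and norm_T_le: "norm (T i x) \<le> norm x"
  using szego by (auto simp: szego_tuple_def commuting_contractions_def contractive_op_def)

lemma T_commute: "T i (T j x) = T j (T i x)"
proof -
  have "T i \<circ> T j = T j \<circ> T i" using szego unfolding szego_tuple_def commuting_contractions_def
    by blast
  thus ?thesis by (simp add: fun_eq_iff)
qed

lemma bounded_clinear_Ts: "bounded_clinear (Ts i)"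
  by (rule bounded_clinear_cadjoint[OF bounded_clinear_T])

lemma norm_Ts_le: "norm (Ts i x) \<le> norm x"
  using norm_cadjoint_le[OF bounded_clinear_T, of 1 i x] norm_T_le by simp

lemmas T_simps = bounded_clinear_simps[OF bounded_clinear_T]
lemmas Ts_simps = bounded_clinear_simps[OF bounded_clinear_Ts]
lemmas cinner_T = cinner_cadjoint[OF bounded_clinear_T]
lemmas cinner_T' = cinner_cadjoint'[OF bounded_clinear_T]

lemma Ts_commute: "Ts i (Ts j x) = Ts j (Ts i x)"
  by (rule cinner_ext) (simp only: cinner_T'[symmetric] T_commute[of i])

lemma Ts_funpow_tendsto_0: "(\<lambda>m. (Ts i ^^ m) x) \<longlonglongrightarrow> 0"
  using szego by (simp add: szego_tuple_def C_dot_0_def)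

lemma nonneg_szego_inv: "nonneg_op (szego_inv T)"
  using szego by (simp add: szego_tuple_def)

lemma bounded_clinear_D: "bounded_clinear D"
  unfolding first_defect_def by (rule bounded_clinear_op_sqrt[OF nonneg_szego_inv])

lemma norm_D_sq: "(norm (D x))\<^sup>2 = inner (szego_inv T x) x"
  unfolding first_defect_def by (rule norm_op_sqrt[OF nonneg_szego_inv])

lemma closed_csubspace_first_defect_space: "closed_csubspace (first_defect_space T)"
  unfolding first_defect_space_def by (rule closed_csubspace_closure_range[OF bounded_clinear_D])

lemma D_in_first_defect_space: "D x \<in> first_defect_space T"
  unfolding first_defect_space_def using closure_subset[of "range D"] by auto

abbreviation Tpow :: "('n \<Rightarrow> nat) \<Rightarrow> 'h \<Rightarrow> 'h" where "Tpow k \<equiv> tuple_pow T k"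
abbreviation Tspow :: "('n \<Rightarrow> nat) \<Rightarrow> 'h \<Rightarrow> 'h" where "Tspow k \<equiv> tuple_pow Ts k"

lemmas Tpow_zero = tuple_pow_zero[of T, OF T_commute]
lemmas Tpow_unit = tuple_pow_unit[of T, OF T_commute]
lemmas Tspow_zero = tuple_pow_zero[of Ts, OF Ts_commute]
lemmas Tspow_unit = tuple_pow_unit[of Ts, OF Ts_commute]
lemmas Tspow_commute = tuple_pow_commute[of Ts, OF Ts_commute]
lemmas Tspow_upd = tuple_pow_upd[of Ts, OF Ts_commute]

lemma bounded_clinear_Tspow: "bounded_clinear (Tspow k)"
proof (induction k rule: multi_index_induct)
  case zero
  thus ?case using bounded_clinear_id by (simp add: Tspow_zero[abs_def] fun_eq_iff[symmetric])
next
  case (step k i)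
  have "Tspow (\<lambda>j. unit_index i j + k j) = (\<lambda>x. Ts i (Tspow k x))" by (rule ext) (rule Tspow_unit)
  thus ?case using bounded_clinear_compose[OF bounded_clinear_Ts step] by simp
qed

lemma norm_Tspow_le: "norm (Tspow k x) \<le> norm x"
  by (induction k rule: multi_index_induct)
     (auto simp: Tspow_zero Tspow_unit intro: order_trans[OF norm_Ts_le])

lemmas op_prod_id_minus_conj_insert =
  op_prod_id_minus_conj_insert_apply[of T, OF bounded_clinear_T T_commute Ts_commute]
lemmas bounded_clinear_op_prod_id_minus_conj =
  bounded_clinear_op_prod_id_minus_conj_family[of T, OF bounded_clinear_T T_commute Ts_commute
      bounded_clinear_Ts]

text \<open>
  The product of \<open>I - \<Delta>\<close> over \<open>J\<close>, applied to the identity, is an alternating sum over the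
  multi-indices with entries 0 and 1.
\<close>

lemma op_prod_id_minus_conj_expand:
  assumes "finite J"
  shows "op_prod (\<lambda>k. id_minus_conj (T k)) J (\<lambda>x. x) x =
    (\<Sum>k \<in> {k \<in> supported_in J. \<forall>i. k i \<le> 1}. (- 1) ^ (\<Sum>i\<in>UNIV. k i) *\<^sub>R Tpow k (Tspow k x))"
  using assms
proof (induction J arbitrary: x rule: finite_induct)
  case empty
  have "{k \<in> supported_in ({} :: 'n set). \<forall>i. k i \<le> 1} = {\<lambda>_. 0}" by auto
  thus ?case by (simp add: Tpow_zero Tspow_zero)
next
  case (insert j J)
  define B where "B = {k \<in> supported_in J. \<forall>i. k i \<le> 1}"
  define t where "t k x = (- 1) ^ (\<Sum>i\<in>UNIV. k i) *\<^sub>R Tpow k (Tspow k x)" for k x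
  define s where "s k = (\<lambda>i. unit_index j i + k i)" for k
  have finB: "finite B"
  proof (rule finite_subset)
    show "B \<subseteq> (UNIV \<rightarrow>\<^sub>E {..1})" by (auto simp: B_def)
  qed (intro finite_PiE, auto)
  have kj: "k j = 0" if "k \<in> B" for k using that insert(2) by (auto simp: B_def supported_in_def)
  \<comment> \<open>multi-indices with entry 0, respectively 1, at \<open>j\<close>\<close>
  have split: "{k \<in> supported_in (insert j J). \<forall>i. k i \<le> 1} = B \<union> s ` B"
  proof (intro equalityI subsetI)
    fix k assume k: "k \<in> {k \<in> supported_in (insert j J). \<forall>i. k i \<le> 1}"
    show "k \<in> B \<union> s ` B"
    proof (cases "k j = 0")
      case True
      have "k i = 0" if "i \<notin> J" for i using k that True
        by (cases "i = j") (auto simp: supported_in_def)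
      thus ?thesis using k by (simp add: B_def supported_in_def)
    next
      case False
      hence "k j = 1" using k
        by (metis (mono_tags, lifting) le_antisym less_one mem_Collect_eq not_le)
      hence "k = s (k(j := 0))" by (auto simp: s_def unit_index_def)
      moreover have "k(j := 0) \<in> B" using k by (auto simp: B_def supported_in_def)
      ultimately show ?thesis by blast
    qed
  next
    fix k assume "k \<in> B \<union> s ` B"
    thus "k \<in> {k \<in> supported_in (insert j J). \<forall>i. k i \<le> 1}"
      using kj by (auto simp: B_def s_def supported_in_def unit_index_def)
  qed
  have disj: "B \<inter> s ` B = {}"
  proof -
    have "k \<notin> s ` B" if "k \<in> B" for k using kj[OF that] by (auto simp: s_def unit_index_def)
    thus ?thesis by blast
  qed
  have inj: "inj_on s B" unfolding s_def by (rule inj_on_subset[OF inj_index_shift]) simp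
  have ts: "t (s k) x = - T j (t k (Ts j x))" for k x
  proof -
    have "(\<Sum>i\<in>UNIV. s k i) = Suc (\<Sum>i\<in>UNIV. k i)" by (simp add: s_def sum.distrib unit_index_def)
    thus ?thesis
      by (simp add: t_def s_def Tpow_unit Tspow_unit Tspow_commute scaleR_scaleC T_simps)
  qed
  have IH: "op_prod (\<lambda>k. id_minus_conj (T k)) J (\<lambda>x. x) x = (\<Sum>k\<in>B. t k x)" for x
    unfolding B_def t_def by (rule insert.IH)
  have "op_prod (\<lambda>k. id_minus_conj (T k)) (insert j J) (\<lambda>x. x) x = (\<Sum>k\<in>B. t k x) - T j (\<Sum>k\<in>B. t k
      (Ts j x))"
    by (simp only: op_prod_id_minus_conj_insert[OF insert(1,2)] IH)
  also have "\<dots> = (\<Sum>k\<in>B. t k x) + (\<Sum>k\<in>B. t (s k) x)" by (simp add: ts T_simps sum_negf)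
  also have "\<dots> = (\<Sum>k\<in>B \<union> s ` B. t k x)"
    by (simp add: sum.union_disjoint finB disj sum.reindex[OF inj])
  finally show ?case unfolding split t_def .
qed

lemma szego_inv_eq_op_prod: "szego_inv T x = op_prod (\<lambda>k. id_minus_conj (T k)) UNIV (\<lambda>x. x) x"
proof -
  have "k i \<in> {0, 1} \<longleftrightarrow> k i \<le> 1" for k :: "'n \<Rightarrow> nat" and i by auto
  hence "(UNIV :: 'n set) \<rightarrow> {0, 1} = {k :: 'n \<Rightarrow> nat. \<forall>i. k i \<le> 1}" by (simp only: Pi_def) simp
  thus ?thesis by (simp add: szego_inv_def op_prod_id_minus_conj_expand)
qed

text \<open>
  With \<open>J = UNIV\<close> this says that the dilation is isometric. Summing over one coordinate at a time,
  the series telescopes, and the remainders vanish since \<open>Ts i ^^ m\<close> tends strongly to 0.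
\<close>

lemma norm_D_Tspow_has_sum:
  assumes "finite J"
  shows "((\<lambda>k. (norm (D (Tspow k h)))\<^sup>2) has_sum
    inner (op_prod (\<lambda>k. id_minus_conj (T k)) (UNIV - J) (\<lambda>x. x) h) h) (supported_in J)"
  using assms
proof (induction J arbitrary: h rule: finite_induct)
  case empty
  show ?case
    using has_sum_finite[of "{\<lambda>_. 0}" "\<lambda>k. (norm (D (Tspow k h)))\<^sup>2"]
    by (simp add: norm_D_sq Tspow_zero szego_inv_eq_op_prod)
next
  case (insert j J)
  define X where "X = op_prod (\<lambda>k. id_minus_conj (T k)) (UNIV - insert j J) (\<lambda>x. x)"
  define g where "g l = inner (X ((Ts j ^^ l) h)) ((Ts j ^^ l) h)" for l
  have UNIV_diff: "UNIV - J = insert j (UNIV - insert j J)" using insert(2) by auto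
  have rec: "op_prod (\<lambda>k. id_minus_conj (T k)) (UNIV - J) (\<lambda>x. x) x = X x - T j (X (Ts j x))" for x
    unfolding UNIV_diff X_def by (rule op_prod_id_minus_conj_insert) auto
  have X: "bounded_clinear X" 
    unfolding X_def by (intro bounded_clinear_op_prod_id_minus_conj bounded_clinear_id) simp
  have "g \<longlonglongrightarrow> inner (X 0) 0"
    unfolding g_def by (intro tendsto_inner bounded_clinear_tendsto[OF X] Ts_funpow_tendsto_0)
  hence "(\<lambda>l. g l - g (Suc l)) sums (g 0 - 0)" by (intro telescope_sums') simp
  hence tel: "(\<lambda>l. g l - g (Suc l)) sums inner (X h) h" by (simp add: g_def)
  have row:
      "((\<lambda>k. (norm (D (Tspow k ((Ts j ^^ l) h))))\<^sup>2) has_sum (g l - g (Suc l))) (supported_in J)"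
      for l
  proof -
    have adj: "inner (T j (X (Ts j y))) y = inner (X (Ts j y)) (Ts j y)" for y
      by (simp only: inner_eq_Re_cinner cinner_T)
    have "inner (op_prod (\<lambda>k. id_minus_conj (T k)) (UNIV - J) (\<lambda>x. x) ((Ts j ^^ l) h)) ((Ts j ^^ l)
        h)
        = g l - g (Suc l)"
      by (simp add: rec inner_diff_left adj g_def)
    with insert.IH[of "(Ts j ^^ l) h"] show ?thesis by simp
  qed
  have nonneg: "0 \<le> g l - g (Suc l)" for l using has_sum_nonneg[OF row] by simp
  have sum: "((\<lambda>l. g l - g (Suc l)) has_sum inner (X h) h) UNIV"
    by (rule sums_nonneg_imp_has_sum[OF tel nonneg])
  let ?f = "\<lambda>(l, k). (norm (D (Tspow k ((Ts j ^^ l) h))))\<^sup>2"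
  have "(?f has_sum inner (X h) h) (UNIV \<times> supported_in J)"
  proof (rule has_sum_SigmaI)
    show "?f summable_on UNIV \<times> supported_in J"
      by (rule summable_on_SigmaI[OF _ has_sum_imp_summable[OF sum]]) (use row in auto)
  qed (use row sum in auto)
  hence "((\<lambda>p. (\<lambda>k. (norm (D (Tspow k h)))\<^sup>2) (case p of (l, k) \<Rightarrow> k(j := l)))
      has_sum inner (X h) h) (UNIV \<times> supported_in J)"
    by (rule has_sum_cong[THEN iffD1, rotated]) (use insert(2) in \<open>auto simp: Tspow_upd
        supported_in_def\<close>)
  hence "((\<lambda>k. (norm (D (Tspow k h)))\<^sup>2) has_sum inner (X h) h) (supported_in (insert j J))"
    by (subst (asm) has_sum_reindex_bij_betw[OF supported_in_insert_bij[OF insert(2)]])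
  thus ?case by (simp add: X_def)
qed

text \<open>The canonical dilation, in terms of Taylor coefficients.\<close>

definition dil :: "'h \<Rightarrow> ('n \<Rightarrow> nat, 'h) ell2" where
  "dil h = Ell2 (\<lambda>k. D (Tspow k h))"

lemma norm_D_Tspow: "((\<lambda>k. (norm (D (Tspow k h)))\<^sup>2) has_sum (norm h)\<^sup>2) UNIV"
  using norm_D_Tspow_has_sum[of UNIV h] by (simp add: dot_square_norm)

lemma dil_nth: "ell2_nth (dil h) k = D (Tspow k h)"
  unfolding dil_def by (subst ell2_nth_Ell2[OF has_sum_imp_summable[OF norm_D_Tspow]]) simp

lemma norm_dil: "norm (dil h) = norm h"
proof -
  have "(norm (dil h))\<^sup>2 = (norm h)\<^sup>2"
    using has_sum_unique[OF ell2_norm[of "dil h"]] norm_D_Tspow[of h] by (simp add: dil_nth)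
  thus ?thesis by simp
qed

lemma bounded_clinear_dil: "bounded_clinear dil"
  by (rule bounded_clinearI[where K=1])
     (auto intro!: ell2_eqI simp: dil_nth norm_dil bounded_clinear_simps[OF bounded_clinear_D]
        bounded_clinear_simps[OF bounded_clinear_Tspow])

lemma dil_Ts: "mbshift (unit_index i) (dil h) = dil (Ts i h)"
  by (rule ell2_eqI) (simp add: mbshift_nth dil_nth Tspow_unit Tspow_commute)

lemma cinner_dil: "cinner (dil x) (dil y) = cinner x y"
  by (rule isometry_cinner[OF closed_csubspace_UNIV bounded_clinear_dil norm_dil]) auto

lemma dil_coeffs_in: "dil h \<in> coeffs_in (first_defect_space T)"
  by (simp add: coeffs_in_def dil_nth D_in_first_defect_space)

subsection \<open>The resolvent product\<close>

lemma pencil_commute: "pencil T w i (pencil T w j x) = pencil T w j (pencil T w i x)"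
  by (simp add: pencil_def Ts_simps Ts_commute[of i j] scaleC_diff_right scaleC_scaleC mult.commute
      algebra_simps)

text \<open>The Neumann series of the product of the resolvents \<open>(I - w j T j\<^sup>*)\<^sup>-\<^sup>1\<close> over \<open>j \<in> J\<close>.\<close>

definition neumann :: "complex ^ 'n \<Rightarrow> 'n set \<Rightarrow> 'h \<Rightarrow> 'h" where
  "neumann w J h = (\<Sum>\<^sub>\<infinity>k\<in>supported_in J. mpow w k *\<^sub>C Tspow k h)"

context
  fixes w :: "complex ^ 'n"
  assumes w: "w \<in> polydisc"
begin

lemma neumann_has_sum: "((\<lambda>k. mpow w k *\<^sub>C Tspow k h) has_sum neumann w J h) (supported_in J)"
proof -
  have "(\<lambda>k. mpow w k *\<^sub>C Tspow k h) summable_on UNIV"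
    by (rule abs_summable_summable, rule mpow_scaleC_abs_summable[OF w], rule norm_Tspow_le)
  hence "(\<lambda>k. mpow w k *\<^sub>C Tspow k h) summable_on supported_in J"
    by (rule summable_on_subset_banach) simp
  thus ?thesis by (simp add: neumann_def)
qed

text \<open>
  The set of multi-indices supported in \<open>insert j J\<close> is the disjoint union of those supported in \<open>J\<close>
  and of its own translate by \<open>unit_index j\<close>.
\<close>

lemma pencil_neumann:
  assumes "j \<notin> J"
  shows "pencil T w j (neumann w (insert j J) h) = neumann w J h"
proof -
  let ?f = "\<lambda>k. mpow w k *\<^sub>C Tspow k h" and ?s = "\<lambda>k i. unit_index j i + k i"
  let ?L = "supported_in (insert j J)"
  have "bounded_clinear (\<lambda>x. (w $ j) *\<^sub>C Ts j x)"
    by (intro bounded_clinear_scaleC_op bounded_clinear_Ts)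
  from bounded_clinear_has_sum[OF this neumann_has_sum[of h "insert j J"]]
  have "((?f \<circ> ?s) has_sum (w $ j) *\<^sub>C Ts j (neumann w (insert j J) h)) ?L"
    by (simp add: o_def mpow_add mpow_unit Tspow_unit Ts_simps scaleC_scaleC)
  hence image: "(?f has_sum (w $ j) *\<^sub>C Ts j (neumann w (insert j J) h)) (?s ` ?L)"
    by (subst has_sum_reindex) (auto intro: inj_on_subset[OF inj_index_shift])
  have disjoint: "supported_in J \<inter> ?s ` ?L = {}"
    using assms by (auto simp: supported_in_def unit_index_def)
  have union: "supported_in J \<union> ?s ` ?L = ?L"
  proof (intro equalityI subsetI)
    fix k assume k: "k \<in> ?L"
    show "k \<in> supported_in J \<union> ?s ` ?L"
    proof (cases "k j = 0")
      case True
      have "k i = 0" if "i \<notin> J" for i using k that True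
        by (cases "i = j") (auto simp: supported_in_def)
      thus ?thesis by (simp add: supported_in_def)
    next
      case False
      have "k = ?s (k(j := k j - 1))" using False by (auto simp: unit_index_def)
      moreover have "k(j := k j - 1) \<in> ?L" using k by (auto simp: supported_in_def)
      ultimately show ?thesis by blast
    qed
  qed (auto simp: supported_in_def unit_index_def)
  have "(?f has_sum (neumann w J h + (w $ j) *\<^sub>C Ts j (neumann w (insert j J) h))) ?L"
    using has_sum_Un_disjoint[OF neumann_has_sum image disjoint] unfolding union .
  hence "neumann w (insert j J) h = neumann w J h + (w $ j) *\<^sub>C Ts j (neumann w (insert j J) h)"
    by (rule has_sum_unique[OF neumann_has_sum])
  thus ?thesis unfolding pencil_def by (simp only: diff_eq_eq)
qed

lemma neumann_empty: "neumann w {} h = h"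
  by (simp add: neumann_def Tspow_zero)

lemma op_prod_pencil_neumann: "finite J \<Longrightarrow> op_prod (pencil T w) J (neumann w J h) = h"
proof (induction J rule: finite_induct)
  case (insert j J)
  have "op_prod (pencil T w) (insert j J) (neumann w (insert j J) h) =
      op_prod (pencil T w) J (pencil T w j (neumann w (insert j J) h))"
    using insert(1,2)
    by (subst op_prod_insert[of "pencil T w", OF pencil_commute])
       (auto intro!: op_prod_intertwine[of "pencil T w", OF pencil_commute] pencil_commute)
  thus ?case using insert by (simp add: pencil_neumann)
qed (simp add: neumann_empty)

lemma bij_pencil: "bij (pencil T w i)"
proof (rule bijI)
  show "inj (pencil T w i)"
  proof (rule injI)
    fix x y assume "pencil T w i x = pencil T w i y"
    hence "x - y = (w $ i) *\<^sub>C Ts i (x - y)"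
      by (simp add: pencil_def Ts_simps scaleC_diff_right algebra_simps)
    hence "norm (x - y) = norm (w $ i) * norm (Ts i (x - y))" by (metis norm_scaleC)
    also have "\<dots> \<le> norm (w $ i) * norm (x - y)" by (intro mult_left_mono norm_Ts_le) simp
    finally have "norm (x - y) \<le> norm (w $ i) * norm (x - y)" .
    moreover have "norm (w $ i) < 1" using w by (simp add: polydisc_def)
    ultimately show "x = y" by (cases "x = y") (simp_all add: mult_le_cancel_right1)
  qed
  show "surj (pencil T w i)"
    using pencil_neumann[of i "{}"] by (auto simp: neumann_empty intro!: surjI)
qed

lemma inv_pencil_commute:
  "inv (pencil T w i) (inv (pencil T w j) x) = inv (pencil T w j) (inv (pencil T w i) x)"
proof -
  let ?p = "\<lambda>i. pencil T w i"
  have p_inv: "?p i (inv (?p i) y) = y" and inv_p: "inv (?p i) (?p i y) = y" for i y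
    using bij_pencil[of i] by (simp_all add: bij_is_surj surj_f_inv_f bij_is_inj inv_f_f)
  define y where "y = inv (?p i) (inv (?p j) x)"
  have "x = ?p j (?p i y)" by (simp add: y_def p_inv)
  also have "\<dots> = ?p i (?p j y)" by (rule pencil_commute)
  finally have "inv (?p j) (inv (?p i) x) = y" by (simp add: inv_p)
  thus ?thesis by (simp add: y_def)
qed

lemma op_prod_inv_pencil: "op_prod (\<lambda>i. inv (pencil T w i)) UNIV h = neumann w UNIV h"
proof -
  have "op_prod (\<lambda>i. inv (pencil T w i)) UNIV (op_prod (pencil T w) UNIV (neumann w UNIV h)) =
      neumann w UNIV h"
    by (rule op_prod_inverse[of "pencil T w" _ "\<lambda>i. inv (pencil T w i)", OF pencil_commute _
        inv_pencil_commute])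
       (simp_all add: bij_is_inj[OF bij_pencil] inv_f_f)
  thus ?thesis by (simp add: op_prod_pencil_neumann)
qed

end

lemma canonical_dilation_eq: "canonical_dilation T h = hardy_fun (dil h)"
proof
  fix w :: "complex ^ 'n"
  show "canonical_dilation T h w = hardy_fun (dil h) w"
  proof (cases "w \<in> polydisc")
    case True
    have "((\<lambda>k. D (mpow w k *\<^sub>C Tspow k h)) has_sum D (neumann w UNIV h)) UNIV"
      using bounded_clinear_has_sum[OF bounded_clinear_D neumann_has_sum[OF True, of h UNIV]]
        by simp
    hence "hardy_fun (dil h) w = D (neumann w UNIV h)"
      by (intro hardy_fun_unique[OF True]) (simp add: dil_nth bounded_clinear_simps[OF
          bounded_clinear_D])
    thus ?thesis using True by (simp add: canonical_dilation_def op_prod_inv_pencil)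
  qed (simp add: canonical_dilation_def)
qed

end

section \<open>The wandering projection\<close>

context szego
begin

text \<open>\<open>M i\<close> is multiplication by \<open>z i\<close>, and \<open>Ms i\<close> its adjoint.\<close>

abbreviation M :: "'n \<Rightarrow> ('n \<Rightarrow> nat, 'h) ell2 \<Rightarrow> ('n \<Rightarrow> nat, 'h) ell2" where
  "M i \<equiv> mshift (unit_index i)"
abbreviation Ms :: "'n \<Rightarrow> ('n \<Rightarrow> nat, 'h) ell2 \<Rightarrow> ('n \<Rightarrow> nat, 'h) ell2" where
  "Ms i \<equiv> mbshift (unit_index i)"
abbreviation dil_adj :: "('n \<Rightarrow> nat, 'h) ell2 \<Rightarrow> 'h" where
  "dil_adj \<equiv> cadjoint dil"

text \<open>
  The projection onto the orthogonal complement of the range of the dilation, in the space of all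
  square-summable families, including those with coefficients outside the first defect space.
\<close>

definition P :: "('n \<Rightarrow> nat, 'h) ell2 \<Rightarrow> ('n \<Rightarrow> nat, 'h) ell2" where
  "P x = x - dil (dil_adj x)"

lemmas M_simps = bounded_clinear_simps[OF bounded_clinear_mshift]
lemmas Ms_simps = bounded_clinear_simps[OF bounded_clinear_mbshift]
lemmas dil_simps = bounded_clinear_simps[OF bounded_clinear_dil]

lemma bounded_clinear_dil_adj: "bounded_clinear dil_adj"
  by (rule bounded_clinear_cadjoint[OF bounded_clinear_dil])

lemmas dil_adj_simps = bounded_clinear_simps[OF bounded_clinear_dil_adj]

lemma cinner_dil_adj: "cinner (dil_adj y) h = cinner y (dil h)"
  by (rule cinner_cadjoint'[OF bounded_clinear_dil, symmetric])

lemma cinner_dil_adj': "cinner h (dil_adj y) = cinner (dil h) y"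
  by (rule cinner_cadjoint[OF bounded_clinear_dil, symmetric])

lemma dil_adj_dil [simp]: "dil_adj (dil h) = h"
  by (rule cinner_ext) (simp add: cinner_dil_adj cinner_dil)

lemma dil_adj_M: "dil_adj (M i x) = T i (dil_adj x)"
  by (rule cinner_ext) (simp add: cinner_dil_adj cinner_mshift dil_Ts cinner_T)

lemma bounded_clinear_P: "bounded_clinear P"
  unfolding P_def
  by (rule bounded_clinear_minus_op[OF bounded_clinear_id
      bounded_clinear_compose[OF bounded_clinear_dil bounded_clinear_dil_adj]])

lemmas P_simps = bounded_clinear_simps[OF bounded_clinear_P]

lemma dil_adj_P [simp]: "dil_adj (P x) = 0"
  by (simp add: P_def dil_adj_simps)

lemma P_dil [simp]: "P (dil h) = 0"
  by (simp add: P_def)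

lemma P_id: "dil_adj x = 0 \<Longrightarrow> P x = x"
  by (simp add: P_def dil_simps)

lemma P_P [simp]: "P (P x) = P x"
  by (simp add: P_id)

lemma cinner_P: "cinner (P x) y = cinner x (P y)"
  by (simp add: P_def cinner_diff_left cinner_diff_right cinner_dil_adj' flip: cinner_dil_adj)

lemma P_mshift_P [simp]: "P (mshift k (P x)) = mshift k (P x)"
proof -
  have "dil_adj (mshift k (P x)) = 0"
    by (induction k rule: multi_index_induct)
       (simp_all add: mshift_mshift[symmetric] dil_adj_M T_simps)
  thus ?thesis by (rule P_id)
qed

lemma P_Ms_P [simp]: "P (Ms i (P x)) = P (Ms i x)"
  by (simp add: P_def[of x] Ms_simps dil_Ts P_simps)

lemma P_coeffs_in: "x \<in> coeffs_in (first_defect_space T) \<Longrightarrow> P x \<in> coeffs_in (first_defect_space T)"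
  unfolding P_def
  by (intro csubspace_diff closed_csubspace_coeffs_in closed_csubspace_first_defect_space
      dil_coeffs_in)

text \<open>
  \<open>F J\<close> is the product of \<open>I - \<Delta>\<close> over the shifts in \<open>J\<close>, applied to \<open>P\<close>. For Beurling tuples \<open>F
  UNIV\<close> turns out to be the projection onto the wandering subspace of the range of \<open>P\<close>.
\<close>

definition F :: "'n set \<Rightarrow> ('n \<Rightarrow> nat, 'h) ell2 \<Rightarrow> ('n \<Rightarrow> nat, 'h) ell2" where
  "F J = op_prod (\<lambda>k. id_minus_conj (M k)) J P"

lemma F_empty [simp]: "F {} x = P x"
  by (simp add: F_def)

lemma M_commute: "M i (M j x) = M j (M i x)"
  by (rule mshift_commute)

lemma Ms_commute: "cadjoint (M i) (cadjoint (M j) x) = cadjoint (M j) (cadjoint (M i) x)"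
  unfolding cadjoint_mshift by (rule mbshift_commute)

lemma F_insert: "i \<notin> J \<Longrightarrow> F (insert i J) x = F J x - M i (F J (Ms i x))"
  using op_prod_id_minus_conj_insert_apply[of M, OF bounded_clinear_mshift M_commute Ms_commute, of
      J i P x]
  by (simp add: F_def cadjoint_mshift)

lemma F_UNIV: "F UNIV x = F (UNIV - {j}) x - M j (F (UNIV - {j}) (Ms j x))"
  using F_insert[of j "UNIV - {j}" x] by (simp add: insert_absorb)

lemma bounded_clinear_Ms: "bounded_clinear (cadjoint (M i))"
  unfolding cadjoint_mshift by (rule bounded_clinear_mbshift)

lemma bounded_clinear_F: "bounded_clinear (F J)"
  unfolding F_def
  by (rule bounded_clinear_op_prod_id_minus_conj_family[of M, OF bounded_clinear_mshift M_commute
        Ms_commute bounded_clinear_Ms bounded_clinear_P]) simp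

lemmas F_simps = bounded_clinear_simps[OF bounded_clinear_F]

lemma finite_index_set_induct [case_names empty insert]:
  fixes J :: "'n set"
  assumes "Q {}" "\<And>i J. i \<notin> J \<Longrightarrow> Q J \<Longrightarrow> Q (insert i J)"
  shows "Q J"
proof -
  have "finite J" by simp
  thus ?thesis by (induction J rule: finite_induct) (use assms in auto)
qed

lemma F_P [simp]: "F J (P x) = F J x"
proof (induction J arbitrary: x rule: finite_index_set_induct)
  case (insert i J)
  have "F J (Ms i (P x)) = F J (Ms i x)"
    using insert.IH[of "Ms i (P x)"] insert.IH[of "Ms i x"] by simp
  thus ?case by (simp add: F_insert insert)
qed simp

lemma cinner_F: "cinner (F J x) y = cinner x (F J y)"
proof (induction J arbitrary: x y rule: finite_index_set_induct)
  case empty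
  show ?case by (simp add: cinner_P)
next
  case (insert i J)
  have "cinner (M i (F J (Ms i x))) y = cinner x (M i (F J (Ms i y)))"
    by (simp only: cinner_mshift insert.IH cinner_mbshift[symmetric])
  thus ?case by (simp only: F_insert[OF insert(1)] cinner_diff_left cinner_diff_right insert.IH)
qed

lemma P_F [simp]: "P (F J x) = F J x"
  by (rule cinner_ext) (simp add: cinner_P cinner_F)

lemma dil_adj_F [simp]: "dil_adj (F J x) = 0"
  using dil_adj_P[of "F J x"] by (simp del: dil_adj_P)

lemma F_dil [simp]: "F J (dil h) = 0"
  using F_P[of J "dil h"] by (simp add: F_simps del: F_P)

lemma F_coeffs_in: "x \<in> coeffs_in (first_defect_space T) \<Longrightarrow> F J x \<in> coeffs_in (first_defect_space T)"
proof (induction J arbitrary: x rule: finite_index_set_induct)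
  case (insert i J)
  thus ?case unfolding F_insert[OF insert(1)]
    by (intro csubspace_diff closed_csubspace_coeffs_in closed_csubspace_first_defect_space
        mshift_coeffs_in insert.IH mbshift_coeffs_in insert.prems)
qed (simp add: P_coeffs_in)

lemma F_M_dil: "F UNIV (M i (dil h)) = F (UNIV - {i}) (M i (dil h))"
  by (simp add: F_UNIV[of _ i] M_simps)

text \<open>Compressing \<open>F J\<close> to the dilation space turns conjugation by shifts into conjugation by \<open>T\<close>.\<close>

lemma compress_F:
  assumes "i \<notin> J" "j \<notin> J"
  shows "dil_adj (Ms i (F J (M j (dil h)))) =
    op_prod (\<lambda>k. id_minus_conj (T k)) J (\<lambda>x. dil_adj (Ms i (P (M j (dil x))))) h"
  using assms
proof (induction J arbitrary: h rule: finite_index_set_induct)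
  case (insert k J)
  hence kij: "k \<noteq> i" "k \<noteq> j" by auto
  have "Ms k (M j (dil h)) = M j (dil (Ts k h))"
    using kij by (simp add: mbshift_unit_mshift_unit dil_Ts)
  moreover have "dil_adj (Ms i (M k x)) = T k (dil_adj (Ms i x))" for x
    using kij by (simp add: mbshift_unit_mshift_unit dil_adj_M)
  ultimately show ?case
    using insert by (simp add: F_insert Ms_simps dil_adj_simps op_prod_id_minus_conj_insert)
qed simp

lemma nonneg_defect_sq: "nonneg_op (\<lambda>x. x - Ts i (T i x))"
proof (rule nonneg_opI)
  show "bounded_clinear (\<lambda>x. x - Ts i (T i x))"
    by (rule bounded_clinear_minus_op[OF bounded_clinear_id
        bounded_clinear_compose[OF bounded_clinear_Ts bounded_clinear_T]])
  show "cinner (x - Ts i (T i x)) y = cinner x (y - Ts i (T i y))" for x y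
    by (simp add: cinner_diff_left cinner_diff_right cinner_T'[symmetric] cinner_T[symmetric])
  show "0 \<le> inner (x - Ts i (T i x)) x" for x
  proof -
    have "inner (Ts i (T i x)) x = (norm (T i x))\<^sup>2"
      by (simp add: inner_eq_Re_cinner cinner_T'[symmetric] cinner_self)
    moreover have "(norm (T i x))\<^sup>2 \<le> (norm x)\<^sup>2" by (intro power_mono norm_T_le) simp
    ultimately show ?thesis by (simp add: inner_diff_left dot_square_norm)
  qed
qed

lemma defect_sq: "defect (T i) (defect (T i) x) = x - Ts i (T i x)"
  unfolding defect_def by (rule op_sqrt_sq[OF nonneg_defect_sq])

lemma compress_P_diag: "dil_adj (Ms i (P (M i (dil x)))) = defect (T i) (defect (T i) x)"
  by (simp add: P_def Ms_simps dil_adj_simps dil_adj_M dil_Ts defect_sq)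

lemma compress_P_offdiag:
  "i \<noteq> j \<Longrightarrow> dil_adj (Ms i (P (M j (dil x)))) = T j (Ts i x) - Ts i (T j x)"
  by (simp add: P_def Ms_simps dil_adj_simps dil_adj_M dil_Ts mbshift_unit_mshift_unit)

text \<open>The entries of the squared joint defect operator.\<close>

lemma compress_wandering:
  "dil_adj (Ms i (F UNIV (M j (dil h)))) =
    (if i = j then defect_diag T j else defect_offdiag T i j) h"
proof (cases "i = j")
  case True
  have "(\<lambda>x. dil_adj (Ms j (P (M j (dil x))))) = defect (T j) \<circ> defect (T j)"
    by (simp add: compress_P_diag fun_eq_iff)
  thus ?thesis using True by (simp add: F_M_dil compress_F defect_diag_def)
next
  case False
  define J where "J = UNIV - {i, j}"
  have J: "UNIV - {j} = insert i J" "i \<notin> J" "j \<notin> J" using False by (auto simp: J_def)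
  have "(\<lambda>x. dil_adj (Ms i (P (M j (dil x))))) = (\<lambda>x. T j (Ts i x) - Ts i (T j x))"
    using False by (simp add: compress_P_offdiag fun_eq_iff)
  thus ?thesis using False J(2,3)
    by (simp add: F_M_dil J(1) F_insert Ms_simps dil_adj_simps compress_F defect_offdiag_def J_def)
qed

text \<open>
  The operator that the determining formula of the characteristic function defines. For Beurling
  tuples its values turn out to be dense in the subspace of those wandering vectors that have
  coefficients in the first defect space.
\<close>

definition Phi :: "'h ^ 'n \<Rightarrow> ('n \<Rightarrow> nat, 'h) ell2" where
  "Phi h = (\<Sum>i\<in>UNIV. F UNIV (M i (dil (h $ i))))"

lemma bounded_clinear_vec_nth: "bounded_clinear (\<lambda>h :: 'h ^ 'n. h $ i)"
  by (rule bounded_clinearI[where K=1]) (simp_all add: scaleC_vec_def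
      Finite_Cartesian_Product.norm_nth_le)

lemma bounded_clinear_Phi: "bounded_clinear Phi"
  unfolding Phi_def
  by (rule bounded_clinear_sum_op, rule bounded_clinear_compose[OF bounded_clinear_F],
      rule bounded_clinear_compose[OF bounded_clinear_mshift],
      rule bounded_clinear_compose[OF bounded_clinear_dil bounded_clinear_vec_nth])

lemma Phi_axis: "Phi (axis i g) = F UNIV (M i (dil g))"
proof -
  have "Phi (axis i g) = (\<Sum>j\<in>UNIV. if j = i then F UNIV (M i (dil g)) else 0)"
    unfolding Phi_def by (rule sum.cong) (auto simp: axis_def dil_simps M_simps F_simps)
  thus ?thesis by simp
qed

lemma Phi_coeffs_in: "Phi h \<in> coeffs_in (first_defect_space T)"
  unfolding Phi_def
  by (intro csubspace_sum closed_csubspace_coeffs_in closed_csubspace_first_defect_space F_coeffs_in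
      mshift_coeffs_in dil_coeffs_in)

lemma joint_defect_sq_nth: "joint_defect_sq T h $ i = dil_adj (Ms i (Phi h))"
  by (simp add: joint_defect_sq_def Phi_def Ms_simps dil_adj_simps compress_wandering)

end

section \<open>Beurling tuples\<close>

text \<open>A fixed Beurling tuple.\<close>

locale beurling =
  fixes T :: "'n::finite \<Rightarrow> 'h::chilbert_space \<Rightarrow> 'h"
  assumes beurling: "beurling_tuple T"

sublocale beurling \<subseteq> szego
  using beurling by unfold_locales (simp add: beurling_tuple_def)

context beurling
begin

lemma defect_defect: "i \<noteq> j \<Longrightarrow> defect (T i) (defect (T j) x) = 0"
proof -
  assume "i \<noteq> j"
  hence "defect (T i) \<circ> defect (T j) = (\<lambda>x. 0)" using beurling unfolding beurling_tuple_def by blast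
  thus ?thesis by (simp add: fun_eq_iff)
qed

text \<open>
  The operators \<open>A i = P \<circ> M i \<circ> dil\<close> satisfy \<open>A i\<^sup>* A i = I - T i\<^sup>* T i\<close>, the square of the defect
  operator; since the defect operators annihilate each other, \<open>A i A j\<^sup>* = 0\<close> for \<open>i \<noteq> j\<close>.
\<close>

lemma cross_terms_vanish:
  assumes "i \<noteq> j"
  shows "P (M i (dil (dil_adj (Ms j (P x))))) = 0"
proof -
  define A where "A i h = P (M i (dil h))" for i h
  define B where "B i y = dil_adj (Ms i (P y))" for i y
  have AB: "cinner (A i h) y = cinner h (B i y)" for i h y
    by (simp add: A_def B_def cinner_P cinner_mshift cinner_dil_adj')
  have BA_adj: "cinner (B i y) h = cinner y (A i h)" for i h y
    using AB[of i h y] by (metis cinner_commute)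
  have BA: "B i (A i h) = defect (T i) (defect (T i) h)" for i h
    by (simp add: A_def B_def compress_P_diag)
  have A_defect: "A i (defect (T j) h) = 0" if "i \<noteq> j" for i j h
  proof -
    let ?g = "defect (T j) h"
    have "cinner (A i ?g) (A i ?g) = cinner ?g (defect (T i) (defect (T i) ?g))"
      by (simp only: AB BA)
    also have "defect (T i) (defect (T i) ?g) = 0"
      using that bounded_clinear_zero[OF bounded_clinear_op_sqrt[OF nonneg_defect_sq]]
      by (simp add: defect_defect) (simp add: defect_def)
    finally show ?thesis by simp
  qed
  define u where "u = B j x"
  have "cinner (A i u) (A i u) = cinner (B j x) (B i (A i u))" by (simp only: AB u_def)
  also have "\<dots> = cinner x (A j (B i (A i u)))" by (rule BA_adj)
  also have "A j (B i (A i u)) = 0" unfolding BA by (rule A_defect[OF assms[symmetric]])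
  finally show ?thesis by (simp add: A_def B_def u_def)
qed

text \<open>The restrictions of the shifts to the range of \<open>P\<close> doubly commute.\<close>

lemma doubly_commute:
  assumes "i \<noteq> j"
  shows "P (Ms i (M j (P x))) = M j (P (Ms i (P x)))"
proof -
  have "Ms i (P x) = P (Ms i (P x)) + dil (dil_adj (Ms i (P x)))" by (simp add: P_def)
  hence "P (M j (Ms i (P x))) = P (M j (P (Ms i (P x)))) + P (M j (dil (dil_adj (Ms i (P x)))))"
    by (metis M_simps(1) P_simps(1))
  also have "\<dots> = M j (P (Ms i (P x)))"
    by (simp only: cross_terms_vanish[OF assms[symmetric]] P_mshift_P) simp
  finally show ?thesis using assms by (simp only: mbshift_unit_mshift_unit[OF assms])
qed

lemma doubly_commute_mshift:
  assumes "l i = 0"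
  shows "P (Ms i (mshift l (P x))) = mshift l (P (Ms i (P x)))"
  using assms
proof (induction l rule: multi_index_induct)
  case (step l j)
  hence ij: "i \<noteq> j" and li: "l i = 0" by (auto simp: unit_index_def split: if_splits)
  have "P (Ms i (M j (mshift l (P x)))) = M j (P (Ms i (mshift l (P x))))"
    using doubly_commute[OF ij, of "mshift l (P x)"] by (simp only: P_mshift_P)
  also have "P (Ms i (mshift l (P x))) = mshift l (P (Ms i (P x)))" by (rule step.IH[OF li])
  finally show ?case by (simp only: mshift_mshift)
qed simp

lemma F_M_P: "j \<notin> J \<Longrightarrow> F J (M j (P x)) = M j (F J (P x))"
proof (induction J arbitrary: x rule: finite_index_set_induct)
  case (insert k J)
  hence kj: "k \<noteq> j" and jJ: "j \<notin> J" by auto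
  have "F J (Ms k (M j (P x))) = F J (P (Ms k (M j (P x))))" by (rule F_P[symmetric])
  also have "\<dots> = F J (M j (P (Ms k (P x))))" by (simp only: doubly_commute[OF kj])
  also have "\<dots> = M j (F J (Ms k (P x)))" by (simp only: insert.IH[OF jJ] F_P)
  finally have "M k (F J (Ms k (M j (P x)))) = M j (M k (F J (Ms k (P x))))"
    by (simp only: M_commute[of k j])
  thus ?case by (simp only: F_insert[OF insert(1)] insert.IH[OF jJ] M_simps)
qed simp

lemma wandering_M_P [simp]: "F UNIV (M j (P x)) = 0"
  unfolding F_UNIV[of _ j] using F_M_P[of j "UNIV - {j}" x] by simp

lemma P_Ms_wandering [simp]: "P (Ms j (F UNIV x)) = 0"
proof (rule cinner_ext)
  fix y
  show "cinner (P (Ms j (F UNIV x))) y = cinner 0 y"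
    by (simp only: cinner_P cinner_mbshift cinner_F wandering_M_P) simp
qed

lemma wandering_idem [simp]: "F UNIV (F UNIV x) = F UNIV x"
proof -
  have "F J (F UNIV x) = F UNIV x" for J
  proof (induction J rule: finite_index_set_induct)
    case (insert i J)
    have "F J (Ms i (F UNIV x)) = F J (P (Ms i (F UNIV x)))" by (rule F_P[symmetric])
    also have "\<dots> = 0" by (simp only: P_Ms_wandering F_simps)
    finally show ?case using insert by (simp add: F_insert M_simps)
  qed simp
  thus ?thesis .
qed

lemma wandering_orthogonal:
  assumes "k \<noteq> l"
  shows "cinner (mshift k (F UNIV x)) (mshift l (F UNIV y)) = 0"
proof -
  have main: "cinner (mshift k (F UNIV x)) (mshift l (F UNIV y)) = 0" if "l i < k i" for k l i x y
  proof -
    \<comment> \<open>cancel the common power of \<open>M i\<close>, and move one of the remaining factors to the other side\<close>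
    define c where "c = (\<lambda>j. l i * unit_index i j)"
    define k' where "k' = (\<lambda>j. k j - Suc (l i) * unit_index i j)"
    define l' where "l' = l(i := 0)"
    have k: "mshift k = (\<lambda>x. mshift c (M i (mshift k' x)))"
      unfolding mshift_mshift using that by (intro ext arg_cong2[of _ _ _ _ mshift])
        (auto simp: c_def k'_def unit_index_def fun_eq_iff)
    have l: "mshift l = (\<lambda>x. mshift c (mshift l' x))"
      unfolding mshift_mshift by (intro ext arg_cong2[of _ _ _ _ mshift])
        (auto simp: c_def l'_def unit_index_def fun_eq_iff)
    have "cinner (mshift k (F UNIV x)) (mshift l (F UNIV y)) =
        cinner (M i (mshift k' (F UNIV x))) (mshift l' (F UNIV y))"
      unfolding k l by (simp only: cinner_mshift[of c] mbshift_mshift)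
    also have "\<dots> = cinner (mshift k' (P (F UNIV x))) (Ms i (mshift l' (P (F UNIV y))))"
      by (simp only: cinner_mshift P_F)
    also have "\<dots> = cinner (mshift k' (P (F UNIV x))) (P (Ms i (mshift l' (P (F UNIV y)))))"
      by (simp only: cinner_P[symmetric] P_mshift_P)
    also have "P (Ms i (mshift l' (P (F UNIV y)))) = mshift l' (P (Ms i (P (F UNIV y))))"
      by (rule doubly_commute_mshift) (simp add: l'_def)
    also have "\<dots> = 0" by (simp add: bounded_clinear_zero[OF bounded_clinear_mshift])
    finally show ?thesis by simp
  qed
  obtain i where "k i \<noteq> l i" using assms by auto
  hence "l i < k i \<or> k i < l i" by linarith
  thus ?thesis
  proof
    assume "l i < k i"
    thus ?thesis by (rule main[where k=k and l=l and i=i])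
  next
    assume "k i < l i"
    hence "cinner (mshift l (F UNIV y)) (mshift k (F UNIV x)) = 0"
      by (rule main[where k=l and l=k and i=i])
    thus ?thesis by (metis cinner_commute complex_cnj_zero)
  qed
qed

text \<open>
  The translates of the wandering subspace span the range of \<open>P\<close>. The factors \<open>I - \<Delta>\<close> of \<open>F UNIV\<close>
  are removed one at a time: if \<open>(I - \<Delta>)(X)\<close> vanishes along the orbit of \<open>y\<close> under \<open>Ms i\<close>, then
  \<open>norm (X y) = norm (X ((Ms i ^^ m) y))\<close> for all \<open>m\<close>, which tends to 0.
\<close>

lemma wandering_complete:
  assumes "\<And>k. F UNIV (mbshift k x) = 0"
  shows "P x = 0"
proof -
  have "\<forall>k. F (UNIV - I) (mbshift k x) = 0" for I
  proof (induction I rule: finite_index_set_induct)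
    case empty
    thus ?case using assms by simp
  next
    case (insert i I)
    define J where "J = UNIV - insert i I"
    have J: "UNIV - I = insert i J" "i \<notin> J" using insert(1) by (auto simp: J_def)
    have step: "F J (mbshift k x) = M i (F J (Ms i (mbshift k x)))" for k
      using insert.IH F_insert[OF J(2), of "mbshift k x"] by (simp add: J(1))
    have "F J (mbshift k x) = 0" for k
    proof -
      have norm_eq: "norm (F J (mbshift k x)) = norm (F J ((Ms i ^^ m) (mbshift k x)))" for m k
      proof (induction m arbitrary: k)
        case (Suc m)
        have "norm (F J (mbshift k x)) = norm (F J (Ms i (mbshift k x)))"
          by (subst step) simp
        also have "\<dots> = norm (F J ((Ms i ^^ m) (Ms i (mbshift k x))))"
          using Suc[of "\<lambda>j. k j + unit_index i j"] by (simp add: mbshift_mbshift)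
        finally show ?case by (simp add: funpow_swap1)
      qed simp
      have "(\<lambda>m. F J ((Ms i ^^ m) (mbshift k x))) \<longlonglongrightarrow> F J 0"
        by (rule bounded_clinear_tendsto[OF bounded_clinear_F mbshift_unit_tendsto_0])
      hence "(\<lambda>m. norm (F J ((Ms i ^^ m) (mbshift k x)))) \<longlonglongrightarrow> 0"
        using tendsto_norm by (fastforce simp: F_simps)
      hence "(\<lambda>m. norm (F J (mbshift k x))) \<longlonglongrightarrow> 0" by (simp only: norm_eq[symmetric])
      hence "norm (F J (mbshift k x)) = 0" using LIMSEQ_const_iff by blast
      thus ?thesis by simp
    qed
    thus ?case by (simp add: J_def)
  qed
  from this[of UNIV] have "F {} (mbshift (\<lambda>_. 0) x) = 0" by (simp del: mbshift_zero F_empty)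
  thus ?thesis by simp
qed

lemma Phi_wandering [simp]: "F UNIV (Phi h) = Phi h"
  by (simp add: Phi_def F_simps)

lemma cinner_joint_defect_sq: "cinner (joint_defect_sq T h) g = cinner (Phi h) (Phi g)"
proof -
  have "cinner (joint_defect_sq T h) g = (\<Sum>i\<in>UNIV. cinner (Phi h) (M i (dil (g $ i))))"
    by (simp add: cinner_vec_def joint_defect_sq_nth cinner_dil_adj cinner_mbshift)
  also have "\<dots> = (\<Sum>i\<in>UNIV. cinner (Phi h) (F UNIV (M i (dil (g $ i)))))"
    by (simp only: cinner_F[symmetric] Phi_wandering)
  finally show ?thesis by (simp add: Phi_def[of g] cinner_sum_right)
qed

lemma nonneg_joint_defect_sq: "nonneg_op (joint_defect_sq T)"
proof (rule nonneg_opI)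
  have "joint_defect_sq T = (\<lambda>h. cadjoint Phi (Phi h))"
    by (rule bounded_clinear_ext_cinner)
       (simp add: cinner_joint_defect_sq cinner_cadjoint'[OF bounded_clinear_Phi, symmetric])
  thus "bounded_clinear (joint_defect_sq T)"
    using bounded_clinear_compose[OF bounded_clinear_cadjoint[OF bounded_clinear_Phi]
        bounded_clinear_Phi]
    by simp
  show "cinner (joint_defect_sq T x) y = cinner x (joint_defect_sq T y)" for x y
    using cinner_joint_defect_sq[of x y] cinner_joint_defect_sq[of y x] by (metis cinner_commute)
  show "0 \<le> inner (joint_defect_sq T x) x" for x
    by (simp add: inner_eq_Re_cinner cinner_joint_defect_sq cinner_self)
qed

lemma bounded_clinear_joint_defect: "bounded_clinear (joint_defect T)"
  unfolding joint_defect_def by (rule bounded_clinear_op_sqrt[OF nonneg_joint_defect_sq])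

lemma norm_joint_defect: "norm (joint_defect T h) = norm (Phi h)"
proof -
  have "(norm (joint_defect T h))\<^sup>2 = Re (cinner (joint_defect_sq T h) h)"
    unfolding joint_defect_def norm_op_sqrt[OF nonneg_joint_defect_sq] by (rule inner_eq_Re_cinner)
  also have "\<dots> = (norm (Phi h))\<^sup>2"
    by (simp only: cinner_joint_defect_sq cinner_self Re_complex_of_real)
  finally show ?thesis by simp
qed

lemma closed_csubspace_joint_defect_space: "closed_csubspace (joint_defect_space T)"
  unfolding joint_defect_space_def
    by (rule closed_csubspace_closure_range[OF bounded_clinear_joint_defect])

lemma joint_defect_in: "joint_defect T h \<in> joint_defect_space T"
  unfolding joint_defect_space_def using closure_subset[of "range (joint_defect T)"] by auto

text \<open>The wandering subspace, within the functions with values in the first defect space.\<close>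

definition W :: "('n \<Rightarrow> nat, 'h) ell2 set" where
  "W = {x. F UNIV x = x} \<inter> coeffs_in (first_defect_space T)"

lemma closed_csubspace_W: "closed_csubspace W"
proof -
  have "closed_csubspace {x. F UNIV x = x}"
    unfolding closed_csubspace_def
  proof (intro conjI ballI allI)
    have "closed {x. (\<lambda>x. F UNIV x - x) x \<in> {0}}"
    proof (rule closed_vimage[unfolded vimage_def])
      have "bounded_linear (\<lambda>x. F UNIV x - x)"
        by (rule bounded_clinear_bounded_linear, rule bounded_clinear_minus_op[OF bounded_clinear_F
            bounded_clinear_id])
      thus "continuous_on UNIV (\<lambda>x. F UNIV x - x)" by (rule linear_continuous_on)
    qed simp
    thus "closed {x. F UNIV x = x}" by simp
  qed (auto simp: F_simps)
  thus ?thesis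
    using closed_csubspace_coeffs_in[OF closed_csubspace_first_defect_space]
    unfolding W_def closed_csubspace_def by auto
qed

lemma Phi_in_W: "Phi h \<in> W"
  by (simp add: W_def Phi_coeffs_in)

text \<open>
  A vector of \<open>W\<close> orthogonal to the range of \<open>Phi\<close> is annihilated by all backward shifts, so it is
  constant. Its value lies in the first defect space, and it is orthogonal to the range of \<open>D\<close>
  because the vector is orthogonal to the range of the dilation. Hence it vanishes.
\<close>

lemma Phi_total:
  assumes y: "y \<in> W" and orth: "\<And>h. cinner (Phi h) y = 0"
  shows "y = 0"
proof -
  have Fy: "F UNIV y = y" using y by (simp add: W_def)
  have Ms0: "Ms i y = 0" for i
  proof -
    have "cinner (dil_adj (Ms i y)) g = 0" for g
    proof -
      have "cinner (dil_adj (Ms i y)) g = cinner y (M i (dil g))"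
        by (simp add: cinner_dil_adj cinner_mbshift)
      also have "\<dots> = cinner y (Phi (axis i g))" by (simp add: Phi_axis cinner_F[symmetric] Fy)
      also have "\<dots> = 0" using orth by (metis cinner_commute complex_cnj_zero)
      finally show ?thesis .
    qed
    hence "dil_adj (Ms i y) = 0" by (intro cinner_ext) simp
    hence "P (Ms i y) = Ms i y" by (rule P_id)
    thus ?thesis using P_Ms_wandering[of i y] by (simp add: Fy)
  qed
  have nz: "ell2_nth y k = 0" if k: "k \<noteq> (\<lambda>_. 0)" for k
  proof -
    obtain i where "k i \<noteq> 0" using k by (auto simp: fun_eq_iff)
    hence i: "k i > 0" by simp
    have "ell2_nth (Ms i y) (k(i := k i - 1)) = ell2_nth y k"
      using i by (auto simp: mbshift_nth unit_index_def intro!: arg_cong[of _ _ "ell2_nth y"])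
    thus ?thesis by (simp add: Ms0)
  qed
  define y0 where "y0 = ell2_nth y (\<lambda>_. 0)"
  have "dil_adj y = 0" using dil_adj_F[of UNIV y] by (simp add: Fy)
  hence "cinner (dil h) y = 0" for h by (simp add: cinner_dil_adj'[symmetric])
  moreover have "cinner (dil h) y = cinner (D h) y0" for h
  proof (rule has_sum_unique[OF ell2_cinner])
    show "((\<lambda>i. cinner (ell2_nth (dil h) i) (ell2_nth y i)) has_sum cinner (D h) y0) UNIV"
      by (rule has_sum_finite_neutralI[where B="{\<lambda>_. 0}"]) (auto simp: nz dil_nth Tspow_zero y0_def)
  qed
  ultimately have D0: "cinner (D h) y0 = 0" for h by simp
  have "y0 \<in> closure (range D)"
    using y by (simp add: W_def coeffs_in_def y0_def first_defect_space_def)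
  then obtain f where f: "\<And>n. f n \<in> range D" "f \<longlonglongrightarrow> y0" by (auto simp: closure_sequential)
  have "cinner (f n) y0 = 0" for n using f(1)[of n] D0 by auto
  hence "(\<lambda>n. 0) \<longlonglongrightarrow> cinner y0 y0" using tendsto_cinner_left[OF f(2), of y0] by simp
  hence "cinner y0 y0 = 0" using LIMSEQ_const_iff by metis
  hence "y0 = 0" by simp
  show ?thesis
  proof (rule ell2_eqI)
    fix k
    show "ell2_nth y k = ell2_nth 0 k"
      by (cases "k = (\<lambda>_. 0)") (use \<open>y0 = 0\<close> in \<open>simp_all add: nz y0_def\<close>)
  qed
qed

end

section \<open>The characteristic function\<close>

context beurling
begin

abbreviation first_space :: "'h set" where "first_space \<equiv> first_defect_space T"
abbreviation joint_space :: "('h ^ 'n) set" where "joint_space \<equiv> joint_defect_space T"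

text \<open>
  The unitary from the joint defect space onto \<open>W\<close>, extended to a partial isometry on all of \<open>'h ^
  'n\<close>.
\<close>

lemma partial_isometry_exists:
  "\<exists>V. bounded_clinear V \<and> (\<forall>h. V (joint_defect T h) = Phi h) \<and>
    (\<forall>x. V x \<in> W \<and> norm (V x) \<le> norm x) \<and> (\<forall>d\<in>joint_space. norm (V d) = norm d)"
proof -
  have "closure (range Phi) \<subseteq> W"
    using closed_csubspace_W Phi_in_W by (intro closure_minimal) (auto simp: closed_csubspace_def)
  moreover obtain V where "bounded_clinear V" "\<And>h. V (joint_defect T h) = Phi h"
    "\<And>x. V x \<in> closure (range Phi)" "\<And>x. norm (V x) \<le> norm x"
    "\<And>d. d \<in> closure (range (joint_defect T)) \<Longrightarrow> norm (V d) = norm d"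
    using partial_isometry_extension[OF bounded_clinear_joint_defect bounded_clinear_Phi
        norm_joint_defect]
    by metis
  ultimately show ?thesis unfolding joint_defect_space_def by (intro exI[of _ V]) auto
qed

definition V :: "'h ^ 'n \<Rightarrow> ('n \<Rightarrow> nat, 'h) ell2" where
  "V = (SOME V. bounded_clinear V \<and> (\<forall>h. V (joint_defect T h) = Phi h) \<and>
    (\<forall>x. V x \<in> W \<and> norm (V x) \<le> norm x) \<and> (\<forall>d\<in>joint_space. norm (V d) = norm d))"

lemma bounded_clinear_V: "bounded_clinear V"
  and V_joint_defect: "V (joint_defect T h) = Phi h"
  and V_in_W: "V x \<in> W"
  and norm_V_le: "norm (V x) \<le> norm x"
  and norm_V: "d \<in> joint_space \<Longrightarrow> norm (V d) = norm d"
  using someI_ex[OF partial_isometry_exists] unfolding V_def[symmetric] by auto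

lemmas V_simps = bounded_clinear_simps[OF bounded_clinear_V]

lemma V_image: "V ` joint_space = W"
proof (rule isometry_onto[OF closed_csubspace_joint_defect_space bounded_clinear_V norm_V
      closed_csubspace_W V_in_W])
  fix y assume y: "y \<in> W" "\<And>x. x \<in> joint_space \<Longrightarrow> cinner (V x) y = 0"
  show "y = 0"
    by (rule Phi_total[OF y(1)]) (simp add: y(2)[OF joint_defect_in] V_joint_defect[symmetric])
qed

lemma F_V [simp]: "F UNIV (V x) = V x"
  using V_in_W[of x] by (simp add: W_def)

lemma V_coeffs_in: "V x \<in> coeffs_in first_space"
  using V_in_W[of x] by (simp add: W_def)

text \<open>
  Multiplication by the characteristic function, in terms of Taylor coefficients. On families in the
  joint defect space it is an isometry onto the orthogonal complement \<open>S\<close> of the range of the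
  dilation.
\<close>

definition N :: "('n \<Rightarrow> nat, 'h ^ 'n) ell2 \<Rightarrow> ('n \<Rightarrow> nat, 'h) ell2" where
  "N g = (\<Sum>\<^sub>\<infinity>k. mshift k (V (ell2_nth g k)))"

lemma N_orthogonal_sum:
  "((\<lambda>k. mshift k (V (ell2_nth g k))) has_sum N g) UNIV \<and>
   (norm (N g))\<^sup>2 = (\<Sum>\<^sub>\<infinity>k. (norm (V (ell2_nth g k)))\<^sup>2) \<and>
   (\<lambda>k. (norm (V (ell2_nth g k)))\<^sup>2) summable_on UNIV"
proof -
  have summ: "(\<lambda>k. (norm (V (ell2_nth g k)))\<^sup>2) summable_on UNIV"
    by (rule summable_on_comparison_test[OF ell2_summable[of g]]) (auto intro: power_mono norm_V_le)
  have "\<exists>s. ((\<lambda>k. mshift k (V (ell2_nth g k))) has_sum s) UNIV \<and>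
      (norm s)\<^sup>2 = (\<Sum>\<^sub>\<infinity>k. (norm (V (ell2_nth g k)))\<^sup>2)"
  proof (rule orthogonal_has_sum)
    show "cinner (mshift k (V (ell2_nth g k))) (mshift l (V (ell2_nth g l))) = 0" if "k \<noteq> l" for k l
      using wandering_orthogonal[OF that, of "V (ell2_nth g k)" "V (ell2_nth g l)"] by simp
  qed (simp add: summ)
  then obtain s where s: "((\<lambda>k. mshift k (V (ell2_nth g k))) has_sum s) UNIV"
      "(norm s)\<^sup>2 = (\<Sum>\<^sub>\<infinity>k. (norm (V (ell2_nth g k)))\<^sup>2)" by blast
  moreover have "s = N g" unfolding N_def using infsumI[OF s(1)] by simp
  ultimately show ?thesis using summ by simp
qed

lemmas N_has_sum = N_orthogonal_sum[THEN conjunct1]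

lemma norm_N: "g \<in> coeffs_in joint_space \<Longrightarrow> norm (N g) = norm g"
proof -
  assume "g \<in> coeffs_in joint_space"
  hence "(norm (N g))\<^sup>2 = (\<Sum>\<^sub>\<infinity>k. (norm (ell2_nth g k))\<^sup>2)"
    using N_orthogonal_sum[of g] by (simp add: coeffs_in_def norm_V)
  also have "\<dots> = (norm g)\<^sup>2" by (rule infsumI[OF ell2_norm])
  finally show ?thesis by simp
qed

lemma bounded_clinear_N: "bounded_clinear N"
proof (rule bounded_clinearI[where K=1])
  fix f g c
  show "N (f + g) = N f + N g"
    by (rule has_sum_unique[OF N_has_sum])
       (use has_sum_add[OF N_has_sum N_has_sum, of f g] in
         \<open>simp add: V_simps bounded_clinear_simps[OF bounded_clinear_mshift]\<close>)
  show "N (c *\<^sub>C f) = c *\<^sub>C N f"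
    by (rule has_sum_unique[OF N_has_sum])
       (use has_sum_bounded_linear[OF bounded_linear_scaleC_right N_has_sum, of c f] in
         \<open>simp add: V_simps bounded_clinear_simps[OF bounded_clinear_mshift]\<close>)
  have "(norm (N f))\<^sup>2 \<le> (\<Sum>\<^sub>\<infinity>k. (norm (ell2_nth f k))\<^sup>2)"
    using N_orthogonal_sum[of f] by (auto intro!: infsum_mono ell2_summable power_mono norm_V_le)
  also have "\<dots> = (norm f)\<^sup>2" by (rule infsumI[OF ell2_norm])
  finally have "norm (N f) \<le> norm f" by (rule power2_le_imp_le) simp
  thus "norm (N f) \<le> 1 * norm f" by simp
qed

text \<open>
  The orthogonal complement of the range of the dilation within the Hardy space of functions with
  values in the first defect space.
\<close>

definition S :: "('n \<Rightarrow> nat, 'h) ell2 set" where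
  "S = {x \<in> coeffs_in first_space. dil_adj x = 0}"

lemma closed_csubspace_S: "closed_csubspace S"
proof -
  have "closed {x. dil_adj x \<in> {0}}"
    using bounded_clinear_dil_adj
    by (intro closed_vimage[unfolded vimage_def] linear_continuous_on)
       (auto simp: bounded_clinear_def)
  thus ?thesis
    using closed_csubspace_coeffs_in[OF closed_csubspace_first_defect_space]
    unfolding S_def closed_csubspace_def
    by (auto simp: dil_adj_simps Collect_conj_eq)
qed

lemma mshift_V_in_S: "mshift k (V x) \<in> S"
proof -
  have PV: "P (V x) = V x" using P_F[of UNIV "V x"] by simp
  have "P (mshift k (V x)) = mshift k (V x)" using P_mshift_P[of k "V x"] by (simp only: PV)
  hence "dil_adj (mshift k (V x)) = 0" by (metis dil_adj_P)
  thus ?thesis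
    by (simp add: S_def mshift_coeffs_in[OF closed_csubspace_first_defect_space V_coeffs_in])
qed

lemma N_single: "\<exists>g \<in> coeffs_in joint_space. N g = mshift k (V d)" if "d \<in> joint_space"
proof -
  define g :: "('n \<Rightarrow> nat, 'h ^ 'n) ell2" where "g = Ell2 (\<lambda>m. if m = k then d else 0)"
  have "(\<lambda>m. (norm (if m = k then d else 0))\<^sup>2) summable_on UNIV"
    by (rule has_sum_imp_summable, rule has_sum_finite_neutralI[where B="{k}"]) auto
  hence g: "ell2_nth g m = (if m = k then d else 0)" for m
    by (simp add: g_def ell2_nth_Ell2)
  have "N g = mshift k (V d)"
  proof (rule has_sum_unique[OF N_has_sum])
    show "((\<lambda>m. mshift m (V (ell2_nth g m))) has_sum mshift k (V d)) UNIV"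
      by (rule has_sum_finite_neutralI[where B="{k}"])
         (auto simp: g V_simps bounded_clinear_simps[OF bounded_clinear_mshift])
  qed
  moreover have "g \<in> coeffs_in joint_space"
    using that csubspace_zero[OF closed_csubspace_joint_defect_space] by (simp add: coeffs_in_def g)
  ultimately show ?thesis by blast
qed

lemma N_image: "N ` coeffs_in joint_space = S"
proof (rule isometry_onto[OF closed_csubspace_coeffs_in[OF closed_csubspace_joint_defect_space]
      bounded_clinear_N norm_N closed_csubspace_S])
  show "N g \<in> S" for g
    by (rule csubspace_has_sum[OF closed_csubspace_S _ N_has_sum]) (rule mshift_V_in_S)
  fix y assume y: "y \<in> S" and orth: "\<And>g. g \<in> coeffs_in joint_space \<Longrightarrow> cinner (N g) y = 0"
  have "F UNIV (mbshift k y) = 0" for k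
  proof -
    have "F UNIV (mbshift k y) \<in> W"
      using y by (simp add: W_def S_def F_coeffs_in mbshift_coeffs_in)
    then obtain d where d: "d \<in> joint_space" "V d = F UNIV (mbshift k y)"
      unfolding V_image[symmetric] by auto
    obtain g where g: "g \<in> coeffs_in joint_space" "N g = mshift k (V d)" using N_single[OF d(1)]
      by blast
    have "cinner (V d) (V d) = cinner (F UNIV (V d)) (mbshift k y)"
      by (simp only: cinner_F d(2)[symmetric])
    also have "\<dots> = cinner (N g) y" by (simp add: g(2) cinner_mshift)
    also have "\<dots> = 0" by (rule orth[OF g(1)])
    finally show ?thesis by (simp add: d(2))
  qed
  hence "P y = 0" by (rule wandering_complete)
  thus "y = 0" using y P_id[of y] by (simp add: S_def)
qed

text \<open>The characteristic function, set to 0 outside the joint defect space.\<close>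

definition Theta :: "complex ^ 'n \<Rightarrow> 'h ^ 'n \<Rightarrow> 'h" where
  "Theta w x = (if x \<in> joint_space then hardy_fun (V x) w else 0)"

lemma bounded_clinear_hardy_fun_V: "bounded_clinear (\<lambda>x. hardy_fun (V x) w)"
  by (rule bounded_clinear_compose[OF bounded_clinear_hardy_fun bounded_clinear_V])

lemma restricted_in_ops:
  assumes "bounded_clinear A" "\<And>x. A x \<in> first_space"
  shows "(\<lambda>x. if x \<in> joint_space then A x else 0) \<in> ops joint_space first_space"
proof -
  note J = closed_csubspace_joint_defect_space
  obtain K where "\<And>x. norm (A x) \<le> K * norm x" using bounded_clinear_bound[OF assms(1)] by blast
  thus ?thesis
    using assms(2) csubspace_add[OF J] csubspace_scaleC[OF J]
    by (auto simp: ops_def bounded_clinear_simps[OF assms(1)])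
qed

lemma op_analytic_Theta: "op_analytic joint_space first_space Theta"
  unfolding op_analytic_def
proof (intro conjI ballI allI impI exI[of _ "\<lambda>k x.
    if x \<in> joint_space then ell2_nth (V x) k else 0"])
  fix w :: "complex ^ 'n"
  show "Theta w \<in> ops joint_space first_space"
    unfolding Theta_def
    by (rule restricted_in_ops[OF bounded_clinear_hardy_fun_V])
       (rule hardy_fun_in[OF closed_csubspace_first_defect_space V_coeffs_in])
  show "Theta w = (\<lambda>x. 0)" if "w \<notin> polydisc" using that by (simp add: Theta_def fun_eq_iff)
  show "(\<lambda>x. if x \<in> joint_space then ell2_nth (V x) k else 0) \<in> ops joint_space first_space" for k
    using V_coeffs_in
    by (intro restricted_in_ops bounded_clinear_compose[OF bounded_clinear_ell2_nth
        bounded_clinear_V])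
       (simp add: coeffs_in_def)
  show "((\<lambda>k. mpow w k *\<^sub>C (if x \<in> joint_space then ell2_nth (V x) k else 0)) has_sum Theta w x)
      UNIV"
    if "w \<in> polydisc" "x \<in> joint_space" for x
    using hardy_fun_has_sum[OF that(1), of "V x"] that(2) by (simp add: Theta_def)
qed

lemma Delta_MT_commute: "Delta_MT T i (Delta_MT T j X) = Delta_MT T j (Delta_MT T i X)"
  by (simp add: Delta_MT_def Mz_def fun_eq_iff Ts_commute[of i j] scaleC_diff_right scaleC_scaleC
      mult.commute algebra_simps)

lemma op_prod_Delta_MT_insert:
  "j \<notin> J \<Longrightarrow> op_prod (Delta_MT T) (insert j J) X = Delta_MT T j (op_prod (Delta_MT T) J X)"
  by (rule op_prod_insert[of "Delta_MT T", OF Delta_MT_commute]) simp_all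

lemma hardy_fun_F_M_dil:
  assumes "i \<notin> J"
  shows "(\<lambda>h. hardy_fun (F J (M i (dil h)))) =
    op_prod (Delta_MT T) J (\<lambda>x z. Mz i (canonical_dilation T x) z - canonical_dilation T (T i x) z)"
  using assms
proof (induction J rule: finite_index_set_induct)
  case empty
  show ?case
    by (simp add: fun_eq_iff P_def dil_adj_M canonical_dilation_eq Mz_hardy_fun hardy_fun_simps)
next
  case (insert j J)
  hence ij: "j \<noteq> i" "i \<notin> J" by auto
  have "hardy_fun (F (insert j J) (M i (dil h))) =
      Delta_MT T j (\<lambda>h. hardy_fun (F J (M i (dil h)))) h" for h
    using insert(1) ij
    by (simp add: fun_eq_iff Delta_MT_def Mz_hardy_fun F_insert hardy_fun_simps
        mbshift_unit_mshift_unit dil_Ts)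
  thus ?case
    by (simp only: op_prod_Delta_MT_insert[OF insert(1)] insert.IH[OF ij(2), symmetric])
qed

lemma hardy_fun_Phi:
  "hardy_fun (Phi h) w = (\<Sum>i\<in>UNIV. op_prod (Delta_MT T) (UNIV - {i})
     (\<lambda>x z. Mz i (canonical_dilation T x) z - canonical_dilation T (T i x) z) (h $ i) w)"
proof -
  have "hardy_fun (Phi h) w = (\<Sum>i\<in>UNIV. hardy_fun (F (UNIV - {i}) (M i (dil (h $ i)))) w)"
    by (simp add: Phi_def bounded_clinear_sum[OF bounded_clinear_hardy_fun] F_M_dil)
  thus ?thesis by (simp add: hardy_fun_F_M_dil[symmetric])
qed

lemma is_char_fun_Theta: "is_char_fun T Theta"
  unfolding is_char_fun_def
  using op_analytic_Theta joint_defect_in by (simp add: Theta_def V_joint_defect hardy_fun_Phi)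

text \<open>
  Operators on the joint defect space are determined by their values on the range of the joint
  defect operator, which is dense.
\<close>

lemma ops_eqI:
  assumes A: "A \<in> ops joint_space first_space" and B: "B \<in> ops joint_space first_space"
    and eq: "\<And>h. A (joint_defect T h) = B (joint_defect T h)"
  shows "A = B"
proof
  fix x
  show "A x = B x"
  proof (cases "x \<in> joint_space")
    case True
    note J = closed_csubspace_joint_defect_space
    have lim: "(\<lambda>n. C (f n)) \<longlonglongrightarrow> C x"
      if C: "C \<in> ops joint_space first_space" and f: "\<And>n. f n \<in> joint_space" "f \<longlonglongrightarrow> x" for C f
    proof -
      from C have "\<exists>K. \<forall>y\<in>joint_space. norm (C y) \<le> K * norm y" by (simp add: ops_def)
      then obtain K where K: "\<And>y. y \<in> joint_space \<Longrightarrow> norm (C y) \<le> K * norm y" by blast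
      have "C (f n - x + x) = C (f n - x) + C x" for n
        using C csubspace_diff[OF J f(1) True] True unfolding ops_def by blast
      hence diff: "C (f n) - C x = C (f n - x)" for n by (simp add: algebra_simps)
      have "(\<lambda>n. C (f n) - C x) \<longlonglongrightarrow> 0"
      proof (rule Lim_null_comparison)
        show "\<forall>\<^sub>F n in sequentially. norm (C (f n) - C x) \<le> K * norm (f n - x)"
          by (rule always_eventually) (simp add: diff K csubspace_diff[OF J f(1) True])
        have "(\<lambda>n. norm (f n - x)) \<longlonglongrightarrow> 0" using f(2) by (simp add: LIM_zero tendsto_norm_zero)
        from tendsto_mult_right_zero[OF this] show "(\<lambda>n. K * norm (f n - x)) \<longlonglongrightarrow> 0" .
      qed
      thus ?thesis by (rule LIM_zero_cancel)
    qed
    from True obtain f where f: "\<And>n. f n \<in> range (joint_defect T)" "f \<longlonglongrightarrow> x"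
      by (auto simp: joint_defect_space_def closure_sequential)
    have fJ: "f n \<in> joint_space" for n using f(1)[of n] joint_defect_in by auto
    have "A (f n) = B (f n)" for n using f(1)[of n] eq by auto
    thus ?thesis using LIMSEQ_unique[OF lim[OF A fJ f(2)]] lim[OF B fJ f(2)] by simp
  next
    case False
    thus ?thesis using A B by (simp add: ops_def)
  qed
qed

lemma is_char_fun_unique:
  assumes "is_char_fun T \<Theta>"
  shows "\<Theta> = Theta"
proof
  fix w
  show "\<Theta> w = Theta w"
  proof (cases "w \<in> polydisc")
    case True
    show ?thesis
    proof (rule ops_eqI)
      show "\<Theta> w \<in> ops joint_space first_space" "Theta w \<in> ops joint_space first_space"
        using assms is_char_fun_Theta True by (auto simp: is_char_fun_def op_analytic_def)
      show "\<Theta> w (joint_defect T h) = Theta w (joint_defect T h)" for h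
        using assms is_char_fun_Theta True by (simp add: is_char_fun_def)
    qed
  next
    case False
    thus ?thesis using assms is_char_fun_Theta by (simp add: is_char_fun_def op_analytic_def)
  qed
qed

lemma char_fun_eq: "char_fun T = Theta"
  unfolding char_fun_def by (rule the_equality, rule is_char_fun_Theta, rule is_char_fun_unique)

text \<open>For linear \<open>X\<close>, the product of the \<open>Delta_MT\<close> precomposes \<open>X\<close> with the product of pencils.\<close>

lemma op_prod_Delta_MT_eq:
  assumes X: "\<And>w x y. X (x - y) w = X x w - X y w" "\<And>w c x. X (c *\<^sub>C x) w = c *\<^sub>C X x w"
  shows "op_prod (Delta_MT T) J X h w = X (op_prod (pencil T w) J h) w"
proof (induction J arbitrary: h rule: finite_index_set_induct)
  case (insert j J)
  have "op_prod (Delta_MT T) (insert j J) X h w =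
      X (op_prod (pencil T w) J h) w - (w $ j) *\<^sub>C X (op_prod (pencil T w) J (Ts j h)) w"
    by (simp add: op_prod_Delta_MT_insert insert(1) Delta_MT_def Mz_def insert.IH)
  also have "op_prod (pencil T w) J (Ts j h) = Ts j (op_prod (pencil T w) J h)"
    by (rule op_prod_intertwine[of "pencil T w", OF pencil_commute, symmetric])
       (simp_all add: pencil_def Ts_simps Ts_commute[of j])
  also have "X (op_prod (pencil T w) J h) w - (w $ j) *\<^sub>C X (Ts j (op_prod (pencil T w) J h)) w =
      X (pencil T w j (op_prod (pencil T w) J h)) w"
    by (simp add: pencil_def X)
  finally show ?case by (simp add: op_prod_insert[of "pencil T w", OF pencil_commute] insert(1))
qed simp

lemma char_fun_formula:
  assumes w: "w \<in> polydisc"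
  shows "char_fun T w (joint_defect T h) =
    first_defect T (op_prod (\<lambda>k. inv (pencil T w k)) UNIV
      (\<Sum>j\<in>UNIV. (\<lambda>x. (w $ j) *\<^sub>C x - T j x) (op_prod (pencil T w) (UNIV - {j}) (h $ j))))"
proof -
  let ?x = "\<lambda>j. op_prod (pencil T w) (UNIV - {j}) (h $ j)"
  have X: "op_prod (Delta_MT T) (UNIV - {j})
      (\<lambda>x z. Mz j (canonical_dilation T x) z - canonical_dilation T (T j x) z) (h $ j) w =
      hardy_fun (dil ((w $ j) *\<^sub>C ?x j - T j (?x j))) w" for j
    by (subst op_prod_Delta_MT_eq)
       (simp_all add: canonical_dilation_eq Mz_def dil_simps hardy_fun_simps T_simps
         scaleC_diff_right scaleC_scaleC mult.commute algebra_simps)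
  have "char_fun T w (joint_defect T h) = hardy_fun (Phi h) w"
    by (simp add: char_fun_eq Theta_def joint_defect_in V_joint_defect)
  also have "\<dots> = (\<Sum>j\<in>UNIV. hardy_fun (dil ((w $ j) *\<^sub>C ?x j - T j (?x j))) w)"
    by (simp only: hardy_fun_Phi X)
  also have "\<dots> = canonical_dilation T (\<Sum>j\<in>UNIV. (w $ j) *\<^sub>C ?x j - T j (?x j)) w"
    by (simp only: canonical_dilation_eq bounded_clinear_sum[OF bounded_clinear_dil]
        bounded_clinear_sum[OF bounded_clinear_hardy_fun])
  finally show ?thesis using w by (simp add: canonical_dilation_def)
qed

section \<open>The model\<close>

lemma op_mult_Theta:
  assumes g: "g \<in> coeffs_in joint_space"
  shows "op_mult Theta (hardy_fun g) = hardy_fun (N g)"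
proof
  fix w
  show "op_mult Theta (hardy_fun g) w = hardy_fun (N g) w"
  proof (cases "w \<in> polydisc")
    case True
    have "hardy_fun g w \<in> joint_space"
      by (rule hardy_fun_in[OF closed_csubspace_joint_defect_space g])
    hence "op_mult Theta (hardy_fun g) w = hardy_fun (V (hardy_fun g w)) w"
      by (simp add: op_mult_def Theta_def)
    also have "\<dots> = hardy_fun (N g) w"
    proof (rule has_sum_unique)
      show "((\<lambda>k. hardy_fun (V (mpow w k *\<^sub>C ell2_nth g k)) w) has_sum
          hardy_fun (V (hardy_fun g w)) w) UNIV"
        by (rule bounded_clinear_has_sum[OF bounded_clinear_hardy_fun_V hardy_fun_has_sum[OF True]])
      show "((\<lambda>k. hardy_fun (V (mpow w k *\<^sub>C ell2_nth g k)) w) has_sum hardy_fun (N g) w) UNIV"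
        using bounded_clinear_has_sum[OF bounded_clinear_hardy_fun[of w] N_has_sum[of g]]
        by (simp add: V_simps hardy_fun_simps hardy_fun_mshift)
    qed
    finally show ?thesis .
  qed (simp add: op_mult_def Theta_def)
qed

lemma range_char_fun: "op_mult (char_fun T) ` hardy joint_space = hardy_fun ` S"
proof -
  have "op_mult (char_fun T) ` hardy joint_space = (\<lambda>g. hardy_fun (N g)) ` coeffs_in joint_space"
    unfolding hardy_eq_image char_fun_eq image_image
      by (rule image_cong) (simp_all add: op_mult_Theta)
  also have "\<dots> = hardy_fun ` S" unfolding N_image[symmetric] image_image ..
  finally show ?thesis .
qed

lemma model_space_eq: "model_space T = range (\<lambda>h. hardy_fun (dil h))"
proof (intro equalityI subsetI)
  fix f assume "f \<in> model_space T"
  then obtain x where x: "f = hardy_fun x" "x \<in> coeffs_in first_space"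
      "\<And>y. y \<in> S \<Longrightarrow> cinner x y = 0"
    by (auto simp: model_space_def hardy_ominus_def hardy_eq_image range_char_fun[unfolded
        hardy_eq_image]
        hardy_inner_hardy_fun)
  have "P x \<in> S" using x(2) by (simp add: S_def P_coeffs_in)
  hence "cinner x (P (P x)) = 0" using x(3) by simp
  hence "cinner (P x) (P x) = 0" by (simp only: cinner_P)
  hence "x = dil (dil_adj x)" by (simp add: P_def)
  hence "f = hardy_fun (dil (dil_adj x))" using x(1) by simp
  thus "f \<in> range (\<lambda>h. hardy_fun (dil h))" by (rule range_eqI)
next
  fix f assume "f \<in> range (\<lambda>h. hardy_fun (dil h))"
  then obtain h where "f = hardy_fun (dil h)" by auto
  thus "f \<in> model_space T"
    using dil_coeffs_in[of h]
    by (auto simp: model_space_def hardy_ominus_def range_char_fun hardy_eq_image[of first_space]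
        hardy_inner_hardy_fun cinner_dil_adj'[symmetric] S_def)
qed

lemma hardy_proj_model_space:
    "hardy_proj (model_space T) (hardy_fun x) = hardy_fun (dil (dil_adj x))"
  unfolding hardy_proj_def
proof (rule the_equality)
  have diff: "(\<lambda>w. hardy_fun x w - hardy_fun y w) = hardy_fun (x - y)" for y
    by (simp add: hardy_fun_simps fun_eq_iff)
  show "hardy_fun (dil (dil_adj x)) \<in> model_space T \<and>
      (\<forall>q\<in>model_space T. hardy_inner (\<lambda>w. hardy_fun x w - hardy_fun (dil (dil_adj x)) w) q = 0)"
    unfolding diff model_space_eq
    by (auto simp: hardy_inner_hardy_fun cinner_dil_adj[symmetric] dil_adj_simps)
  fix g assume g: "g \<in> model_space T \<and>
      (\<forall>q\<in>model_space T. hardy_inner (\<lambda>w. hardy_fun x w - g w) q = 0)"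
  then obtain h where h: "g = hardy_fun (dil h)" by (auto simp: model_space_eq)
  have "cinner (dil_adj (x - dil h)) h' = 0" for h'
    using g unfolding h diff model_space_eq by (auto simp: hardy_inner_hardy_fun cinner_dil_adj)
  hence "dil_adj (x - dil h) = 0" by (intro cinner_ext) simp
  thus "g = hardy_fun (dil (dil_adj x))" by (simp add: h dil_adj_simps)
qed

lemma unitarily_equivalent_model:
  "unitarily_equivalent T (model_space T) (model_op (model_space T))"
  unfolding unitarily_equivalent_def
proof (intro exI conjI allI ballI)
  let ?U = "\<lambda>h. hardy_fun (dil h)"
  have inj: "inj ?U"
  proof (rule injI)
    fix x y assume "?U x = ?U y"
    hence "dil x = dil y" by (rule injD[OF inj_hardy_fun])
    hence "dil_adj (dil x) = dil_adj (dil y)" by (rule arg_cong)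
    thus "x = y" by simp
  qed
  show "unitary_onto (model_space T) ?U"
    unfolding unitary_onto_def model_space_eq
    by (simp add: inj_on_imp_bij_betw[OF inj] dil_simps hardy_fun_simps fun_eq_iff
        hardy_inner_hardy_fun cinner_dil)
  fix i f assume "f \<in> model_space T"
  then obtain h where h: "f = ?U h" by (auto simp: model_space_eq)
  have "model_op (model_space T) i f = ?U (T i h)"
    by (simp add: h model_op_def Mz_hardy_fun hardy_proj_model_space dil_adj_M)
  thus "?U (T i (inv ?U f)) = model_op (model_space T) i f"
    by (simp add: h inv_f_f[OF inj])
qed

end

theorem theorem7p2:
  fixes T :: "'n::finite \<Rightarrow> 'h::chilbert_space \<Rightarrow> 'h"
  assumes "beurling_tuple T"
  shows "(\<exists>!\<Theta>. is_char_fun T \<Theta>) \<and>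
    (\<forall>w\<in>polydisc. \<forall>h :: 'h ^ 'n.
       char_fun T w (joint_defect T h) =
         first_defect T (op_prod (\<lambda>k. inv (pencil T w k)) UNIV
           (\<Sum>j\<in>UNIV. (\<lambda>x. (w $ j) *\<^sub>C x - T j x) (op_prod (pencil T w) (UNIV - {j}) (h $ j))))) \<and>
    unitarily_equivalent T (model_space T) (model_op (model_space T))"
proof -
  interpret beurling T by unfold_locales (rule assms)
  show ?thesis
    using is_char_fun_Theta is_char_fun_unique char_fun_formula unitarily_equivalent_model by blast
qed

end
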